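(* Let $f:[0,1]\to[0,1]$ be a continuous map without wandering intervals. Then there exists a residual subset $G\subset[0,1]$ such that for any $x\in G$ one of the following possibilities holds: 1) $\omega(x)$ is a cycle; 2) $\omega(x)$ is a solenoid; 3) $\omega(x)=\mathrm{orb}\,I$ is a cycle of intervals and $V_f(x)=M_{f|\mathrm{orb}\,I}$.
   Context: $\omega(x)$ is the set of limit points of the forward orbit of $x$. A cycle is the orbit of a periodic point. A (non-degenerate) interval $I$ is wandering if $f^nI\cap f^mI=\emptyset$ for all $n>m\ge0$ and $I$ does not tend to a cycle (i.e. the limit set of the points of $I$ is not a cycle). A closed interval $I$ is periodic of period $k$ if $I,fI,\dots,f^{k-1}I$ are pairwise disjoint and $f^kI=I$; then $\mathrm{orb}\,I=\bigcup_{i=0}^{k-1}f^iI$ is called a cycle of intervals. If $I_0\supset I_1\supset\cdots$ are periodic intervals with periods tending to infinity and $Q=\bigcap_j\mathrm{orb}\,I_j$ is nowhere dense, then $Q$ is called a solenoid. A set is residual if it contains a dense $G_\delta$-set. $M_{f|\mathrm{orb}\,I}$ is the set of all $f$-invariant Borel probability measures on $\mathrm{orb}\,I$. $V_f(x)$ is the set of all weak limit measures (as $N\to\infty$) of the time averages $N^{-1}\sum_{j=0}^{N-1}f^j_*\delta_x$, where $\delta_x$ is the unit mass at $x$. *)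

theory Defs
  imports "HOL-Probability.Probability"
begin

text \<open>A self-map of the unit interval is a function \<open>f :: real \<Rightarrow> real\<close> with
  \<open>f \<in> {0..1} \<rightarrow> {0..1}\<close>; its values outside \<open>{0..1}\<close> play no role.  The \<open>n\<close>-th iterate
  is \<open>f ^^ n\<close>.\<close>

text \<open>Limit points are taken along the sequence \<open>n \<mapsto> f\<^sup>n x\<close> (not of its range), so that the
  limit set of a periodic point is its orbit.\<close>

definition omega_limit :: "(real \<Rightarrow> real) \<Rightarrow> real \<Rightarrow> real set" where
  "omega_limit f x = {y. \<exists>r. strict_mono r \<and> (\<lambda>n. (f ^^ r n) x) \<longlonglongrightarrow> y}"

definition is_cycle :: "(real \<Rightarrow> real) \<Rightarrow> real set \<Rightarrow> bool" where
  "is_cycle f C \<longleftrightarrow> (\<exists>p\<in>{0..1}. \<exists>n>0. (f ^^ n) p = p \<and> C = range (\<lambda>k. (f ^^ k) p))"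

text \<open>If the images of an interval are pairwise disjoint, their lengths tend to \<open>0\<close>, so all its
  points have the same limit set; hence it is immaterial how the limit sets of the points of
  \<open>I\<close> are combined in the last clause.\<close>

definition wandering_interval :: "(real \<Rightarrow> real) \<Rightarrow> real set \<Rightarrow> bool" where
  "wandering_interval f I \<longleftrightarrow>
     I \<subseteq> {0..1} \<and> is_interval I \<and> (\<exists>a\<in>I. \<exists>b\<in>I. a < b) \<and>
     (\<forall>m n. m < n \<longrightarrow> (f ^^ n) ` I \<inter> (f ^^ m) ` I = {}) \<and>
     \<not> (\<exists>C. is_cycle f C \<and> (\<forall>x\<in>I. omega_limit f x = C))"

definition periodic_interval :: "(real \<Rightarrow> real) \<Rightarrow> real set \<Rightarrow> nat \<Rightarrow> bool" where
  "periodic_interval f I k \<longleftrightarrow>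
     (\<exists>a b. 0 \<le> a \<and> a < b \<and> b \<le> 1 \<and> I = {a..b}) \<and> 0 < k \<and>
     disjoint_family_on (\<lambda>i. (f ^^ i) ` I) {..<k} \<and> (f ^^ k) ` I = I"

definition orb :: "(real \<Rightarrow> real) \<Rightarrow> real set \<Rightarrow> nat \<Rightarrow> real set" where
  "orb f I k = (\<Union>i<k. (f ^^ i) ` I)"

definition solenoid :: "(real \<Rightarrow> real) \<Rightarrow> real set \<Rightarrow> bool" where
  "solenoid f Q \<longleftrightarrow>
     (\<exists>I p. (\<forall>j. periodic_interval f (I j) (p j)) \<and> (\<forall>j. I (Suc j) \<subseteq> I j) \<and>
        filterlim p at_top sequentially \<and>
        Q = (\<Inter>j. orb f (I j) (p j)) \<and> interior (closure Q) = {})"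

definition residual_in :: "'a topology \<Rightarrow> 'a set \<Rightarrow> bool" where
  "residual_in X G \<longleftrightarrow>
     G \<subseteq> topspace X \<and> (\<exists>D\<subseteq>G. gdelta_in X D \<and> X closure_of D = topspace X)"

abbreviation unit_borel :: "real measure" where
  "unit_borel \<equiv> restrict_space borel {0..1}"

text \<open>Borel measures on a Borel set \<open>J \<subseteq> {0..1}\<close> are identified with the Borel measures on
  \<open>{0..1}\<close> concentrated on \<open>J\<close>, so that they can be compared with limits of measures
  on \<open>{0..1}\<close>.\<close>

definition invariant_measures :: "(real \<Rightarrow> real) \<Rightarrow> real set \<Rightarrow> real measure set" where
  "invariant_measures f J =
     {\<mu>. sets \<mu> = sets unit_borel \<and> prob_space \<mu> \<and> emeasure \<mu> J = 1 \<and>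
         distr \<mu> unit_borel f = \<mu>}"

definition time_average :: "(real \<Rightarrow> real) \<Rightarrow> real \<Rightarrow> nat \<Rightarrow> real measure" where
  "time_average f x N = measure_of {0..1} (sets unit_borel)
     (\<lambda>A. (\<Sum>j<N. emeasure (distr (return unit_borel x) unit_borel (f ^^ j)) A) / of_nat N)"

text \<open>The set function in \<open>time_average\<close> is countably additive, so \<open>measure_of\<close> does not
  degenerate.\<close>

lemma emeasure_time_average:
  assumes "A \<in> sets unit_borel"
  shows "emeasure (time_average f x N) A =
    (\<Sum>j<N. emeasure (distr (return unit_borel x) unit_borel (f ^^ j)) A) / of_nat N"
proof (rule emeasure_measure_of[OF time_average_def])
  show "sets unit_borel \<subseteq> Pow {0..1}"
    by (auto simp: sets_restrict_space)
  show "A \<in> sets (time_average f x N)"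
    using assms sets.space_closed[of unit_borel]
    by (simp add: time_average_def sets_measure_of sets.sigma_sets_eq[of unit_borel, simplified] space_restrict_space)
  show "positive (sets (time_average f x N)) (\<lambda>A. (\<Sum>j<N. emeasure (distr (return unit_borel x) unit_borel (f ^^ j)) A) / of_nat N)"
    by (auto simp: positive_def)
  have s: "sets (time_average f x N) = sets unit_borel"
    using sets.space_closed[of unit_borel]
    by (simp add: time_average_def sets_measure_of sets.sigma_sets_eq[of unit_borel, simplified] space_restrict_space)
  show "countably_additive (sets (time_average f x N)) (\<lambda>A. (\<Sum>j<N. emeasure (distr (return unit_borel x) unit_borel (f ^^ j)) A) / of_nat N)"
    unfolding s
    by (auto simp: countably_additive_def divide_ennreal_def suminf_sum suminf_emeasure)
qed

definition weakly_converges :: "(nat \<Rightarrow> real measure) \<Rightarrow> real measure \<Rightarrow> bool" where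
  "weakly_converges \<mu>s \<mu> \<longleftrightarrow>
     (\<forall>\<phi>. continuous_on {0..1} \<phi> \<longrightarrow>
        (\<lambda>n. integral\<^sup>L (\<mu>s n) \<phi>) \<longlonglongrightarrow> integral\<^sup>L \<mu> (\<phi> :: real \<Rightarrow> real))"

definition limit_measures :: "(real \<Rightarrow> real) \<Rightarrow> real \<Rightarrow> real measure set" where
  "limit_measures f x =
     {\<mu>. sets \<mu> = sets unit_borel \<and> prob_space \<mu> \<and>
         (\<exists>r. strict_mono r \<and> weakly_converges (\<lambda>n. time_average f x (r n)) \<mu>)}"

end

theory Submission
  imports Defs
begin

text \<open>Call a point generic if it belongs to every set, out of countably many open ones, in whose closure it
  lies: the sets of points visiting a given rational interval after time \<open>m\<close>, and the sets of points some
  late time averages of which are close to given rational values on the first monomials.  What happens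
  arbitrarily close to a generic \<open>x\<close> then happens to \<open>x\<close> itself.

  If some neighbourhood of \<open>x\<close> has pairwise disjoint images, its points tend to a cycle since nothing wanders.
  Otherwise the late images of small neighbourhoods fill nested invariant unions of finitely many
  cyclically permuted intervals, and by genericity their intersection is \<open>\<omega>(x)\<close>.  If it has interior, it is
  a cycle of intervals; if it is infinite without interior, it is a solenoid; if it is finite, it is a cycle.

  If \<open>\<omega>(x) = orb I\<close>, it remains to find points near \<open>x\<close> with time averages close to a given invariant measure
  \<open>\<mu>\<close>.  A power \<open>u\<close> of \<open>f\<close> maps a subinterval of \<open>I\<close> transitively to itself and has an interior
  fixed point \<open>q\<close> which lies in some image of every subinterval.  Hence the images of an interval of length
  at least \<open>\<delta>\<close> cover, within a time depending only on \<open>\<delta>\<close> and \<open>\<eta>\<close>, the points on either side of \<open>q\<close>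
  that are \<open>\<eta>\<close>-far from the endpoints.  So any prescribed number of orbit segments of length \<open>n\<close> can be
  followed one after the other with gaps bounded independently of \<open>n\<close>.  Finally, the integral of a function
  with respect to \<open>\<mu>\<close> equals the integral of its \<open>n\<close>-th time average, which is close to the mean over
  finitely many sample points, whose number does not depend on \<open>n\<close>; no ergodic theorem is needed.\<close>

section \<open>Iterates and limit sets\<close>

text \<open>The endpoints of the interval are the main obstacle. Covering controls only points at a
  distance from them, while an invariant measure may give them mass, for instance if an endpoint is
  fixed and has no interior preimage. So open collars of small measure are removed from the set of
  samples, and orbits through the endpoints themselves are replaced by orbits of interior points
  with nearly the same averages (\<open>interior_companion\<close>). A power of the return map is
  needed because a transitive map may exchange the two sides of its fixed point, some subinterval
  never reaching this point; the square, restricted to one side, then has a fixed point that works.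
  Non-ergodic measures need no decomposition: the sample points may behave quite differently from
  each other, since shadowing strings their orbit segments together in any order.\<close>

lemma funpow_image_add: "(f ^^ (m + n)) ` A = (f ^^ m) ` ((f ^^ n) ` A)"
  by (simp add: funpow_add image_comp)

lemma funpow_mem: "f \<in> S \<rightarrow> S \<Longrightarrow> x \<in> S \<Longrightarrow> (f ^^ n) x \<in> S"
  by (induction n) auto

lemma funpow_image_subset: "f ` S \<subseteq> S \<Longrightarrow> (f ^^ n) ` S \<subseteq> S"
  using funpow_mem[of f S _ n] by blast

lemma funpow_image_eq: "f ` S = S \<Longrightarrow> (f ^^ n) ` S = S"
proof (induction n)
  case (Suc n)
  then show ?case using funpow_image_add[where f=f and m=1 and n=n and A=S] by simp
qed simp

lemma continuous_on_funpow:
  assumes "continuous_on S f" "f \<in> S \<rightarrow> S"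
  shows "continuous_on S (f ^^ n)"
proof (induction n)
  case 0
  show ?case by (simp add: id_def)
next
  case (Suc n)
  have "(f ^^ n) ` S \<subseteq> S"
    using funpow_mem[OF assms(2)] by blast
  then have "continuous_on S (f \<circ> (f ^^ n))"
    by (intro continuous_on_compose Suc.IH continuous_on_subset[OF assms(1)])
  then show ?case by simp
qed

lemma cluster_point_iff:
  fixes X :: "nat \<Rightarrow> 'a::metric_space"
  shows "(\<exists>r. strict_mono r \<and> (\<lambda>n. X (r n)) \<longlonglongrightarrow> y) \<longleftrightarrow>
    (\<forall>e>0. \<forall>m. \<exists>n\<ge>m. dist (X n) y < e)"
proof
  assume "\<exists>r. strict_mono r \<and> (\<lambda>n. X (r n)) \<longlonglongrightarrow> y"
  then obtain r where r: "strict_mono r" "(\<lambda>n. X (r n)) \<longlonglongrightarrow> y" by blast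
  show "\<forall>e>0. \<forall>m. \<exists>n\<ge>m. dist (X n) y < e"
  proof (intro allI impI)
    fix e :: real and m :: nat assume "e > 0"
    then obtain N where "\<And>n. n \<ge> N \<Longrightarrow> dist (X (r n)) y < e"
      using r(2) unfolding lim_sequentially by blast
    moreover have "r (max N m) \<ge> m"
      using seq_suble[OF r(1), of "max N m"] by linarith
    ultimately show "\<exists>n\<ge>m. dist (X n) y < e"
      using max.cobounded1 by blast
  qed
next
  assume *: "\<forall>e>0. \<forall>m. \<exists>n\<ge>m. dist (X n) y < e"
  have "\<exists>r. \<forall>n. dist (X (r n)) y < inverse (real (Suc n)) \<and> r n < r (Suc n)"
  proof (intro dependent_nat_choice)
    show "\<exists>k. dist (X k) y < inverse (real (Suc 0))"
      using *[rule_format, of "inverse (real (Suc 0))" 0] by auto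
    show "\<exists>k'. dist (X k') y < inverse (real (Suc (Suc n))) \<and> k < k'" for k n
    proof -
      have "inverse (real (Suc (Suc n))) > 0" by simp
      then obtain k' where "k' \<ge> Suc k" "dist (X k') y < inverse (real (Suc (Suc n)))"
        using * by blast
      then show ?thesis using Suc_le_lessD by blast
    qed
  qed
  then obtain r where r: "\<And>n. dist (X (r n)) y < inverse (real (Suc n))" "\<And>n. r n < r (Suc n)"
    by blast
  have "(\<lambda>n. dist (X (r n)) y) \<longlonglongrightarrow> 0"
    by (rule tendsto_sandwich[OF _ _ tendsto_const LIMSEQ_inverse_real_of_nat])
      (intro always_eventually allI zero_le_dist less_imp_le r(1))+
  then show "\<exists>r. strict_mono r \<and> (\<lambda>n. X (r n)) \<longlonglongrightarrow> y"
    using r(2) by (intro exI[of _ r]) (simp add: strict_mono_Suc_iff tendsto_dist_iff[of _ y])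
qed

lemma omega_limit_iff:
  "y \<in> omega_limit f x \<longleftrightarrow> (\<forall>e>0. \<forall>m. \<exists>n\<ge>m. \<bar>(f ^^ n) x - y\<bar> < e)"
  using cluster_point_iff[of "\<lambda>n. (f ^^ n) x" y] by (simp add: omega_limit_def dist_real_def)

section \<open>Limit sets of continuous self-maps of an interval\<close>

locale interval_map =
  fixes u :: "real \<Rightarrow> real" and a b :: real
  assumes cont: "continuous_on {a..b} u" and maps: "u \<in> {a..b} \<rightarrow> {a..b}"
begin

lemma iter_mem: "y \<in> {a..b} \<Longrightarrow> (u ^^ n) y \<in> {a..b}"
  by (rule funpow_mem[OF maps])

lemma iter_cont: "continuous_on {a..b} (u ^^ n)"
  by (rule continuous_on_funpow[OF cont maps])

lemma image_full:
  assumes "a < b" and dense: "\<And>p. a < p \<Longrightarrow> p < b \<Longrightarrow> p \<in> closure (u ` {a..b})"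
  shows "u ` {a..b} = {a..b}"
proof
  show "u ` {a..b} \<subseteq> {a..b}" using maps by auto
  have cl: "closed (u ` {a..b})"
    by (intro compact_imp_closed compact_continuous_image cont compact_Icc)
  then have "{a<..<b} \<subseteq> u ` {a..b}" using dense by auto
  then have "closure {a<..<b} \<subseteq> u ` {a..b}" using cl by (rule closure_minimal)
  then show "{a..b} \<subseteq> u ` {a..b}" using assms(1) by (simp add: closure_greaterThanLessThan)
qed

end

locale unit_map = interval_map f 0 1 for f
begin

lemma iter_image: "A \<subseteq> {0..1} \<Longrightarrow> (f ^^ n) ` A \<subseteq> {0..1}"
  using iter_mem by blast

lemma iter_connected: "A \<subseteq> {0..1} \<Longrightarrow> connected A \<Longrightarrow> connected ((f ^^ n) ` A)"
  by (rule connected_continuous_image[OF continuous_on_subset[OF iter_cont]])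

lemma iter_compact: "A \<subseteq> {0..1} \<Longrightarrow> compact A \<Longrightarrow> compact ((f ^^ n) ` A)"
  by (rule compact_continuous_image[OF continuous_on_subset[OF iter_cont]])

lemma omega_subset:
  assumes "x \<in> {0..1}" shows "omega_limit f x \<subseteq> {0..1}"
proof
  fix y assume "y \<in> omega_limit f x"
  then obtain r where "(\<lambda>n. (f ^^ r n) x) \<longlonglongrightarrow> y" by (auto simp: omega_limit_def)
  then show "y \<in> {0..1}"
    by (rule closed_sequentially[OF closed_atLeastAtMost _ , rotated]) (rule iter_mem[OF assms])
qed

lemma omega_closed: "closed (omega_limit f x)"
proof (rule closed_sequential_limits[THEN iffD2], safe)
  fix X l assume X: "\<forall>n. X n \<in> omega_limit f x" "X \<longlonglongrightarrow> l"
  show "l \<in> omega_limit f x"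
    unfolding omega_limit_iff
  proof (intro allI impI)
    fix e :: real and m :: nat assume "e > 0"
    then obtain i where i: "\<bar>X i - l\<bar> < e / 2"
      using X(2) unfolding lim_sequentially dist_real_def by (meson half_gt_zero order_refl)
    obtain n where "n \<ge> m" "\<bar>(f ^^ n) x - X i\<bar> < e / 2"
      using X(1) \<open>e > 0\<close> unfolding omega_limit_iff by (meson half_gt_zero)
    with i show "\<exists>n\<ge>m. \<bar>(f ^^ n) x - l\<bar> < e"
      by (intro exI[of _ n]) linarith
  qed
qed

lemma unit_subseq:
  fixes X :: "nat \<Rightarrow> real"
  assumes "\<And>n. X n \<in> {0..1}"
  obtains l r where "l \<in> {0..1}" "strict_mono r" "(\<lambda>n. X (r n)) \<longlonglongrightarrow> l"
proof -
  have "seq_compact {0..1::real}" by (rule compact_imp_seq_compact[OF compact_Icc])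
  from seq_compactE[OF this, of X] assms show thesis
    using that unfolding o_def by blast
qed

lemma omega_compact: "x \<in> {0..1} \<Longrightarrow> compact (omega_limit f x)"
  using compact_Int_closed[OF compact_Icc omega_closed, of 0 1 x] omega_subset[of x]
  by (simp add: Int_absorb1)

lemma omega_near:
  assumes x: "x \<in> {0..1}" and e: "e > 0"
  obtains N where "\<And>n. n \<ge> N \<Longrightarrow> \<exists>p\<in>omega_limit f x. \<bar>(f ^^ n) x - p\<bar> < e"
proof (rule ccontr)
  assume not: "\<not> thesis"
  have *: "\<forall>N. \<exists>n\<ge>N. \<forall>p\<in>omega_limit f x. \<not> \<bar>(f ^^ n) x - p\<bar> < e"
  proof (rule allI, rule ccontr)
    fix N assume "\<not> (\<exists>n\<ge>N. \<forall>p\<in>omega_limit f x. \<not> \<bar>(f ^^ n) x - p\<bar> < e)"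
    then have "thesis" by (intro that[of N]) blast
    with not show False ..
  qed
  have "\<exists>s. \<forall>n. (\<forall>p\<in>omega_limit f x. \<not> \<bar>(f ^^ s n) x - p\<bar> < e) \<and> s n < s (Suc n)"
  proof (intro dependent_nat_choice)
    show "\<exists>k. \<forall>p\<in>omega_limit f x. \<not> \<bar>(f ^^ k) x - p\<bar> < e" using * by blast
    show "\<exists>k'. (\<forall>p\<in>omega_limit f x. \<not> \<bar>(f ^^ k') x - p\<bar> < e) \<and> k < k'" for k n :: nat
    proof -
      obtain k' where "k' \<ge> Suc k" "\<forall>p\<in>omega_limit f x. \<not> \<bar>(f ^^ k') x - p\<bar> < e"
        using * by blast
      then show ?thesis by (intro exI[of _ k']) auto
    qed
  qed
  then obtain s where s0: "\<forall>n. (\<forall>p\<in>omega_limit f x. \<not> \<bar>(f ^^ s n) x - p\<bar> < e) \<and> s n < s (Suc n)" ..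
  have s: "\<And>n p. p \<in> omega_limit f x \<Longrightarrow> \<not> \<bar>(f ^^ s n) x - p\<bar> < e" "strict_mono s"
    using s0 by (blast, simp add: strict_mono_Suc_iff)
  obtain l r where r: "strict_mono r" "(\<lambda>n. (f ^^ s (r n)) x) \<longlonglongrightarrow> l"
    using unit_subseq[of "\<lambda>n. (f ^^ s n) x"] iter_mem[OF x] by blast
  have "l \<in> omega_limit f x"
    unfolding omega_limit_def mem_Collect_eq using r strict_mono_o[OF s(2) r(1)]
    by (intro exI[of _ "s \<circ> r"]) (simp add: o_def)
  moreover obtain n where "\<bar>(f ^^ s (r n)) x - l\<bar> < e"
    using r(2) e unfolding lim_sequentially dist_real_def by auto
  ultimately show False using s(1) by blast
qed

lemma omega_nonempty: "x \<in> {0..1} \<Longrightarrow> omega_limit f x \<noteq> {}"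
proof -
  assume x: "x \<in> {0..1}"
  obtain N where "\<And>n. n \<ge> N \<Longrightarrow> \<exists>p\<in>omega_limit f x. \<bar>(f ^^ n) x - p\<bar> < 1"
    using omega_near[OF x zero_less_one] by blast
  from this[of N] show ?thesis by auto
qed

lemma omega_image:
  assumes x: "x \<in> {0..1}" shows "f ` omega_limit f x = omega_limit f x"
proof
  show "f ` omega_limit f x \<subseteq> omega_limit f x"
  proof
    fix z assume "z \<in> f ` omega_limit f x"
    then obtain y where y0: "z = f y" "y \<in> omega_limit f x" by (rule imageE)
    then obtain r where r: "strict_mono r" "(\<lambda>n. (f ^^ r n) x) \<longlonglongrightarrow> y"
      unfolding omega_limit_def mem_Collect_eq by (elim exE conjE)
    note y = y0(1) subsetD[OF omega_subset[OF x] y0(2)] r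
    have "(\<lambda>n. f ((f ^^ r n) x)) \<longlonglongrightarrow> f y"
      by (rule continuous_on_tendsto_compose[OF cont y(4,2)]) (intro always_eventually allI iter_mem[OF x])
    then show "z \<in> omega_limit f x"
      using y unfolding omega_limit_def mem_Collect_eq
      by (intro exI[of _ "\<lambda>n. Suc (r n)"]) (simp add: strict_mono_def)
  qed
  show "omega_limit f x \<subseteq> f ` omega_limit f x"
  proof
    fix y assume "y \<in> omega_limit f x"
    then obtain r where r: "strict_mono r" "(\<lambda>n. (f ^^ r n) x) \<longlonglongrightarrow> y"
      unfolding omega_limit_def mem_Collect_eq by (elim exE conjE)
    \<comment> \<open>Shifting to \<open>Suc n\<close> makes the times positive, so that the
      preceding iterate exists; a limit point of the preceding iterates is the desired
      preimage.\<close>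
    have pos: "r (Suc n) > 0" for n
      using strict_mono_less[OF r(1), of 0 "Suc n"] by auto
    obtain l t where t: "strict_mono t" "(\<lambda>n. (f ^^ (r (Suc (t n)) - 1)) x) \<longlonglongrightarrow> l" "l \<in> {0..1}"
      using unit_subseq[of "\<lambda>n. (f ^^ (r (Suc n) - 1)) x"] iter_mem[OF x] by blast
    have "strict_mono (\<lambda>n. r (Suc (t n)) - 1)"
    proof (rule strict_monoI)
      fix m n :: nat assume "m < n"
      then have "r (Suc (t m)) < r (Suc (t n))" using r(1) t(1) by (simp add: strict_mono_less)
      with pos[of "t m"] show "r (Suc (t m)) - 1 < r (Suc (t n)) - 1" by linarith
    qed
    then have l: "l \<in> omega_limit f x"
      unfolding omega_limit_def mem_Collect_eq using t by (intro exI[of _ "\<lambda>n. r (Suc (t n)) - 1"]) (simp add: o_def)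
    have "(\<lambda>n. f ((f ^^ (r (Suc (t n)) - 1)) x)) \<longlonglongrightarrow> f l"
      by (rule continuous_on_tendsto_compose[OF cont t(2,3)]) (intro always_eventually allI iter_mem[OF x])
    moreover have "f ((f ^^ (r (Suc (t n)) - 1)) x) = (f ^^ r (Suc (t n))) x" for n
    proof -
      have "Suc (r (Suc (t n)) - 1) = r (Suc (t n))" using pos[of "t n"] by simp
      then show ?thesis by (metis comp_apply funpow.simps(2))
    qed
    moreover have "(\<lambda>n. (f ^^ r (Suc (t n))) x) \<longlonglongrightarrow> y"
      using LIMSEQ_subseq_LIMSEQ[OF LIMSEQ_Suc[OF r(2)] t(1)] by (simp add: o_def)
    ultimately show "y \<in> f ` omega_limit f x"
      using l LIMSEQ_unique[of "\<lambda>n. (f ^^ r (Suc (t n))) x" "f l" y] by (auto simp del: o_apply)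
  qed
qed

text \<open>Distinct points of the limit set are at least \<open>d\<close> apart. Once the orbit of
  \<open>x\<close> is close to \<open>p\<close>, it can only move on along the orbit of
  \<open>p\<close>; so the limit set lies in the forward orbit of each of its points, and applying
  this to \<open>f p\<close> makes \<open>p\<close> periodic.\<close>

lemma finite_omega_cycle:
  assumes x: "x \<in> {0..1}" and fin: "finite (omega_limit f x)"
  shows "is_cycle f (omega_limit f x)"
proof -
  let ?W = "omega_limit f x"
  have sub: "?W \<subseteq> {0..1}" by (rule omega_subset[OF x])
  have W_orbit: "?W \<subseteq> range (\<lambda>k. (f ^^ k) p)" if p: "p \<in> ?W" for p
  proof
    let ?O = "range (\<lambda>k. (f ^^ k) p)"
    have O_sub: "?O \<subseteq> ?W"
      using funpow_image_eq[OF omega_image[OF x]] p by blast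
    obtain d where d: "d > 0" "\<And>y z. y \<in> ?W \<Longrightarrow> z \<in> ?W \<Longrightarrow> y \<noteq> z \<Longrightarrow> d \<le> \<bar>y - z\<bar>"
    proof (cases "\<exists>y\<in>?W. \<exists>z\<in>?W. y \<noteq> z")
      case True
      let ?D = "(\<lambda>(y, z). \<bar>y - z\<bar>) ` {(y, z) \<in> ?W \<times> ?W. y \<noteq> z}"
      have "finite {(y, z) \<in> ?W \<times> ?W. y \<noteq> z}"
        by (rule finite_subset[of _ "?W \<times> ?W"]) (use fin in auto)
      then have "finite ?D" by blast
      moreover have "?D \<noteq> {}" using True by auto
      ultimately have "Min ?D \<in> ?D" "\<And>v. v \<in> ?D \<Longrightarrow> Min ?D \<le> v" by auto
      then show ?thesis by (intro that[of "Min ?D"]) auto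
    next
      case False
      then show ?thesis by (intro that[of 1]) auto
    qed
    have uc: "uniformly_continuous_on {0..1} f"
      by (rule compact_uniformly_continuous[OF cont compact_Icc])
    obtain e where e: "e > 0" "\<And>y z. y \<in> {0..1} \<Longrightarrow> z \<in> {0..1} \<Longrightarrow> \<bar>y - z\<bar> < e \<Longrightarrow> \<bar>f y - f z\<bar> < d / 2"
      using uc[unfolded uniformly_continuous_on_def dist_real_def, rule_format, of "d / 2"] d(1)
      by (auto simp: abs_minus_commute)
    \<comment> \<open>One \<open>d / 2\<close> pays for the continuity error of \<open>f\<close>,
      the other for the distance to the limit set; two points of the limit set less than
      \<open>d\<close> apart coincide.\<close>
    define e' where "e' = min e (d / 2)"
    have e': "e' > 0" using e(1) d(1) by (simp add: e'_def)
    obtain N where N: "\<And>n. n \<ge> N \<Longrightarrow> \<exists>q\<in>?W. \<bar>(f ^^ n) x - q\<bar> < e'"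
      using omega_near[OF x e'] by blast
    obtain n0 where n0: "n0 \<ge> N" "\<bar>(f ^^ n0) x - p\<bar> < e'"
      using p e' unfolding omega_limit_iff by blast
    have near: "\<exists>q\<in>?O. \<bar>(f ^^ (n0 + n)) x - q\<bar> < e'" for n
    proof (induction n)
      case 0
      have "p \<in> ?O" by (rule image_eqI[of _ _ 0]) auto
      then show ?case using n0(2) by (intro bexI[of _ p]) auto
    next
      case (Suc n)
      then obtain q where q: "q \<in> ?O" "\<bar>(f ^^ (n0 + n)) x - q\<bar> < e'" by blast
      have q01: "q \<in> {0..1}" using q(1) O_sub sub by blast
      have 1: "\<bar>(f ^^ (n0 + Suc n)) x - f q\<bar> < d / 2"
        using e(2)[OF iter_mem[OF x] q01, of "n0 + n"] q(2) by (simp add: e'_def)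
      obtain q' where q': "q' \<in> ?W" "\<bar>(f ^^ (n0 + Suc n)) x - q'\<bar> < e'"
        using N[of "n0 + Suc n"] n0(1) by auto
      obtain k where "q = (f ^^ k) p" using q(1) by blast
      then have fq: "f q \<in> ?O" by (intro image_eqI[of _ _ "Suc k"]) auto
      have "\<bar>f q - q'\<bar> < d" using 1 q'(2) unfolding e'_def by linarith
      then have "f q = q'" using d(2)[of "f q" q'] fq O_sub q'(1) by fastforce
      then show ?case using fq q'(2) by blast
    qed
    fix w assume w: "w \<in> ?W"
    obtain n where n: "n \<ge> n0" "\<bar>(f ^^ n) x - w\<bar> < e'"
      using w e' unfolding omega_limit_iff by blast
    obtain q where q: "q \<in> ?O" "\<bar>(f ^^ n) x - q\<bar> < e'"
      using near[of "n - n0"] n(1) by auto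
    have "\<bar>w - q\<bar> < d" using n(2) q(2) unfolding e'_def by linarith
    then have "w = q" using d(2)[of w q] w q(1) O_sub by fastforce
    then show "w \<in> ?O" using q(1) by simp
  qed
  obtain p where p: "p \<in> ?W" using omega_nonempty[OF x] by blast
  have "f p \<in> ?W" using omega_image[OF x] p by blast
  then obtain k where k: "p = (f ^^ k) (f p)" using W_orbit p by blast
  have "(f ^^ Suc k) p = p" using k by (simp add: funpow_swap1)
  moreover have "?W = range (\<lambda>k. (f ^^ k) p)"
    using W_orbit[OF p] funpow_image_eq[OF omega_image[OF x]] p by blast
  ultimately show ?thesis
    unfolding is_cycle_def using p sub by (intro bexI[of _ p] exI[of _ "Suc k"]) auto
qed

end

section \<open>Cycles of intervals and solenoids\<close>

text \<open>The fibres of \<open>h\<close> over a common point of all images are nested nonempty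
  compact sets.\<close>

lemma image_INT_nested:
  fixes K :: "nat \<Rightarrow> real set" and h :: "real \<Rightarrow> real"
  assumes comp: "\<And>n. compact (K n)" and nest: "\<And>m n. m \<le> n \<Longrightarrow> K n \<subseteq> K m"
    and cont: "continuous_on (K 0) h"
  shows "h ` (\<Inter>n. K n) = (\<Inter>n. h ` K n)"
proof
  show "h ` (\<Inter>n. K n) \<subseteq> (\<Inter>n. h ` K n)" by blast
  show "(\<Inter>n. h ` K n) \<subseteq> h ` (\<Inter>n. K n)"
  proof
    fix w assume w: "w \<in> (\<Inter>n. h ` K n)"
    have "(\<Inter>n. {x \<in> K n. h x = w}) \<noteq> {}"
    proof (rule compact_nest)
      fix n
      have "{x \<in> K n. h x = w} = K n \<inter> {x \<in> K n. h x = w}" by blast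
      moreover have "closed {x \<in> K n. h x = w}"
        using continuous_on_subset[OF cont nest[of 0 n]] compact_imp_closed[OF comp]
        by (intro continuous_closed_preimage_constant) auto
      ultimately show "compact {x \<in> K n. h x = w}"
        using compact_Int_closed[OF comp] by metis
      show "{x \<in> K n. h x = w} \<noteq> {}" using w by blast
    qed (use nest in blast)
    then show "w \<in> h ` (\<Inter>n. K n)" by blast
  qed
qed

section \<open>Cyclically permuted intervals\<close>

lemma compact_connected_real:
  fixes S :: "real set"
  assumes "compact S" "connected S"
  obtains a b where "S = {a..b}"
  using assms is_interval_compact[of S] is_interval_connected_1[of S] by auto

lemma mod_add_right_cancel_nat:
  fixes i m n k :: nat
  assumes "(m + i) mod k = (n + i) mod k"
  shows "m mod k = n mod k"
proof -
  obtain p q where "m + i + k * p = n + i + k * q"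
    using assms unfolding nat_mod_eq_iff by blast
  then have "m + k * p = n + k * q" by simp
  then show ?thesis unfolding nat_mod_eq_iff by blast
qed

text \<open>A relaxation of \<open>periodic_interval\<close>: \<open>I\<close> may be degenerate,
  and its return map need not be onto. Returning components of closed invariant sets have this form;
  \<open>weakly_periodic_core\<close> recovers genuine periodic intervals.\<close>

definition weakly_periodic :: "(real \<Rightarrow> real) \<Rightarrow> real set \<Rightarrow> nat \<Rightarrow> bool" where
  "weakly_periodic f I k \<longleftrightarrow> I \<subseteq> {0..1} \<and> compact I \<and> connected I \<and> 0 < k \<and>
     disjoint_family_on (\<lambda>i. (f ^^ i) ` I) {..<k} \<and> (f ^^ k) ` I \<subseteq> I"

lemma periodic_imp_weakly_periodic: "periodic_interval f I k \<Longrightarrow> weakly_periodic f I k"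
  unfolding periodic_interval_def weakly_periodic_def by force

lemma weakly_periodicD:
  assumes "weakly_periodic f I k"
  shows "I \<subseteq> {0..1}" "compact I" "connected I" "0 < k" "(f ^^ k) ` I \<subseteq> I"
  using assms unfolding weakly_periodic_def by auto

lemma weakly_periodic_image_mod:
  assumes "weakly_periodic f I k"
  shows "(f ^^ n) ` I \<subseteq> (f ^^ (n mod k)) ` I"
proof -
  have "((f ^^ k) ^^ (n div k)) ` I \<subseteq> I"
    by (rule funpow_image_subset[OF weakly_periodicD(5)[OF assms]])
  then have "(f ^^ (n mod k)) ` ((f ^^ (k * (n div k))) ` I) \<subseteq> (f ^^ (n mod k)) ` I"
    unfolding funpow_mult by (rule image_mono)
  then show ?thesis
    unfolding funpow_image_add[symmetric] by simp
qed

lemma weakly_periodic_disjoint: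
  assumes "weakly_periodic f I k" "(f ^^ i) ` I \<inter> (f ^^ j) ` I \<noteq> {}"
  shows "i mod k = j mod k"
proof (rule ccontr)
  assume "i mod k \<noteq> j mod k"
  then have "(f ^^ (i mod k)) ` I \<inter> (f ^^ (j mod k)) ` I = {}"
    using assms(1) unfolding weakly_periodic_def disjoint_family_on_def by simp
  then show False
    using assms(2) weakly_periodic_image_mod[OF assms(1), of i]
      weakly_periodic_image_mod[OF assms(1), of j] by blast
qed

lemma weakly_periodic_orb:
  assumes "weakly_periodic f I k"
  shows "(\<Union>n. (f ^^ n) ` I) = orb f I k"
proof
  show "(\<Union>n. (f ^^ n) ` I) \<subseteq> orb f I k"
    unfolding orb_def
  proof (rule UN_least)
    fix n
    have "n mod k \<in> {..<k}" using weakly_periodicD(4)[OF assms] by simp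
    then show "(f ^^ n) ` I \<subseteq> (\<Union>i<k. (f ^^ i) ` I)"
      using weakly_periodic_image_mod[OF assms, of n] by (meson UN_upper order_trans)
  qed
qed (auto simp: orb_def)

lemma orb_image_subset:
  assumes "weakly_periodic f I k"
  shows "orb f ((f ^^ i) ` I) k \<subseteq> orb f I k"
  unfolding weakly_periodic_orb[OF assms, symmetric]
  unfolding orb_def funpow_image_add[symmetric] by blast

lemma orb_iter_subset:
  assumes "weakly_periodic f I k"
  shows "(f ^^ i) ` orb f I k \<subseteq> orb f ((f ^^ i) ` I) k"
  unfolding orb_def image_UN funpow_image_add[symmetric]
  by (simp add: add.commute)

context unit_map
begin

lemma weakly_periodic_shift:
  assumes "weakly_periodic f I k"
  shows "weakly_periodic f ((f ^^ i) ` I) k"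
  unfolding weakly_periodic_def
proof (intro conjI)
  note D = weakly_periodicD[OF assms]
  show "(f ^^ i) ` I \<subseteq> {0..1}" by (rule iter_image[OF D(1)])
  show "compact ((f ^^ i) ` I)" by (rule iter_compact[OF D(1,2)])
  show "connected ((f ^^ i) ` I)" by (rule iter_connected[OF D(1,3)])
  show "0 < k" by (rule D(4))
  show "disjoint_family_on (\<lambda>j. (f ^^ j) ` (f ^^ i) ` I) {..<k}"
    unfolding disjoint_family_on_def
  proof (intro ballI impI)
    fix m n assume mn: "m \<in> {..<k}" "n \<in> {..<k}" "m \<noteq> n"
    show "(f ^^ m) ` (f ^^ i) ` I \<inter> (f ^^ n) ` (f ^^ i) ` I = {}"
    proof (rule ccontr)
      assume "\<not> ?thesis"
      then have "(m + i) mod k = (n + i) mod k"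
        unfolding funpow_image_add[symmetric] by (rule weakly_periodic_disjoint[OF assms])
      then have "m mod k = n mod k"
        by (rule mod_add_right_cancel_nat)
      then show False using mn by simp
    qed
  qed
  have "(f ^^ i) ` (f ^^ k) ` I \<subseteq> (f ^^ i) ` I" by (rule image_mono[OF D(5)])
  then show "(f ^^ k) ` (f ^^ i) ` I \<subseteq> (f ^^ i) ` I"
    unfolding funpow_image_add[symmetric] by (simp add: add.commute)
qed

lemma orb_compact:
  assumes "weakly_periodic f I k"
  shows "compact (orb f I k)"
  unfolding orb_def
  by (intro compact_UN iter_compact weakly_periodicD[OF assms]) auto

text \<open>The period is the first return time \<open>k\<close>. The image of \<open>I\<close> at
  that time is connected, lies in \<open>C\<close> and meets \<open>I\<close>, hence is contained in
  it. If images at times \<open>i < j < k\<close> met, another \<open>k - j\<close> steps would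
  produce a return at the earlier time \<open>k - j + i\<close>.\<close>

lemma weakly_periodic_component:
  assumes C: "compact C" "C \<subseteq> {0..1}" "f ` C \<subseteq> C"
    and I: "I = connected_component_set C z"
    and t: "0 < t" "(f ^^ t) ` I \<inter> I \<noteq> {}"
  shows "\<exists>k. weakly_periodic f I k"
proof -
  define k where "k = (LEAST t. 0 < t \<and> (f ^^ t) ` I \<inter> I \<noteq> {})"
  have k: "0 < k" "(f ^^ k) ` I \<inter> I \<noteq> {}"
    using LeastI[of "\<lambda>t. 0 < t \<and> (f ^^ t) ` I \<inter> I \<noteq> {}" t] t unfolding k_def by auto
  have least: "(f ^^ j) ` I \<inter> I = {}" if "0 < j" "j < k" for j
    using not_less_Least[of j "\<lambda>t. 0 < t \<and> (f ^^ t) ` I \<inter> I \<noteq> {}"] that unfolding k_def by auto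
  have IC: "I \<subseteq> C" unfolding I by (rule connected_component_subset)
  have I01: "I \<subseteq> {0..1}" using IC C(2) by blast
  have conI: "connected I" unfolding I by (rule connected_connected_component)
  have "closed I" unfolding I by (rule closed_connected_component[OF compact_imp_closed[OF C(1)]])
  then have "compact (C \<inter> I)" by (rule compact_Int_closed[OF C(1)])
  then have comI: "compact I" using IC by (simp add: Int_absorb1)
  have sub: "(f ^^ k) ` I \<subseteq> I"
  proof -
    obtain w where w: "w \<in> (f ^^ k) ` I" "w \<in> I" using k(2) by blast
    have "(f ^^ k) ` I \<subseteq> C" using funpow_image_subset[OF C(3), of k] IC by blast
    then have "(f ^^ k) ` I \<subseteq> connected_component_set C w"
      by (intro connected_component_maximal w(1) iter_connected I01 conI)
    also have "\<dots> = I" unfolding I using w(2) unfolding I by (rule connected_component_eq)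
    finally show ?thesis .
  qed
  have "disjoint_family_on (\<lambda>i. (f ^^ i) ` I) {..<k}"
  proof -
    have dis: "(f ^^ i) ` I \<inter> (f ^^ j) ` I = {}" if ij: "i < j" "j < k" for i j
    proof (rule ccontr)
      assume "\<not> ?thesis"
      then obtain w where w: "w \<in> (f ^^ i) ` I" "w \<in> (f ^^ j) ` I" by blast
      have "(f ^^ (k - j)) w \<in> (f ^^ (k - j + i)) ` I" "(f ^^ (k - j)) w \<in> (f ^^ (k - j + j)) ` I"
        unfolding funpow_image_add using w by (auto simp del: image_image)
      then have "(f ^^ (k - j + i)) ` I \<inter> I \<noteq> {}" using sub ij by auto
      moreover have "(f ^^ (k - j + i)) ` I \<inter> I = {}" using ij by (intro least) linarith+
      ultimately show False by contradiction
    qed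
    show ?thesis
      unfolding disjoint_family_on_def
    proof (intro ballI impI)
      fix m n assume "m \<in> {..<k}" "n \<in> {..<k}" "m \<noteq> n"
      then show "(f ^^ m) ` I \<inter> (f ^^ n) ` I = {}"
        using dis[of m n] dis[of n m] by (cases "m < n") auto
    qed
  qed
  then show ?thesis
    unfolding weakly_periodic_def using I01 comI conI k(1) sub by blast
qed

lemma orbit_return:
  assumes "y \<in> omega_limit f x" "e > 0"
  obtains n1 n2 where "N \<le> n1" "n1 < n2" "\<bar>(f ^^ n1) x - y\<bar> < e" "\<bar>(f ^^ n2) x - y\<bar> < e"
proof -
  obtain n1 where n1: "n1 \<ge> N" "\<bar>(f ^^ n1) x - y\<bar> < e"
    using assms unfolding omega_limit_iff by blast
  obtain n2 where n2: "n2 \<ge> Suc n1" "\<bar>(f ^^ n2) x - y\<bar> < e"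
    using assms unfolding omega_limit_iff by blast
  show thesis using that[of n1 n2] n1 n2 by simp
qed

lemma omega_subset_closed:
  assumes "closed C" "\<And>n. n \<ge> N \<Longrightarrow> (f ^^ n) x \<in> C"
  shows "omega_limit f x \<subseteq> C"
proof
  fix y assume y: "y \<in> omega_limit f x"
  have "y \<in> closure C"
    unfolding closure_approachable
  proof (intro allI impI)
    fix e :: real assume "e > 0"
    then obtain n where "n \<ge> N" "\<bar>(f ^^ n) x - y\<bar> < e"
      using y unfolding omega_limit_iff by blast
    then show "\<exists>z\<in>C. dist z y < e"
      using assms(2) by (auto simp: dist_real_def)
  qed
  then show "y \<in> C" using assms(1) by simp
qed

text \<open>The component \<open>I\<close> of the limit set around an interior point is visited
  twice by the orbit, so it returns to itself. The return map is onto because the limit set equals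
  its image: a preimage under \<open>f ^^ k\<close> lies in some image of \<open>I\<close>, and
  disjointness leaves only \<open>I\<close> itself.\<close>

lemma interior_omega_orb:
  assumes x: "x \<in> {0..1}" and int: "interior (omega_limit f x) \<noteq> {}"
  shows "\<exists>I k. periodic_interval f I k \<and> omega_limit f x = orb f I k"
proof -
  let ?W = "omega_limit f x"
  obtain z e where e: "e > 0" "ball z e \<subseteq> ?W"
    using int unfolding mem_interior[abs_def] by (metis equals0I mem_interior)
  define I where "I = connected_component_set ?W z"
  have zI: "ball z e \<subseteq> I"
    unfolding I_def using e by (intro connected_component_maximal) auto
  have zW: "z \<in> ?W" using e by auto
  obtain n1 n2 where n: "n1 < n2" "\<bar>(f ^^ n1) x - z\<bar> < e" "\<bar>(f ^^ n2) x - z\<bar> < e"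
    using orbit_return[OF zW e(1), of 0] by blast
  have mem: "(f ^^ n1) x \<in> I" "(f ^^ n2) x \<in> I"
    using n zI by (auto simp: dist_real_def abs_minus_commute subset_iff)
  have n2: "(f ^^ n2) x = (f ^^ (n2 - n1)) ((f ^^ n1) x)"
    using n(1) by (metis comp_apply funpow_add le_add_diff_inverse2 less_imp_le)
  have "(f ^^ (n2 - n1)) ` I \<inter> I \<noteq> {}"
    using mem n2 by blast
  then obtain k where k: "weakly_periodic f I k"
    using weakly_periodic_component[OF omega_compact[OF x] omega_subset[OF x] _ I_def, of "n2 - n1"]
      omega_image[OF x] n(1) by auto
  have IW: "I \<subseteq> ?W" unfolding I_def by (rule connected_component_subset)
  have sub1: "?W \<subseteq> orb f I k"
  proof (rule omega_subset_closed[where N = n1])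
    show "closed (orb f I k)" by (rule compact_imp_closed[OF orb_compact[OF k]])
    fix n assume "n \<ge> n1"
    then have "(f ^^ n) x = (f ^^ (n - n1)) ((f ^^ n1) x)"
      by (metis comp_apply funpow_add le_add_diff_inverse2)
    then show "(f ^^ n) x \<in> orb f I k"
      unfolding weakly_periodic_orb[OF k, symmetric] using mem(1) by blast
  qed
  have sub2: "orb f I k \<subseteq> ?W"
    unfolding orb_def using IW funpow_image_eq[OF omega_image[OF x]] by blast
  have eq: "?W = orb f I k" using sub1 sub2 by blast
  have "I \<subseteq> (f ^^ k) ` I"
  proof
    fix w assume w: "w \<in> I"
    then have "w \<in> (f ^^ k) ` ?W" using IW funpow_image_eq[OF omega_image[OF x]] by blast
    then obtain i where i: "i < k" "w \<in> (f ^^ k) ` (f ^^ i) ` I"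
      unfolding eq orb_def by blast
    have "w \<in> (f ^^ (k + i)) ` I" using i(2) unfolding funpow_image_add .
    then have "(f ^^ (k + i)) ` I \<inter> (f ^^ 0) ` I \<noteq> {}" using w by auto
    then have "(k + i) mod k = 0 mod k" by (rule weakly_periodic_disjoint[OF k])
    then have "i = 0" using i(1) by simp
    then show "w \<in> (f ^^ k) ` I" using i(2) by simp
  qed
  then have fk: "(f ^^ k) ` I = I" using weakly_periodicD(5)[OF k] by blast
  obtain a b where ab: "I = {a..b}"
    using compact_connected_real weakly_periodicD(2,3)[OF k] by blast
  have "z \<in> I" "z + e / 2 \<in> I" using zI e(1) by (auto simp: subset_iff dist_real_def)
  then have "a < b" using e(1) unfolding ab by auto
  moreover have "0 \<le> a" "b \<le> 1"
    using weakly_periodicD(1)[OF k] \<open>a < b\<close> unfolding ab by auto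
  ultimately have "periodic_interval f I k"
    using k fk ab unfolding periodic_interval_def weakly_periodic_def by blast
  then show ?thesis using eq by blast
qed

text \<open>Since \<open>f\<close> maps \<open>W\<close> onto itself, there is an
  \<open>l\<close>-th preimage in \<open>W\<close>; disjointness of the images leaves only
  \<open>I\<close> as its place.\<close>

lemma orb_invariant_fiber:
  assumes I: "weakly_periodic f I k" and W: "f ` W = W" "W \<subseteq> orb f I k"
    and w: "w \<in> W" "w \<in> (f ^^ l) ` I"
  shows "\<exists>v \<in> W \<inter> I. w = (f ^^ l) v"
proof -
  have "w \<in> (f ^^ l) ` W" using funpow_image_eq[OF W(1)] w(1) by blast
  then obtain v where v: "v \<in> W" "w = (f ^^ l) v" by blast
  then obtain j where j: "j < k" "v \<in> (f ^^ j) ` I" using W(2) unfolding orb_def by blast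
  have "w \<in> (f ^^ (l + j)) ` I" unfolding funpow_image_add using v(2) j(2) by blast
  then have "(f ^^ (l + j)) ` I \<inter> (f ^^ (l + 0)) ` I \<noteq> {}" using w(2) by auto
  then have "(l + j) mod k = (l + 0) mod k" by (rule weakly_periodic_disjoint[OF I])
  then have "j mod k = 0 mod k"
    by (intro mod_add_right_cancel_nat[of j l k 0]) (simp add: add.commute)
  then have "j = 0" using j(1) by simp
  then show ?thesis using v j(2) by auto
qed

text \<open>\<open>J\<close> is the intersection of all images under the return map of the piece
  \<open>I'\<close> that contains \<open>z\<close>; this makes the return map onto, and
  \<open>J\<close> is not a point since its orbit contains the infinite set \<open>W\<close>. The
  last conclusion is a maximality property: it makes the cores obtained around the same
  \<open>z\<close> from different \<open>I\<close> nested.\<close>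

lemma weakly_periodic_core:
  assumes I: "weakly_periodic f I k"
    and W: "f ` W = W" "W \<subseteq> orb f I k" "infinite W" "z \<in> W"
  obtains J where "periodic_interval f J k" "z \<in> J" "W \<subseteq> orb f J k" "orb f J k \<subseteq> orb f I k"
    "\<And>A k'. \<lbrakk>connected A; z \<in> A; A \<subseteq> orb f I k; (f ^^ k') ` A = A; 0 < k'\<rbrakk> \<Longrightarrow> A \<subseteq> J"
proof -
  note D = weakly_periodicD[OF I]
  obtain i where i: "i < k" "z \<in> (f ^^ i) ` I" using W(2,4) unfolding orb_def by blast
  define I' where "I' = (f ^^ i) ` I"
  have I': "weakly_periodic f I' k" unfolding I'_def by (rule weakly_periodic_shift[OF I])
  note D' = weakly_periodicD[OF I']
  have zI': "z \<in> I'" using i unfolding I'_def by simp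
  have orb': "orb f I' k \<subseteq> orb f I k" unfolding I'_def by (rule orb_image_subset[OF I])
  have WI': "W \<subseteq> orb f I' k"
    using orb_iter_subset[OF I, of i] image_mono[OF W(2), of "f ^^ i"] funpow_image_eq[OF W(1), of i]
    unfolding I'_def by simp
  define K where "K n = (f ^^ (n * k)) ` I'" for n
  have K_Suc: "K (Suc n) \<subseteq> K n" for n
  proof -
    have "K (Suc n) = (f ^^ (n * k)) ` (f ^^ k) ` I'"
      unfolding K_def by (subst funpow_image_add[symmetric]) (simp add: add.commute)
    also have "\<dots> \<subseteq> K n" unfolding K_def by (rule image_mono[OF D'(5)])
    finally show ?thesis .
  qed
  have K_anti: "K n \<subseteq> K m" if "m \<le> n" for m n
    by (rule lift_Suc_antimono_le[of K, OF K_Suc that])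
  have K_comp: "compact (K n)" and K_conn: "connected (K n)" for n
    unfolding K_def by (rule iter_compact[OF D'(1,2)], rule iter_connected[OF D'(1,3)])
  define J where "J = (\<Inter>n. K n)"
  have J_sub: "J \<subseteq> I'" unfolding J_def K_def using INT_lower[of 0 UNIV "\<lambda>n. (f ^^ (n * k)) ` I'"] by simp
  have "continuous_on (K 0) (f ^^ k)"
    unfolding K_def by (simp add: continuous_on_subset[OF iter_cont D'(1)])
  then have "(f ^^ k) ` J = (\<Inter>n. (f ^^ k) ` K n)"
    unfolding J_def by (intro image_INT_nested K_comp K_anti)
  also have "\<dots> = (\<Inter>n. K (Suc n))"
    unfolding K_def funpow_image_add[symmetric] by (simp add: add.commute)
  also have "\<dots> = J"
    unfolding J_def using K_Suc by blast
  finally have fJ: "(f ^^ k) ` J = J" .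
  have WJ: "W \<inter> I' \<subseteq> J"
  proof
    fix w assume w: "w \<in> W \<inter> I'"
    have "w \<in> K n" for n
    proof -
      have "w \<in> (f ^^ (n * k)) ` W" using funpow_image_eq[OF W(1)] w by blast
      then obtain v where v: "v \<in> W" "w = (f ^^ (n * k)) v" by blast
      then obtain j where j: "j < k" "v \<in> (f ^^ j) ` I'" using WI' unfolding orb_def by blast
      have "w \<in> (f ^^ (n * k + j)) ` I'" unfolding funpow_image_add using v(2) j(2) by blast
      then have "(f ^^ (n * k + j)) ` I' \<inter> (f ^^ 0) ` I' \<noteq> {}" using w by auto
      then have "(n * k + j) mod k = 0 mod k" by (rule weakly_periodic_disjoint[OF I'])
      then have "j = 0" using j(1) by simp
      then show "w \<in> K n" using v j(2) unfolding K_def by auto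
    qed
    then show "w \<in> J" unfolding J_def by blast
  qed
  have zJ: "z \<in> J" using WJ W(4) zI' by blast
  have W_orbJ: "W \<subseteq> orb f J k"
  proof
    fix w assume w: "w \<in> W"
    then obtain l where l: "l < k" "w \<in> (f ^^ l) ` I'" using WI' unfolding orb_def by blast
    obtain v where "v \<in> W \<inter> I'" "w = (f ^^ l) v"
      using orb_invariant_fiber[OF I' W(1) WI' w l(2)] by blast
    then show "w \<in> orb f J k" unfolding orb_def using WJ l(1) by blast
  qed
  have orbJ: "orb f J k \<subseteq> orb f I k"
  proof -
    have "orb f J k \<subseteq> orb f I' k" unfolding orb_def using J_sub by blast
    then show ?thesis using orb' by blast
  qed
  have "compact J" unfolding J_def
    by (rule compact_Inter) (use K_comp in auto)
  moreover have "connected J" unfolding J_def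
    by (rule connected_nest[OF K_comp K_conn K_anti])
  ultimately obtain a b where ab: "J = {a..b}" using compact_connected_real by blast
  have "a < b"
  proof (rule ccontr)
    assume "\<not> a < b"
    then have "finite J" unfolding ab by (cases "a = b") auto
    then have "finite (orb f J k)" unfolding orb_def by blast
    then show False using W(3) W_orbJ finite_subset by blast
  qed
  moreover have "0 \<le> a" "b \<le> 1"
    using order_trans[OF J_sub D'(1)] \<open>a < b\<close> unfolding ab by auto
  moreover have "disjoint_family_on (\<lambda>i. (f ^^ i) ` J) {..<k}"
  proof -
    have d: "disjoint_family_on (\<lambda>i. (f ^^ i) ` I') {..<k}" using I' unfolding weakly_periodic_def by blast
    show ?thesis unfolding disjoint_family_on_def
    proof (intro ballI impI)
      fix m n assume mn: "m \<in> {..<k}" "n \<in> {..<k}" "m \<noteq> n"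
      have "(f ^^ m) ` J \<subseteq> (f ^^ m) ` I'" "(f ^^ n) ` J \<subseteq> (f ^^ n) ` I'"
        using J_sub by (auto intro: image_mono)
      moreover have "(f ^^ m) ` I' \<inter> (f ^^ n) ` I' = {}"
        using d mn unfolding disjoint_family_on_def by blast
      ultimately show "(f ^^ m) ` J \<inter> (f ^^ n) ` J = {}" by blast
    qed
  qed
  ultimately have per: "periodic_interval f J k"
    unfolding periodic_interval_def using ab D(4) fJ by blast
  \<comment> \<open>A connected set that meets the piece \<open>I'\<close> misses the other pieces.
    Then \<open>A\<close>, being its own image under multiples of \<open>k\<close> as large as
    desired, lies in every \<open>K n\<close>.\<close>
  have max: "A \<subseteq> J" if A: "connected A" "z \<in> A" "A \<subseteq> orb f I k" "(f ^^ k') ` A = A" "0 < k'" for A k'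
  proof -
    define R where "R = (\<Union>j\<in>{..<k} - {i}. (f ^^ j) ` I)"
    have "closed R" unfolding R_def
      by (intro closed_UN ballI compact_imp_closed iter_compact D) auto
    moreover have "I' \<inter> R \<inter> A = {}"
    proof -
      have "(f ^^ i) ` I \<inter> (f ^^ j) ` I = {}" if "j \<in> {..<k} - {i}" for j
        using I i(1) that unfolding weakly_periodic_def disjoint_family_on_def by blast
      then show ?thesis unfolding I'_def R_def by blast
    qed
    moreover have "A \<subseteq> I' \<union> R" using A(3) unfolding orb_def I'_def R_def by blast
    ultimately have "I' \<inter> A = {} \<or> R \<inter> A = {}"
      using compact_imp_closed[OF D'(2)] by (intro connected_closedD[OF A(1)]) auto
    then have AI': "A \<subseteq> I'" using A(2) zI' \<open>A \<subseteq> I' \<union> R\<close> by blast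
    have "A \<subseteq> K n" for n
    proof -
      have "A = ((f ^^ k') ^^ (n * k)) ` A" by (rule funpow_image_eq[OF A(4), symmetric])
      also have "\<dots> = (f ^^ (k' * n * k)) ` A" by (simp add: funpow_mult mult.assoc)
      also have "\<dots> \<subseteq> K (k' * n)" unfolding K_def by (rule image_mono[OF AI'])
      also have "\<dots> \<subseteq> K n" using A(5) by (intro K_anti) simp
      finally show ?thesis .
    qed
    then show "A \<subseteq> J" unfolding J_def by blast
  qed
  show thesis by (rule that[OF per zJ W_orbJ orbJ max])
qed

text \<open>All cores are taken around one point \<open>z\<close> of \<open>W\<close>. Their
  intersection is an interval inside \<open>W\<close>, hence only \<open>z\<close>. With bounded
  periods every point of \<open>W\<close> would be one of finitely many iterates of
  \<open>z\<close>, but \<open>W\<close> is infinite.\<close>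

lemma solenoid_of_nested:
  assumes W: "f ` W = W" "infinite W" "closed W" "interior W = {}"
    and I: "\<And>j. weakly_periodic f (I j) (k j)"
    and nest: "\<And>j. orb f (I (Suc j)) (k (Suc j)) \<subseteq> orb f (I j) (k j)"
    and Weq: "W = (\<Inter>j. orb f (I j) (k j))"
  shows "solenoid f W"
proof -
  obtain z where z: "z \<in> W" using W(2) by (metis finite.emptyI ex_in_conv)
  have Wsub: "W \<subseteq> orb f (I j) (k j)" for j using Weq by blast
  have "\<exists>J. periodic_interval f J (k j) \<and> z \<in> J \<and> W \<subseteq> orb f J (k j) \<and> orb f J (k j) \<subseteq> orb f (I j) (k j) \<and>
    (\<forall>A k'. connected A \<longrightarrow> z \<in> A \<longrightarrow> A \<subseteq> orb f (I j) (k j) \<longrightarrow> (f ^^ k') ` A = A \<longrightarrow> 0 < k' \<longrightarrow> A \<subseteq> J)" for j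
    by (rule weakly_periodic_core[OF I[of j] W(1) Wsub[of j] W(2) z]) blast
  then have "\<forall>j. \<exists>J. periodic_interval f J (k j) \<and> z \<in> J \<and> W \<subseteq> orb f J (k j) \<and> orb f J (k j) \<subseteq> orb f (I j) (k j) \<and>
    (\<forall>A k'. connected A \<longrightarrow> z \<in> A \<longrightarrow> A \<subseteq> orb f (I j) (k j) \<longrightarrow> (f ^^ k') ` A = A \<longrightarrow> 0 < k' \<longrightarrow> A \<subseteq> J)" ..
  from choice[OF this] obtain J where J0: "\<forall>j. periodic_interval f (J j) (k j) \<and> z \<in> J j \<and> W \<subseteq> orb f (J j) (k j) \<and> orb f (J j) (k j) \<subseteq> orb f (I j) (k j) \<and>
    (\<forall>A k'. connected A \<longrightarrow> z \<in> A \<longrightarrow> A \<subseteq> orb f (I j) (k j) \<longrightarrow> (f ^^ k') ` A = A \<longrightarrow> 0 < k' \<longrightarrow> A \<subseteq> J j)" ..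
  have J: "\<And>j. periodic_interval f (J j) (k j)" "\<And>j. z \<in> J j"
    "\<And>j. W \<subseteq> orb f (J j) (k j)" "\<And>j. orb f (J j) (k j) \<subseteq> orb f (I j) (k j)"
    "\<And>j A k'. connected A \<Longrightarrow> z \<in> A \<Longrightarrow> A \<subseteq> orb f (I j) (k j) \<Longrightarrow> (f ^^ k') ` A = A \<Longrightarrow> 0 < k' \<Longrightarrow> A \<subseteq> J j"
    using J0 by simp_all
  have Jw: "weakly_periodic f (J j) (k j)" for j by (rule periodic_imp_weakly_periodic[OF J(1)])
  have Jeq: "(f ^^ k j) ` J j = J j" for j using J(1)[of j] unfolding periodic_interval_def by blast
  have Jnest: "J (Suc j) \<subseteq> J j" for j
  proof (rule J(5)[OF _ J(2) _ Jeq weakly_periodicD(4)[OF Jw]])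
    show "connected (J (Suc j))" by (rule weakly_periodicD(3)[OF Jw])
    have "J (Suc j) \<subseteq> orb f (J (Suc j)) (k (Suc j))"
      using weakly_periodicD(4)[OF Jw[of "Suc j"]] unfolding orb_def by force
    then show "J (Suc j) \<subseteq> orb f (I j) (k j)" using J(4)[of "Suc j"] nest[of j] by blast
  qed
  have Janti: "J n \<subseteq> J m" if "m \<le> n" for m n
    by (rule lift_Suc_antimono_le[of J, OF Jnest that])
  have WJ: "W = (\<Inter>j. orb f (J j) (k j))"
    using J(3,4) Weq by blast
  \<comment> \<open>The point \<open>z\<close> lies in \<open>J j\<close> and in its image at time
    \<open>k (Suc j)\<close>, so \<open>k j\<close> divides \<open>k (Suc j)\<close>.\<close>
  have "k j \<le> k (Suc j)" for j
  proof -
    have "z \<in> (f ^^ k (Suc j)) ` J (Suc j)" using J(2) Jeq by blast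
    then have "z \<in> (f ^^ k (Suc j)) ` J j" using Jnest by blast
    then have "(f ^^ k (Suc j)) ` J j \<inter> (f ^^ 0) ` J j \<noteq> {}" using J(2)[of j] by auto
    then have "k (Suc j) mod k j = 0 mod k j" by (rule weakly_periodic_disjoint[OF Jw])
    then show ?thesis using weakly_periodicD(4)[OF Jw[of "Suc j"]] by (auto intro: dvd_imp_le)
  qed
  then have mono_k: "mono k" by (rule mono_iff_le_Suc[THEN iffD2, rule_format])
  have INTz: "(\<Inter>j. J j) = {z}"
  proof -
    have com: "compact (\<Inter>j. J j)" by (rule compact_Inter) (use weakly_periodicD(2)[OF Jw] in auto)
    have con: "connected (\<Inter>j. J j)"
      by (rule connected_nest[OF weakly_periodicD(2)[OF Jw] weakly_periodicD(3)[OF Jw] Janti])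
    obtain a b where ab: "(\<Inter>j. J j) = {a..b}" using compact_connected_real[OF com con] by blast
    have zin: "z \<in> {a..b}" using J(2) ab by blast
    have "J j \<subseteq> orb f (J j) (k j)" for j
      using weakly_periodicD(4)[OF Jw[of j]] unfolding orb_def by force
    then have "(\<Inter>j. J j) \<subseteq> W" unfolding WJ by blast
    then have "{a<..<b} \<subseteq> W" unfolding ab using greaterThanLessThan_subseteq_atLeastAtMost_iff by blast
    then have "{a<..<b} \<subseteq> interior W" by (rule interior_maximal) simp
    then have "\<not> a < b" unfolding W(4) by (simp add: dense)
    then have "a = z" "b = z" using zin by auto
    then show ?thesis unfolding ab by simp
  qed
  have "filterlim k at_top sequentially"
  proof (rule ccontr)
    assume "\<not> filterlim k at_top sequentially"
    then obtain B where B0: "\<And>N. \<exists>n\<ge>N. \<not> B \<le> k n"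
      unfolding filterlim_at_top eventually_sequentially by blast
    have B: "k j < B" for j
    proof -
      obtain n where "n \<ge> j" "\<not> B \<le> k n" using B0 by blast
      then show ?thesis using monoD[OF mono_k, of j n] by linarith
    qed
    have "W \<subseteq> (\<lambda>i. (f ^^ i) z) ` {..<B}"
    proof
      fix w assume "w \<in> W"
      have "\<forall>j. \<exists>i. i \<in> {..<B} \<and> w \<in> (f ^^ i) ` J j"
      proof
        fix j
        obtain i where "i < k j" "w \<in> (f ^^ i) ` J j"
          using \<open>w \<in> W\<close> unfolding WJ orb_def by blast
        then show "\<exists>i. i \<in> {..<B} \<and> w \<in> (f ^^ i) ` J j"
          using B[of j] by (intro exI[of _ i]) auto
      qed
      then obtain g where g0: "\<forall>j. g j \<in> {..<B} \<and> w \<in> (f ^^ g j) ` J j" by (rule choice[THEN exE])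
      have g: "\<And>j. g j \<in> {..<B}" "\<And>j. w \<in> (f ^^ g j) ` J j" using g0 by blast+
      have "finite (range g)" by (rule finite_subset[of _ "{..<B}"]) (use g(1) in auto)
      \<comment> \<open>An index that serves infinitely many \<open>j\<close> serves all of them,
        because the \<open>J j\<close> are nested.\<close>
      then obtain i where i: "i \<in> range g" "infinite {j. g j = i}"
        using pigeonhole_infinite[of UNIV g] by (auto simp: infinite_UNIV_nat)
      have "w \<in> (f ^^ i) ` J j" for j
      proof -
        obtain n where "n \<ge> j" "g n = i" using i(2) unfolding infinite_nat_iff_unbounded_le by auto
        then show ?thesis using g(2)[of n] Janti by blast
      qed
      then have "w \<in> (\<Inter>j. (f ^^ i) ` J j)" by blast
      also have "\<dots> = (f ^^ i) ` (\<Inter>j. J j)"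
        by (intro image_INT_nested[symmetric] weakly_periodicD(2)[OF Jw] Janti
          continuous_on_subset[OF iter_cont weakly_periodicD(1)[OF Jw]])
      finally have "w = (f ^^ i) z" unfolding INTz by simp
      moreover have "i < B" using i(1) g(1) by auto
      ultimately show "w \<in> (\<lambda>i. (f ^^ i) z) ` {..<B}" by blast
    qed
    then show False using W(2) finite_subset by blast
  qed
  then show ?thesis
    unfolding solenoid_def using J(1) Jnest WJ W(3,4)
    by (intro exI[of _ J] exI[of _ k]) (simp add: closure_closed)
qed

end

section \<open>Generic points\<close>

text \<open>A set \<open>A\<close> together with the complement of its closure is open and dense,
  and a point belongs to this union exactly if lying in the closure of \<open>A\<close> forces it to
  lie in \<open>A\<close>. Baire's theorem applies to the countable intersection.\<close>

lemma residual_regular: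
  assumes "countable \<O>" and op: "\<And>A. A \<in> \<O> \<Longrightarrow> openin (top_of_set {0..1::real}) A"
  shows "residual_in (top_of_set {0..1}) {x \<in> {0..1}. \<forall>A\<in>\<O>. x \<in> closure A \<longrightarrow> x \<in> A}"
    (is "residual_in _ ?G")
proof -
  define T where "T A = A \<union> ({0..1} - closure A)" for A :: "real set"
  have T_open: "openin (top_of_set {0..1}) (T A)" if "A \<in> \<O>" for A
  proof -
    have "openin (top_of_set {0..1}) ({0..1} \<inter> - closure A)"
      by (rule openin_open_Int) (rule open_Compl[OF closed_closure])
    then show ?thesis
      unfolding T_def Diff_eq by (rule openin_Un[OF op[OF that]])
  qed
  have T_dense: "{0..1} \<subseteq> closure (T A)" for A
  proof
    fix x :: real assume "x \<in> {0..1}"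
    then show "x \<in> closure (T A)"
      using closure_mono[of A "T A"] closure_subset[of "T A"] unfolding T_def by blast
  qed
  \<comment> \<open>Inserting \<open>{0..1}\<close> keeps the intersection inside the unit interval
    even for an empty family.\<close>
  define \<F> where "\<F> = insert {0..1} (T ` \<O>)"
  have F_count: "countable \<F>" unfolding \<F>_def using assms(1) by simp
  have F_open: "openin (top_of_set {0..1}) S \<and> {0..1} \<subseteq> closure S" if "S \<in> \<F>" for S
    using that T_open T_dense unfolding \<F>_def by (auto simp: subset_iff)
  have G_eq: "?G = \<Inter>\<F>"
    unfolding \<F>_def T_def using op by (auto dest: openin_imp_subset)
  have dense: "{0..1} \<subseteq> closure (\<Inter>\<F>)"
    by (rule Baire[OF closed_atLeastAtMost F_count F_open])
  have gd: "gdelta_in (top_of_set {0..1}) (\<Inter>\<F>)"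
    using F_open by (intro gdelta_in_Inter F_count) (auto simp: \<F>_def open_imp_gdelta_in)
  show ?thesis
    unfolding residual_in_def G_eq
  proof (intro conjI exI[of _ "\<Inter>\<F>"])
    show sub: "\<Inter>\<F> \<subseteq> topspace (top_of_set {0..1})" unfolding \<F>_def by auto
    show "top_of_set {0..1} closure_of \<Inter>\<F> = topspace (top_of_set {0..1})"
      using dense sub by (simp add: closure_of_subtopology Int_absorb1 Int_absorb2)
  qed (use gd in auto)
qed

context unit_map
begin

definition hits :: "real \<Rightarrow> real \<Rightarrow> nat \<Rightarrow> real set" where
  "hits p q m = {y \<in> {0..1}. \<exists>n\<ge>m. (f ^^ n) y \<in> {p<..<q}}"

lemma hits_open: "openin (top_of_set {0..1}) (hits p q m)"
proof -
  have "hits p q m = (\<Union>n\<in>{m..}. {0..1} \<inter> (f ^^ n) -` {p<..<q})"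
    unfolding hits_def by auto
  also have "openin (top_of_set {0..1}) \<dots>"
    by (intro openin_Union ballI) (auto intro!: continuous_openin_preimage_gen iter_cont)
  finally show ?thesis .
qed

definition near :: "real \<Rightarrow> real \<Rightarrow> real set" where
  "near x e = {0..1} \<inter> ball x e"

lemma near_subset: "near x e \<subseteq> {0..1}"
  unfolding near_def by blast

lemma near_connected: "connected (near x e)"
  unfolding near_def by (intro convex_connected convex_Int convex_ball) simp

lemma near_center: "x \<in> {0..1} \<Longrightarrow> 0 < e \<Longrightarrow> x \<in> near x e"
  unfolding near_def by simp

text \<open>The negation provides a neighbourhood with pairwise disjoint images, that is, a
  wandering interval unless its points tend to a cycle.\<close>

definition recurrent_near :: "real \<Rightarrow> bool" where
  "recurrent_near x \<longleftrightarrow> (\<forall>e>0. \<exists>a b. a < b \<and> (f ^^ a) ` near x e \<inter> (f ^^ b) ` near x e \<noteq> {})"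

lemma not_recurrent_near_cycle:
  assumes x: "x \<in> {0..1}" and "\<not> recurrent_near x"
    and nw: "\<not> (\<exists>I. wandering_interval f I)"
  shows "is_cycle f (omega_limit f x)"
proof -
  define P where "P e a b \<longleftrightarrow> (f ^^ a) ` near x e \<inter> (f ^^ b) ` near x e = {}" for e a b
  have "\<not> (\<forall>e>0. \<exists>a b. a < b \<and> \<not> P e a b)"
    using assms(2) unfolding recurrent_near_def P_def .
  then obtain e where "e > 0" "\<And>a b. a < b \<Longrightarrow> P e a b" by blast
  then have e: "e > 0" "\<And>a b. a < b \<Longrightarrow> (f ^^ a) ` near x e \<inter> (f ^^ b) ` near x e = {}"
    unfolding P_def by simp_all
  \<comment> \<open>The neighbourhood is one-sided if \<open>x\<close> is an endpoint; hence a
    second point is sought on the right or on the left.\<close>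
  have "\<exists>u\<in>near x e. \<exists>v\<in>near x e. u < v"
  proof (cases "x < 1")
    case True
    define v where "v = min 1 (x + e / 2)"
    have "x < v" "v \<in> near x e" using True x e(1) unfolding near_def v_def by (auto simp: dist_real_def)
    then show ?thesis using near_center[OF x e(1)] by blast
  next
    case False
    define v where "v = max 0 (x - e / 2)"
    have "v < x" "v \<in> near x e" using False x e(1) unfolding near_def v_def by (auto simp: dist_real_def)
    then show ?thesis using near_center[OF x e(1)] by blast
  qed
  moreover have "\<forall>m n. m < n \<longrightarrow> (f ^^ n) ` near x e \<inter> (f ^^ m) ` near x e = {}"
    using e(2) by blast
  moreover have "is_interval (near x e)" using near_connected is_interval_connected_1 by blast
  ultimately have "\<exists>C. is_cycle f C \<and> (\<forall>x\<in>near x e. omega_limit f x = C)"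
    using nw near_subset unfolding wandering_interval_def by metis
  then obtain C where "is_cycle f C" "\<forall>x\<in>near x e. omega_limit f x = C" by (elim exE conjE)
  then show ?thesis using near_center[OF x e(1)] by simp
qed

text \<open>The late images of a neighbourhood \<open>U j\<close> have a forward invariant closure
  \<open>C j\<close>. Recurrence makes one component of \<open>C j\<close> return to itself, and its
  orbit is all of \<open>C j\<close>. These sets decrease to the limit set, so
  \<open>solenoid_of_nested\<close> applies.\<close>

lemma omega_solenoid:
  assumes x: "x \<in> {0..1}" and rec: "recurrent_near x"
    and gen: "\<And>p q m. p \<in> \<rat> \<Longrightarrow> q \<in> \<rat> \<Longrightarrow> x \<in> closure (hits p q m) \<Longrightarrow> x \<in> hits p q m"
    and inf: "infinite (omega_limit f x)" and int: "interior (omega_limit f x) = {}"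
  shows "solenoid f (omega_limit f x)"
proof -
  define e where "e j = 1 / (real j + 1)" for j :: nat
  have e: "0 < e j" for j by (simp add: e_def)
  have e_anti: "e (Suc j) \<le> e j" for j by (simp add: e_def frac_le)
  define U where "U j = near x (e j)" for j
  have U01: "U j \<subseteq> {0..1}" and Ucon: "connected (U j)" and xU: "x \<in> U j" for j
    unfolding U_def by (rule near_subset, rule near_connected, rule near_center[OF x e])
  have U_anti: "U (Suc j) \<subseteq> U j" for j
    unfolding U_def near_def using subset_ball[OF e_anti[of j], of x] by blast
  have "\<forall>j. \<exists>ab. fst ab < snd ab \<and> (f ^^ fst ab) ` U j \<inter> (f ^^ snd ab) ` U j \<noteq> {}"
    using rec e unfolding recurrent_near_def U_def by (metis fst_conv snd_conv)
  from choice[OF this] obtain ab :: "nat \<Rightarrow> nat \<times> nat"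
    where ab: "\<And>j. fst (ab j) < snd (ab j)" "\<And>j. (f ^^ fst (ab j)) ` U j \<inter> (f ^^ snd (ab j)) ` U j \<noteq> {}"
    by blast
  \<comment> \<open>At least the first of the two times at which images of \<open>U j\<close> meet,
    so that the images at times \<open>m j\<close> and \<open>m j + t j\<close> still meet; the
    remaining terms make \<open>m\<close> monotone and at least \<open>j\<close>.\<close>
  define m where "m j = j + (\<Sum>i\<le>j. fst (ab i))" for j
  define t where "t j = snd (ab j) - fst (ab j)" for j
  have t_pos: "0 < t j" for j unfolding t_def using ab(1)[of j] by simp
  have m_ge: "j \<le> m j" and m_Suc: "m j \<le> m (Suc j)" for j unfolding m_def by simp_all
  have ret: "(f ^^ t j) ` (f ^^ m j) ` U j \<inter> (f ^^ m j) ` U j \<noteq> {}" for j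
  proof -
    have "fst (ab j) \<le> m j" unfolding m_def
      using member_le_sum[of j "{..j}" "\<lambda>i. fst (ab i)"] by simp
    then obtain i where i: "m j = i + fst (ab j)" by (metis add.commute le_Suc_ex)
    have i2: "t j + m j = i + snd (ab j)" unfolding i t_def using ab(1)[of j] by simp
    have "(f ^^ i) ` ((f ^^ fst (ab j)) ` U j \<inter> (f ^^ snd (ab j)) ` U j) \<noteq> {}"
      using ab(2)[of j] by (simp del: image_image)
    moreover have "(f ^^ i) ` ((f ^^ fst (ab j)) ` U j \<inter> (f ^^ snd (ab j)) ` U j) \<subseteq>
        (f ^^ (i + fst (ab j))) ` U j \<inter> (f ^^ (i + snd (ab j))) ` U j"
      unfolding funpow_image_add by (rule image_Int_subset)
    ultimately have "(f ^^ (i + fst (ab j))) ` U j \<inter> (f ^^ (i + snd (ab j))) ` U j \<noteq> {}"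
      by (metis subset_empty)
    then show ?thesis unfolding funpow_image_add[symmetric] i2 unfolding i by (simp only: Int_commute not_False_eq_True)
  qed
  define S where "S j = (\<Union>n\<in>{m j..}. (f ^^ n) ` U j)" for j
  define C where "C j = closure (S j)" for j
  have S01: "S j \<subseteq> {0..1}" for j unfolding S_def using iter_image[OF U01] by blast
  have C01: "C j \<subseteq> {0..1}" for j unfolding C_def by (rule closure_minimal[OF S01]) simp
  have Ccl: "closed (C j)" for j unfolding C_def by simp
  have Ccom: "compact (C j)" for j
    using compact_Int_closed[OF compact_Icc Ccl, of 0 1 j] C01[of j] by (simp add: Int_absorb1)
  have fC: "f ` C j \<subseteq> C j" for j
  proof -
    have "f ` S j \<subseteq> S j"
    proof
      fix w assume "w \<in> f ` S j"
      then obtain n u where "n \<ge> m j" "u \<in> U j" "w = f ((f ^^ n) u)" unfolding S_def by auto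
      then have "Suc n \<in> {m j..}" "w \<in> (f ^^ Suc n) ` U j" by auto
      then show "w \<in> S j" unfolding S_def by blast
    qed
    then have "f ` S j \<subseteq> C j" unfolding C_def using closure_subset by blast
    then show ?thesis
      unfolding C_def using continuous_on_subset[OF cont C01[of j, unfolded C_def]]
      by (intro image_closure_subset) auto
  qed
  define I where "I j = connected_component_set (C j) ((f ^^ m j) x)" for j
  have fU_S: "(f ^^ n) ` U j \<subseteq> C j" if "n \<ge> m j" for n j
    unfolding C_def S_def using that closure_subset by fastforce
  have fU_I: "(f ^^ m j) ` U j \<subseteq> I j" for j
    unfolding I_def
    by (intro connected_component_maximal imageI xU iter_connected U01 Ucon fU_S order_refl)
  have "\<exists>k. weakly_periodic f (I j) k" for j
  proof (rule weakly_periodic_component[OF Ccom C01 fC I_def t_pos])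
    show "(f ^^ t j) ` I j \<inter> I j \<noteq> {}"
      using ret[of j] fU_I[of j] image_mono[OF fU_I[of j], of "f ^^ t j"] by blast
  qed
  then have "\<forall>j. \<exists>k. weakly_periodic f (I j) k" ..
  from choice[OF this] obtain k where k: "\<And>j. weakly_periodic f (I j) (k j)" by blast
  have orbC: "orb f (I j) (k j) = C j" for j
  proof
    have "I j \<subseteq> C j" unfolding I_def by (rule connected_component_subset)
    then show "orb f (I j) (k j) \<subseteq> C j"
      unfolding orb_def using funpow_image_subset[OF fC] by blast
    show "C j \<subseteq> orb f (I j) (k j)"
      unfolding C_def
    proof (rule closure_minimal)
      show "closed (orb f (I j) (k j))" by (rule compact_imp_closed[OF orb_compact[OF k]])
      show "S j \<subseteq> orb f (I j) (k j)"
        unfolding S_def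
      proof (rule UN_least)
        fix n assume n: "n \<in> {m j..}"
        have "(f ^^ n) ` U j = (f ^^ (n - m j)) ` (f ^^ m j) ` U j"
          unfolding funpow_image_add[symmetric] using n by simp
        also have "\<dots> \<subseteq> (f ^^ (n - m j)) ` I j" by (rule image_mono[OF fU_I])
        finally show "(f ^^ n) ` U j \<subseteq> orb f (I j) (k j)"
          unfolding weakly_periodic_orb[OF k, symmetric] by blast
      qed
    qed
  qed
  have CS: "C (Suc j) \<subseteq> C j" for j
  proof -
    have "S (Suc j) \<subseteq> S j"
      unfolding S_def using m_Suc[of j] U_anti[of j] by (intro UN_mono image_mono) auto
    then show ?thesis unfolding C_def by (rule closure_mono)
  qed
  have C_anti: "C j \<subseteq> C i" if "i \<le> j" for i j by (rule lift_Suc_antimono_le[of C, OF CS that])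
  have eq: "omega_limit f x = (\<Inter>j. C j)"
  proof
    show "omega_limit f x \<subseteq> (\<Inter>j. C j)"
    proof (rule INT_greatest)
      fix j show "omega_limit f x \<subseteq> C j"
        by (rule omega_subset_closed[OF Ccl, of "m j"]) (use fU_S xU in blast)
    qed
    \<comment> \<open>Here genericity enters: points arbitrarily close to \<open>x\<close> visit
      each rational interval around \<open>y\<close> after time \<open>N\<close>, so
      \<open>x\<close> does as well.\<close>
    show "(\<Inter>j. C j) \<subseteq> omega_limit f x"
    proof
      fix y assume y: "y \<in> (\<Inter>j. C j)"
      show "y \<in> omega_limit f x"
        unfolding omega_limit_iff
      proof (intro allI impI)
        fix d :: real and N :: nat assume d: "d > 0"
        obtain p where p: "p \<in> \<rat>" "y - d < p" "p < y" using Rats_dense_in_real[of "y - d" y] d by auto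
        obtain q where q: "q \<in> \<rat>" "y < q" "q < y + d" using Rats_dense_in_real[of y "y + d"] d by auto
        have "x \<in> closure (hits p q N)"
          unfolding closure_approachable
        proof (intro allI impI)
          fix r :: real assume r: "r > 0"
          obtain i :: nat where i: "1 / r < real i" using reals_Archimedean2 by blast
          define j where "j = max i N"
          have "1 / r < real j + 1" using i unfolding j_def by linarith
          then have ej: "e j < r" unfolding e_def using r by (simp add: field_simps)
          have "y \<in> closure (S j)" using y unfolding C_def by blast
          moreover have "open {p<..<q}" "y \<in> {p<..<q}" using p q by auto
          ultimately obtain w where w: "w \<in> S j" "w \<in> {p<..<q}"
            unfolding closure_iff_nhds_not_empty by (metis disjoint_iff order_refl)
          then obtain n u where u: "n \<ge> m j" "u \<in> U j" "w = (f ^^ n) u" unfolding S_def by auto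
          have "n \<ge> N" using u(1) m_ge[of j] unfolding j_def by linarith
          then have "u \<in> hits p q N" unfolding hits_def using u w U01 by blast
          moreover have "dist u x < r" using u(2) ej unfolding U_def near_def by (simp add: dist_commute)
          ultimately show "\<exists>u\<in>hits p q N. dist u x < r" by blast
        qed
        then have "x \<in> hits p q N" by (rule gen[OF p(1) q(1)])
        then obtain n where n: "n \<ge> N" "(f ^^ n) x \<in> {p<..<q}" unfolding hits_def by blast
        have "\<bar>(f ^^ n) x - y\<bar> < d" using n(2) p(2) q(3) by auto
        then show "\<exists>n\<ge>N. \<bar>(f ^^ n) x - y\<bar> < d" using n(1) by blast
      qed
    qed
  qed
  show ?thesis
  proof (rule solenoid_of_nested[OF omega_image[OF x] inf omega_closed int k])
    show "orb f (I (Suc j)) (k (Suc j)) \<subseteq> orb f (I j) (k j)" for j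
      unfolding orbC by (rule CS)
    show "omega_limit f x = (\<Inter>j. orb f (I j) (k j))"
      unfolding orbC by (rule eq)
  qed
qed

end

section \<open>Covering interval maps\<close>

definition birkhoff_sum :: "('a \<Rightarrow> 'a) \<Rightarrow> ('a \<Rightarrow> real) \<Rightarrow> nat \<Rightarrow> 'a \<Rightarrow> real" where
  "birkhoff_sum u \<Phi> n y = (\<Sum>t<n. \<Phi> ((u ^^ t) y))"

lemma birkhoff_sum_add:
  "birkhoff_sum u \<Phi> (m + n) y = birkhoff_sum u \<Phi> m y + birkhoff_sum u \<Phi> n ((u ^^ m) y)"
proof (induction n)
  case (Suc n)
  have "(u ^^ (m + n)) y = (u ^^ n) ((u ^^ m) y)" by (metis add.commute comp_apply funpow_add)
  then show ?case using Suc by (simp add: birkhoff_sum_def)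
qed (simp add: birkhoff_sum_def)

lemma birkhoff_sum_bound:
  assumes "\<And>t. t < n \<Longrightarrow> \<bar>\<Phi> ((u ^^ t) y)\<bar> \<le> B"
  shows "\<bar>birkhoff_sum u \<Phi> n y\<bar> \<le> n * B"
proof -
  have "\<bar>birkhoff_sum u \<Phi> n y\<bar> \<le> (\<Sum>t<n. \<bar>\<Phi> ((u ^^ t) y)\<bar>)"
    unfolding birkhoff_sum_def by (rule sum_abs)
  also have "\<dots> \<le> (\<Sum>t<n. B)" by (rule sum_mono) (use assms in simp)
  finally show ?thesis by simp
qed

lemma birkhoff_sum_diff:
  assumes "\<And>t. t < n \<Longrightarrow> \<bar>\<Phi> ((u ^^ t) y) - \<Phi> ((u ^^ t) z)\<bar> \<le> B"
  shows "\<bar>birkhoff_sum u \<Phi> n y - birkhoff_sum u \<Phi> n z\<bar> \<le> n * B"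
proof -
  have "\<bar>birkhoff_sum u \<Phi> n y - birkhoff_sum u \<Phi> n z\<bar> \<le> (\<Sum>t<n. \<bar>\<Phi> ((u ^^ t) y) - \<Phi> ((u ^^ t) z)\<bar>)"
    unfolding birkhoff_sum_def sum_subtractf[symmetric] by (rule sum_abs)
  also have "\<dots> \<le> (\<Sum>t<n. B)" by (rule sum_mono) (use assms in simp)
  finally show ?thesis by simp
qed

text \<open>Cut \<open>{a..b}\<close> into cells shorter than \<open>\<delta> / 2\<close>. Every
  interval of length at least \<open>\<delta>\<close> contains one of these finitely many cells, and
  a bound that dominates those of all cells is uniform.\<close>

lemma uniform_on_long_intervals:
  fixes a b \<delta> :: real and R :: "real \<Rightarrow> real \<Rightarrow> nat \<Rightarrow> bool"
  assumes ab: "a < b" "0 < \<delta>"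
    and ex: "\<And>c d. a \<le> c \<Longrightarrow> c < d \<Longrightarrow> d \<le> b \<Longrightarrow> \<exists>N. R c d N"
    and mono: "\<And>c d N N'. R c d N \<Longrightarrow> N \<le> N' \<Longrightarrow> R c d N'"
    and enlarge: "\<And>c d c' d' N. R c d N \<Longrightarrow> a \<le> c' \<Longrightarrow> c' \<le> c \<Longrightarrow> c < d \<Longrightarrow> d \<le> d' \<Longrightarrow> d' \<le> b \<Longrightarrow> R c' d' N"
  shows "\<exists>N. \<forall>c d. a \<le> c \<longrightarrow> d \<le> b \<longrightarrow> \<delta> \<le> d - c \<longrightarrow> R c d N"
proof -
  obtain n :: nat where n: "2 * (b - a) / \<delta> < real n" using reals_Archimedean2 by blast
  have "0 < 2 * (b - a) / \<delta>" using ab by simp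
  then have n0: "0 < n" using n by (metis less_trans of_nat_0_less_iff)
  define w where "w = (b - a) / n"
  have w: "0 < w" "n * w = b - a" unfolding w_def using n0 ab by auto
  have "2 * (b - a) < n * \<delta>" using n ab by (simp add: field_simps)
  then have "n * (2 * w) < n * \<delta>" using w(2) by simp
  then have w2: "2 * w < \<delta>" using n0 by simp
  have cell: "\<exists>N. R (a + real i * w) (a + real (Suc i) * w) N" if i: "i < n" for i
  proof (rule ex)
    have "real (Suc i) * w \<le> real n * w" using i w(1) by (intro mult_right_mono) auto
    then show "a + real (Suc i) * w \<le> b" using w(2) by simp
  qed (use w(1) in \<open>auto simp: algebra_simps\<close>)
  then have "\<forall>i. \<exists>N. i < n \<longrightarrow> R (a + real i * w) (a + real (Suc i) * w) N" by blast
  from choice[OF this] obtain g where g: "\<And>i. i < n \<Longrightarrow> R (a + real i * w) (a + real (Suc i) * w) (g i)" by blast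
  show ?thesis
  proof (intro exI allI impI)
    fix c d assume cd: "a \<le> c" "d \<le> b" "\<delta> \<le> d - c"
    \<comment> \<open>The first cell whose left end is not before \<open>c\<close>; it ends before
      \<open>d\<close> because two cells are shorter than \<open>\<delta>\<close>.\<close>
    define i where "i = nat \<lceil>(c - a) / w\<rceil>"
    have "0 \<le> (c - a) / w" using cd(1) w(1) by simp
    then have i: "(c - a) / w \<le> real i" "real i < (c - a) / w + 1" unfolding i_def by linarith+
    have i1: "c - a \<le> real i * w" using i(1) w(1) by (simp add: field_simps)
    have i2: "real i * w < c - a + w" using i(2) w(1) by (simp add: field_simps)
    have i3: "real (Suc i) * w = real i * w + w" by (simp add: algebra_simps)
    have "real (Suc i) * w < real n * w" using i2 i3 w2 cd w(2) by linarith
    then have "real (Suc i) < real n" using w(1) mult_less_cancel_right_pos by blast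
    then have i4: "i < n" by simp
    have "R (a + real i * w) (a + real (Suc i) * w) (sum g {..<n})"
      using g[OF i4] by (rule mono) (rule member_le_sum, use i4 in auto)
    then show "R c d (sum g {..<n})"
      by (rule enlarge) (use cd i1 i2 i3 w2 w(1) in linarith)+
  qed
qed

lemma between_image:
  fixes g :: "real \<Rightarrow> real"
  assumes "continuous_on {c..d} g" "y1 \<in> {c..d}" "y2 \<in> {c..d}" "g y1 \<le> v" "v \<le> g y2"
  shows "\<exists>y\<in>{c..d}. g y = v"
proof -
  have "connected (g ` {c..d})" by (rule connected_continuous_image[OF assms(1) connected_Icc])
  then have "v \<in> g ` {c..d}" by (rule connectedD_interval[of _ "g y1" "g y2"]) (use assms in auto)
  then show ?thesis by blast
qed

context interval_map
begin

lemma iter_cont_sub: "a \<le> c \<Longrightarrow> d \<le> b \<Longrightarrow> continuous_on {c..d} (u ^^ n)"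
  by (rule continuous_on_subset[OF iter_cont]) auto

lemma between_iter:
  assumes "a \<le> c" "d \<le> b" "y \<in> (u ^^ n) ` {c..d}" "z \<in> (u ^^ n) ` {c..d}" "y \<le> w" "w \<le> z"
  shows "w \<in> (u ^^ n) ` {c..d}"
  using connected_continuous_image[OF iter_cont_sub[OF assms(1,2)] connected_Icc] assms(3-)
  by (rule connectedD_interval)

lemma iter_image_interval:
  assumes "a \<le> c" "c \<le> d" "d \<le> b"
  obtains c' d' where "(u ^^ n) ` {c..d} = {c'..d'}" "a \<le> c'" "c' \<le> d'" "d' \<le> b"
proof -
  have "compact ((u ^^ n) ` {c..d})"
    by (rule compact_continuous_image[OF iter_cont_sub compact_Icc]) (use assms in auto)
  moreover have "connected ((u ^^ n) ` {c..d})"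
    by (rule connected_continuous_image[OF iter_cont_sub connected_Icc]) (use assms in auto)
  ultimately obtain c' d' where cd: "(u ^^ n) ` {c..d} = {c'..d'}"
    using is_interval_compact[of "(u ^^ n) ` {c..d}"] is_interval_connected_1[of "(u ^^ n) ` {c..d}"] by auto
  have "(u ^^ n) c \<in> {c'..d'}" unfolding cd[symmetric] using assms by simp
  then have le: "c' \<le> d'" by simp
  have "{c'..d'} \<subseteq> {a..b}" unfolding cd[symmetric] using iter_mem assms by force
  then show thesis using that[OF cd _ le] le by simp
qed

end

text \<open>The bound \<open>M\<close> asks for arbitrarily late times. As \<open>q\<close> is
  fixed, images contain it from some time on, so a late image that catches \<open>p\<close> covers
  everything between \<open>p\<close> and \<open>q\<close>.\<close>

locale covering_map = interval_map +
  fixes q :: real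
  assumes q: "a < q" "q < b" and q_fixed: "u q = q"
    and cover: "\<And>c d p M. \<lbrakk>a \<le> c; c < d; d \<le> b; a < p; p < b\<rbrakk> \<Longrightarrow> \<exists>m\<ge>M. p \<in> (u ^^ m) ` {c..d}"
begin

lemma q_iter: "(u ^^ n) q = q"
  by (induction n) (simp_all add: q_fixed)

lemma image_later:
  assumes "p \<in> (u ^^ m) ` A" "m \<le> n" shows "(u ^^ (n - m)) p \<in> (u ^^ n) ` A"
proof -
  have "(u ^^ (n - m)) p \<in> (u ^^ (n - m)) ` (u ^^ m) ` A" using assms(1) by (rule imageI)
  then show ?thesis unfolding funpow_image_add[symmetric] using assms(2) by simp
qed

lemma q_eventually:
  assumes "a \<le> c" "c < d" "d \<le> b"
  obtains m0 where "\<And>m. m \<ge> m0 \<Longrightarrow> q \<in> (u ^^ m) ` {c..d}"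
proof -
  obtain m0 where m0: "q \<in> (u ^^ m0) ` {c..d}" using cover[OF assms q, of 0] by blast
  show thesis using that[of m0] image_later[OF m0] q_iter by simp
qed

text \<open>A second periodic point is needed because images of an interval contain \<open>q\<close> from some time on, and
  a point of another cycle as well, which keeps their length away from \<open>0\<close>.\<close>

lemma second_periodic_point: "\<exists>p n. a < p \<and> p < b \<and> p \<noteq> q \<and> 0 < n \<and> (u ^^ n) p = p"
proof -
  define c where "c = (3 * q + b) / 4"
  define d where "d = (q + b) / 2"
  have cd: "q < c" "c < d" "d < b" "a \<le> c" "a < d" "d \<le> b" using q unfolding c_def d_def by auto
  obtain m0 where m0: "\<And>m. m \<ge> m0 \<Longrightarrow> q \<in> (u ^^ m) ` {c..d}"
    using q_eventually[OF cd(4,2,6)] by blast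
  obtain m where m: "m \<ge> max m0 1" "d \<in> (u ^^ m) ` {c..d}"
    using cover[OF cd(4,2,6,5,3), of "max m0 1"] by blast
  have qm: "q \<in> (u ^^ m) ` {c..d}" using m0 m(1) by simp
  obtain y1 where y1: "y1 \<in> {c..d}" "q = (u ^^ m) y1" using qm by blast
  obtain y2 where y2: "y2 \<in> {c..d}" "d = (u ^^ m) y2" using m(2) by blast
  \<comment> \<open>One point of \<open>{c..d}\<close> is sent to \<open>q\<close>, which is below
    \<open>c\<close>, and another to \<open>d\<close>; so the displacement changes sign, and its
    zero is a periodic point to the right of \<open>q\<close>.\<close>
  have "continuous_on {c..d} (\<lambda>y. (u ^^ m) y - y)"
    by (intro continuous_intros iter_cont_sub cd(4,6))
  then have "\<exists>y\<in>{c..d}. (u ^^ m) y - y = 0"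
    by (rule between_image[OF _ y1(1) y2(1)]) (use y1 y2 cd in auto)
  then obtain y where "y \<in> {c..d}" "(u ^^ m) y = y" by auto
  then show ?thesis using cd q m(1) by (intro exI[of _ y] exI[of _ m]) auto
qed

text \<open>The constant \<open>r\<close> is the distance from \<open>q\<close> to the orbit of a
  second periodic point \<open>p\<close>. That orbit avoids \<open>q\<close>, since it could not
  leave \<open>q\<close> to return to \<open>p\<close>. Once an image contains \<open>p\<close>, all
  later ones contain points of this orbit.\<close>

lemma images_leave_q:
  obtains r where "0 < r"
    "\<And>c d. a \<le> c \<Longrightarrow> c < d \<Longrightarrow> d \<le> b \<Longrightarrow> \<exists>m0. \<forall>m\<ge>m0. \<exists>y\<in>(u ^^ m) ` {c..d}. r \<le> \<bar>y - q\<bar>"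
proof -
  obtain p n where p: "a < p" "p < b" "p \<noteq> q" "0 < n" "(u ^^ n) p = p" using second_periodic_point by blast
  have ne: "(u ^^ i) p \<noteq> q" for i
  proof
    assume i: "(u ^^ i) p = q"
    have "i \<le> n * i" using p(4) by simp
    then have "(u ^^ (n * i)) p = (u ^^ (n * i - i)) ((u ^^ i) p)"
      by (metis comp_apply funpow_add le_add_diff_inverse2)
    then have "(u ^^ (n * i)) p = q" unfolding i q_iter .
    moreover have "(u ^^ (n * i)) p = p"
      using funpow_mod_eq[OF p(5), of "n * i"] by simp
    ultimately show False using p(3) by simp
  qed
  define r where "r = Min ((\<lambda>i. \<bar>(u ^^ i) p - q\<bar>) ` {..<n})"
  have fin: "finite ((\<lambda>i. \<bar>(u ^^ i) p - q\<bar>) ` {..<n})" "(\<lambda>i. \<bar>(u ^^ i) p - q\<bar>) ` {..<n} \<noteq> {}"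
    using p(4) by auto
  have "r \<in> (\<lambda>i. \<bar>(u ^^ i) p - q\<bar>) ` {..<n}" unfolding r_def by (rule Min_in[OF fin])
  then have "0 < r" using ne by auto
  moreover have r: "r \<le> \<bar>(u ^^ i) p - q\<bar>" for i
  proof -
    have "r \<le> \<bar>(u ^^ (i mod n)) p - q\<bar>" unfolding r_def
      by (rule Min_le[OF fin(1)]) (use p(4) in simp)
    then show ?thesis unfolding funpow_mod_eq[OF p(5)] .
  qed
  moreover have "\<exists>m0. \<forall>m\<ge>m0. \<exists>y\<in>(u ^^ m) ` {c..d}. r \<le> \<bar>y - q\<bar>" if cd: "a \<le> c" "c < d" "d \<le> b" for c d
  proof -
    obtain m0 where m0: "p \<in> (u ^^ m0) ` {c..d}" using cover[OF cd p(1,2), of 0] by blast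
    show ?thesis using image_later[OF m0] r by blast
  qed
  ultimately show thesis using that by blast
qed

section \<open>Lower bounds for the lengths of images, uniform in time\<close>

definition spread :: "real set \<Rightarrow> real \<Rightarrow> bool" where
  "spread A e \<longleftrightarrow> (\<exists>y\<in>A. \<exists>z\<in>A. e \<le> z - y)"

lemma spread_mono: "spread A e \<Longrightarrow> A \<subseteq> B \<Longrightarrow> e' \<le> e \<Longrightarrow> spread B e'"
  unfolding spread_def by (meson order_trans subsetD)

lemma spread_abs: "y \<in> A \<Longrightarrow> z \<in> A \<Longrightarrow> spread A \<bar>y - z\<bar>"
  unfolding spread_def abs_if by auto

text \<open>Late images contain \<open>q\<close> and a point at distance at least \<open>r\<close>
  from it. No early image is a single point, for then all later ones would be; so the minimum over
  the finitely many early times is positive.\<close>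

lemma images_spread:
  assumes cd: "a \<le> c" "c < d" "d \<le> b"
  shows "\<exists>e>0. \<forall>n. spread ((u ^^ n) ` {c..d}) e"
proof -
  obtain r where r: "0 < r"
    "\<And>c d. a \<le> c \<Longrightarrow> c < d \<Longrightarrow> d \<le> b \<Longrightarrow> \<exists>m0. \<forall>m\<ge>m0. \<exists>y\<in>(u ^^ m) ` {c..d}. r \<le> \<bar>y - q\<bar>"
    using images_leave_q by blast
  obtain m1 where m1: "\<And>m. m \<ge> m1 \<Longrightarrow> q \<in> (u ^^ m) ` {c..d}" using q_eventually[OF cd] by blast
  obtain m2 where m2: "\<forall>m\<ge>m2. \<exists>y\<in>(u ^^ m) ` {c..d}. r \<le> \<bar>y - q\<bar>" using r(2)[OF cd] by blast
  define m0 where "m0 = max m1 m2"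
  have late: "spread ((u ^^ m) ` {c..d}) r" if m: "m \<ge> m0" for m
  proof -
    obtain y where y: "y \<in> (u ^^ m) ` {c..d}" "r \<le> \<bar>y - q\<bar>" using m2 m unfolding m0_def by (meson max.boundedE)
    have "q \<in> (u ^^ m) ` {c..d}" using m1 m unfolding m0_def by simp
    from spread_mono[OF spread_abs[OF y(1) this] order_refl y(2)] show ?thesis .
  qed
  have single: "\<exists>e>0. spread ((u ^^ n) ` {c..d}) e" for n
  proof (rule ccontr)
    assume no: "\<not> ?thesis"
    have const: "y = z" if "y \<in> (u ^^ n) ` {c..d}" "z \<in> (u ^^ n) ` {c..d}" for y z
      using spread_abs[OF that] no by (metis eq_iff_diff_eq_0 zero_less_abs_iff)
    have "(u ^^ (m0 + n)) ` {c..d} \<subseteq> {(u ^^ m0) ((u ^^ n) c)}"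
    proof -
      have "(u ^^ n) c \<in> (u ^^ n) ` {c..d}" using cd by simp
      then have "(u ^^ n) ` {c..d} \<subseteq> {(u ^^ n) c}" using const by blast
      from image_mono[OF this, of "u ^^ m0"] show ?thesis unfolding funpow_image_add by simp
    qed
    then have "\<not> spread ((u ^^ (m0 + n)) ` {c..d}) r"
      using r(1) unfolding spread_def by (metis diff_self not_le singletonD subsetD)
    then show False using late[of "m0 + n"] by simp
  qed
  have early: "\<exists>e>0. \<forall>n<m. spread ((u ^^ n) ` {c..d}) e" for m
  proof (induction m)
    case 0
    then show ?case by (intro exI[of _ 1]) auto
  next
    case (Suc m)
    then obtain e1 where e1: "e1 > 0" "\<forall>n<m. spread ((u ^^ n) ` {c..d}) e1" by blast
    obtain e2 where e2: "e2 > 0" "spread ((u ^^ m) ` {c..d}) e2" using single by blast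
    show ?case
    proof (intro exI conjI allI impI)
      show "min e1 e2 > 0" using e1 e2 by simp
      fix n assume "n < Suc m"
      then consider "n < m" | "n = m" by linarith
      then show "spread ((u ^^ n) ` {c..d}) (min e1 e2)"
        by cases (use spread_mono[OF _ order_refl] e1(2) e2(2) in \<open>meson min.cobounded1 min.cobounded2\<close>)+
    qed
  qed
  obtain e1 where e1: "e1 > 0" "\<forall>n<m0. spread ((u ^^ n) ` {c..d}) e1" using early by blast
  show ?thesis
  proof (intro exI conjI allI)
    show "min e1 r > 0" using e1 r by simp
    fix n
    show "spread ((u ^^ n) ` {c..d}) (min e1 r)"
    proof (cases "n < m0")
      case True
      then show ?thesis using spread_mono[OF _ order_refl min.cobounded1] e1(2) by blast
    next
      case False
      then show ?thesis using spread_mono[OF late order_refl min.cobounded2] by simp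
    qed
  qed
qed

lemma images_spread_uniform:
  assumes "0 < \<delta>"
  obtains e where "0 < e" "\<And>c d n. a \<le> c \<Longrightarrow> d \<le> b \<Longrightarrow> \<delta> \<le> d - c \<Longrightarrow> spread ((u ^^ n) ` {c..d}) e"
proof -
  \<comment> \<open>Lower bounds are written as \<open>1 / (N + 1)\<close>, so that a larger
    \<open>N\<close> makes a weaker claim, as \<open>uniform_on_long_intervals\<close>
    requires.\<close>
  define R where "R c d N \<longleftrightarrow> (\<forall>n. spread ((u ^^ n) ` {c..d}) (1 / (real N + 1)))" for c d and N :: nat
  have "\<exists>N. \<forall>c d. a \<le> c \<longrightarrow> d \<le> b \<longrightarrow> \<delta> \<le> d - c \<longrightarrow> R c d N"
  proof (rule uniform_on_long_intervals[OF _ assms])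
    show "a < b" using q by simp
    fix c d assume cd: "a \<le> c" "c < d" "d \<le> b"
    obtain e where e: "e > 0" "\<forall>n. spread ((u ^^ n) ` {c..d}) e" using images_spread[OF cd] by blast
    obtain N :: nat where N: "1 / e < real N" using reals_Archimedean2 by blast
    have "1 / (real N + 1) \<le> e"
    proof -
      have "1 / e < real N + 1" using N by simp
      then show ?thesis using e(1) by (simp add: field_simps)
    qed
    then show "\<exists>N. R c d N" unfolding R_def using spread_mono[OF _ order_refl] e(2) by blast
  next
    fix c d and N N' :: nat assume R: "R c d N" and le: "N \<le> N'"
    have "1 / (real N' + 1) \<le> 1 / (real N + 1)" using le by (simp add: frac_le)
    then show "R c d N'" using R unfolding R_def using spread_mono[OF _ order_refl] by blast
  next
    fix c d c' d' :: real and N :: nat assume R: "R c d N" and le: "c' \<le> c" "d \<le> d'"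
    have "(u ^^ n) ` {c..d} \<subseteq> (u ^^ n) ` {c'..d'}" for n using le by (intro image_mono) auto
    then show "R c' d' N" using R unfolding R_def using spread_mono[OF _ _ order_refl] by blast
  qed
  then obtain N where N: "\<And>c d. a \<le> c \<Longrightarrow> d \<le> b \<Longrightarrow> \<delta> \<le> d - c \<Longrightarrow> R c d N" by blast
  show thesis by (rule that[of "1 / (real N + 1)"]) (use N[unfolded R_def] in auto)
qed

text \<open>A late image contains \<open>q\<close> together with a point near one endpoint, hence
  everything between. \<open>cover\<close> yields no common time for the two sides of
  \<open>q\<close>, so each has its own \<open>m\<close>.\<close>

lemma cover_uniform:
  assumes "0 < \<delta>" "0 < \<eta>"
  obtains M where "\<And>c d. a \<le> c \<Longrightarrow> d \<le> b \<Longrightarrow> \<delta> \<le> d - c \<Longrightarrow>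
    (\<exists>m\<le>M. {a + \<eta>..q} \<subseteq> (u ^^ m) ` {c..d}) \<and> (\<exists>m\<le>M. {q..b - \<eta>} \<subseteq> (u ^^ m) ` {c..d})"
proof -
  define R where "R c d M \<longleftrightarrow> (\<exists>m\<le>M. {a + \<eta>..q} \<subseteq> (u ^^ m) ` {c..d}) \<and> (\<exists>m\<le>M. {q..b - \<eta>} \<subseteq> (u ^^ m) ` {c..d})"
    for c d and M :: nat
  have "\<exists>N. \<forall>c d. a \<le> c \<longrightarrow> d \<le> b \<longrightarrow> \<delta> \<le> d - c \<longrightarrow> R c d N"
  proof (rule uniform_on_long_intervals[OF _ assms(1)])
    show "a < b" using q by simp
    fix c d assume cd: "a \<le> c" "c < d" "d \<le> b"
    obtain m0 where m0: "\<And>m. m \<ge> m0 \<Longrightarrow> q \<in> (u ^^ m) ` {c..d}" using q_eventually[OF cd] by blast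
    \<comment> \<open>Comparing with \<open>q\<close> keeps the targets in the open interval if
      \<open>\<eta>\<close> is large; the set to be covered is then empty or
      \<open>{q}\<close>.\<close>
    define p1 where "p1 = min (a + \<eta>) q"
    define p2 where "p2 = max (b - \<eta>) q"
    have p: "a < p1" "p1 < b" "a < p2" "p2 < b" using q assms unfolding p1_def p2_def by auto
    obtain m1 where m1: "m1 \<ge> m0" "p1 \<in> (u ^^ m1) ` {c..d}" using cover[OF cd p(1,2)] by blast
    obtain m2 where m2: "m2 \<ge> m0" "p2 \<in> (u ^^ m2) ` {c..d}" using cover[OF cd p(3,4)] by blast
    have "{a + \<eta>..q} \<subseteq> (u ^^ m1) ` {c..d}"
      using between_iter[OF cd(1,3) m1(2) m0[OF m1(1)]] unfolding p1_def by auto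
    moreover have "{q..b - \<eta>} \<subseteq> (u ^^ m2) ` {c..d}"
      using between_iter[OF cd(1,3) m0[OF m2(1)] m2(2)] unfolding p2_def by auto
    ultimately have "R c d (max m1 m2)" unfolding R_def by (meson max.cobounded1 max.cobounded2)
    then show "\<exists>N. R c d N" by blast
  next
    fix c d and N N' :: nat assume "R c d N" and "N \<le> N'"
    then show "R c d N'" unfolding R_def by (meson order_trans)
  next
    fix c d c' d' :: real and N :: nat assume R: "R c d N" and le: "c' \<le> c" "d \<le> d'"
    have "(u ^^ n) ` {c..d} \<subseteq> (u ^^ n) ` {c'..d'}" for n using le by (intro image_mono) auto
    then show "R c' d' N" using R unfolding R_def by (meson order_trans)
  qed
  then show thesis using that unfolding R_def by blast
qed

text \<open>If all of \<open>{p1..p2}\<close> stays \<open>\<epsilon>\<close>-close to the orbit of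
  \<open>z\<close>, take it; otherwise take the segment from \<open>z\<close> to the nearest point
  that departs by \<open>\<epsilon>\<close>. At some time this has length at least
  \<open>\<eta>\<close> or \<open>\<epsilon>\<close>, and \<open>images_spread_uniform\<close>
  preserves a length independent of \<open>n\<close>, which is what allows segments to be
  chained.\<close>

lemma bowen_interval:
  assumes "0 < \<epsilon>" "0 < \<eta>"
  obtains e where "0 < e"
    "\<And>p1 p2 z n. \<lbrakk>a \<le> p1; p2 \<le> b; \<eta> \<le> p2 - p1; z \<in> {p1..p2}\<rbrakk> \<Longrightarrow>
      \<exists>c d. p1 \<le> c \<and> c \<le> d \<and> d \<le> p2 \<and> (\<forall>y\<in>{c..d}. \<forall>i<n. \<bar>(u ^^ i) y - (u ^^ i) z\<bar> \<le> \<epsilon>) \<and>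
        spread ((u ^^ n) ` {c..d}) e"
proof -
  obtain e1 where e1: "0 < e1" "\<And>c d n. a \<le> c \<Longrightarrow> d \<le> b \<Longrightarrow> \<eta> \<le> d - c \<Longrightarrow> spread ((u ^^ n) ` {c..d}) e1"
    using images_spread_uniform[OF assms(2)] by blast
  obtain e2 where e2: "0 < e2" "\<And>c d n. a \<le> c \<Longrightarrow> d \<le> b \<Longrightarrow> \<epsilon> \<le> d - c \<Longrightarrow> spread ((u ^^ n) ` {c..d}) e2"
    using images_spread_uniform[OF assms(1)] by blast
  show thesis
  proof (rule that[of "min e1 e2"])
    show "0 < min e1 e2" using e1 e2 by simp
    fix p1 p2 z n assume p: "a \<le> p1" "p2 \<le> b" "\<eta> \<le> p2 - p1" "z \<in> {p1..p2}"
    define dv where "dv i y = \<bar>(u ^^ i) y - (u ^^ i) z\<bar>" for i y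
    have dv_cont: "continuous_on {p1..p2} (dv i)" for i
      unfolding dv_def[abs_def] by (intro continuous_intros iter_cont_sub p(1,2))
    define B where "B = (\<Union>i<n. {y \<in> {p1..p2}. \<epsilon> \<le> dv i y})"
    have "\<exists>c d. p1 \<le> c \<and> c \<le> d \<and> d \<le> p2 \<and> (\<forall>y\<in>{c..d}. \<forall>i<n. dv i y \<le> \<epsilon>) \<and>
        spread ((u ^^ n) ` {c..d}) (min e1 e2)"
    proof (cases "B = {}")
      case True
      have "dv i y \<le> \<epsilon>" if "y \<in> {p1..p2}" "i < n" for y i
      proof (rule ccontr)
        assume "\<not> ?thesis"
        then have "\<epsilon> \<le> dv i y" "i \<in> {..<n}" using that(2) by auto
        then have "y \<in> B" unfolding B_def using that(1) by blast
        then show False using True by simp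
      qed
      then have "\<forall>y\<in>{p1..p2}. \<forall>i<n. dv i y \<le> \<epsilon>" by blast
      moreover have "spread ((u ^^ n) ` {p1..p2}) (min e1 e2)"
        by (rule spread_mono[OF e1(2)[OF p(1-3)] order_refl min.cobounded1])
      ultimately show ?thesis using p(4) by (intro exI[of _ p1] exI[of _ p2]) auto
    next
      case False
      have "compact {y \<in> {p1..p2}. \<epsilon> \<le> dv i y}" for i
      proof -
        have "closed {y \<in> {p1..p2}. \<epsilon> \<le> dv i y}"
          by (intro continuous_on_closed_Collect_le dv_cont continuous_on_const closed_atLeastAtMost)
        then have "compact ({p1..p2} \<inter> {y \<in> {p1..p2}. \<epsilon> \<le> dv i y})" by (rule compact_Int_closed[OF compact_Icc])
        moreover have "{p1..p2} \<inter> {y \<in> {p1..p2}. \<epsilon> \<le> dv i y} = {y \<in> {p1..p2}. \<epsilon> \<le> dv i y}" by blast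
        ultimately show ?thesis by simp
      qed
      then have "compact B" unfolding B_def by (intro compact_UN) auto
      moreover have "continuous_on B (\<lambda>y. \<bar>y - z\<bar>)" by (intro continuous_intros)
      ultimately obtain y where y: "y \<in> B" "\<And>y'. y' \<in> B \<Longrightarrow> \<bar>y - z\<bar> \<le> \<bar>y' - z\<bar>"
        using continuous_attains_inf[of B "\<lambda>y. \<bar>y - z\<bar>"] False by blast
      \<comment> \<open>Between \<open>z\<close> and the nearest point \<open>y\<close> of \<open>B\<close> orbits stay \<open>\<epsilon>\<close>-close to that of \<open>z\<close>,
        yet the \<open>i\<close>-th image of this segment has length at least \<open>\<epsilon>\<close>, so later images are not short.\<close>
      obtain i where i: "i < n" "\<epsilon> \<le> dv i y" "y \<in> {p1..p2}" using y(1) unfolding B_def by blast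
      define c where "c = min z y"
      define d where "d = max z y"
      have cd: "p1 \<le> c" "c \<le> d" "d \<le> p2" using p(4) i(3) unfolding c_def d_def by auto
      have closer: "\<bar>y' - z\<bar> < \<bar>y - z\<bar>" if "y' \<in> {c..d}" "y' \<noteq> y" for y'
        using that unfolding c_def d_def by (auto simp: min_def max_def split: if_splits)
      \<comment> \<open>A violation could occur only at \<open>y\<close>. But then, starting from 0
        at \<open>z\<close>, the deviation takes the value \<open>\<epsilon>\<close> at some point
        of the segment; this point also belongs to \<open>B\<close>, so it would be \<open>y\<close>
        again.\<close>
      have small: "dv j y' \<le> \<epsilon>" if y': "y' \<in> {c..d}" and j: "j < n" for y' j
      proof (rule ccontr)
        assume not: "\<not> dv j y' \<le> \<epsilon>"
        have "y' \<in> {p1..p2}" using y' cd by auto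
        moreover have "\<epsilon> \<le> dv j y'" "j \<in> {..<n}" using not j by auto
        ultimately have "y' \<in> B" unfolding B_def by blast
        then have y'y: "y' = y" using y(2)[of y'] closer[OF y'] by fastforce
        have "dv j z = 0" unfolding dv_def by simp
        then have "\<exists>y''\<in>{c..d}. dv j y'' = \<epsilon>"
          using continuous_on_subset[OF dv_cont, of "{c..d}" j] cd not y' assms(1)
          by (intro between_image[of c d "dv j" z y']) (auto simp: c_def d_def)
        then obtain y'' where y'': "y'' \<in> {c..d}" "dv j y'' = \<epsilon>" by blast
        then have "\<epsilon> \<le> dv j y''" "j \<in> {..<n}" "y'' \<in> {p1..p2}" using j cd by auto
        then have "y'' \<in> B" unfolding B_def by blast
        then have "y'' = y" using y(2)[of y''] closer[OF y''(1)] by fastforce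
        then show False using not y'' y'y by simp
      qed
      obtain c' d' where im: "(u ^^ i) ` {c..d} = {c'..d'}" "a \<le> c'" "c' \<le> d'" "d' \<le> b"
        using iter_image_interval[of c d i] cd p by auto
      have "z \<in> {c..d}" "y \<in> {c..d}" unfolding c_def d_def by auto
      then have "(u ^^ i) z \<in> {c'..d'}" "(u ^^ i) y \<in> {c'..d'}" unfolding im(1)[symmetric] by (simp_all only: imageI)
      then have "\<epsilon> \<le> d' - c'" using i(2) unfolding dv_def by auto
      then have "spread ((u ^^ (n - i)) ` {c'..d'}) e2" by (rule e2(2)[OF im(2,4)])
      then have "spread ((u ^^ n) ` {c..d}) e2"
        unfolding im(1)[symmetric] funpow_image_add[symmetric] using i(1) by simp
      then have "spread ((u ^^ n) ` {c..d}) (min e1 e2)" by (rule spread_mono[OF _ order_refl min.cobounded2])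
      then show ?thesis using small cd by blast
    qed
    then show "\<exists>c d. p1 \<le> c \<and> c \<le> d \<and> d \<le> p2 \<and> (\<forall>y\<in>{c..d}. \<forall>i<n. \<bar>(u ^^ i) y - (u ^^ i) z\<bar> \<le> \<epsilon>) \<and>
        spread ((u ^^ n) ` {c..d}) (min e1 e2)"
      unfolding dv_def .
  qed
qed

end

section \<open>Shadowing of prescribed orbit segments\<close>

lemma uniform_modulus:
  fixes \<Phi> :: "nat \<Rightarrow> real \<Rightarrow> real"
  assumes "\<And>j. j < r \<Longrightarrow> continuous_on {a..b} (\<Phi> j)" "0 < \<kappa>"
  obtains e where "0 < e"
    "\<And>j x y. \<lbrakk>j < r; x \<in> {a..b}; y \<in> {a..b}; \<bar>x - y\<bar> \<le> e\<rbrakk> \<Longrightarrow> \<bar>\<Phi> j x - \<Phi> j y\<bar> \<le> \<kappa>"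
proof -
  have "\<exists>e>0. \<forall>j<r. \<forall>x\<in>{a..b}. \<forall>y\<in>{a..b}. \<bar>x - y\<bar> \<le> e \<longrightarrow> \<bar>\<Phi> j x - \<Phi> j y\<bar> \<le> \<kappa>"
    using assms(1)
  proof (induction r)
    case 0
    show ?case by (intro exI[of _ 1]) simp
  next
    case (Suc r)
    then obtain e1 where e1: "e1 > 0"
      "\<forall>j<r. \<forall>x\<in>{a..b}. \<forall>y\<in>{a..b}. \<bar>x - y\<bar> \<le> e1 \<longrightarrow> \<bar>\<Phi> j x - \<Phi> j y\<bar> \<le> \<kappa>"
      by (meson less_SucI)
    have "uniformly_continuous_on {a..b} (\<Phi> r)"
      using Suc.prems by (intro compact_uniformly_continuous compact_Icc) simp
    then obtain e2 where e2: "e2 > 0"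
      "\<forall>x\<in>{a..b}. \<forall>y\<in>{a..b}. \<bar>y - x\<bar> < e2 \<longrightarrow> \<bar>\<Phi> r y - \<Phi> r x\<bar> < \<kappa>"
      using assms(2) unfolding uniformly_continuous_on_def dist_real_def by meson
    show ?case
    proof (intro exI conjI allI impI ballI)
      show "min e1 (e2 / 2) > 0" using e1 e2 by simp
      fix j x y assume j: "j < Suc r" and xy: "x \<in> {a..b}" "y \<in> {a..b}" "\<bar>x - y\<bar> \<le> min e1 (e2 / 2)"
      show "\<bar>\<Phi> j x - \<Phi> j y\<bar> \<le> \<kappa>"
      proof (cases "j = r")
        case True
        have "\<bar>x - y\<bar> < e2" using xy(3) e2(1) by linarith
        then show ?thesis unfolding True using e2(2) xy(1,2) by (meson less_imp_le)
      next
        case False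
        then have "j < r" using j by simp
        then show ?thesis using e1(2) xy by simp
      qed
    qed
  qed
  then show thesis using that by blast
qed

text \<open>Both sums are parts of the sum over the first \<open>m + n\<close> iterates, and each
  omits \<open>m\<close> terms of absolute value at most 1.\<close>

lemma birkhoff_sum_shift:
  assumes "\<And>t. \<bar>\<Phi> ((u ^^ t) w)\<bar> \<le> 1"
  shows "\<bar>birkhoff_sum u \<Phi> n w - birkhoff_sum u \<Phi> n ((u ^^ m) w)\<bar> \<le> 2 * real m"
proof -
  have "birkhoff_sum u \<Phi> (m + n) w = birkhoff_sum u \<Phi> m w + birkhoff_sum u \<Phi> n ((u ^^ m) w)"
    by (rule birkhoff_sum_add)
  moreover have "birkhoff_sum u \<Phi> (n + m) w = birkhoff_sum u \<Phi> n w + birkhoff_sum u \<Phi> m ((u ^^ n) w)"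
    by (rule birkhoff_sum_add)
  moreover have "\<bar>birkhoff_sum u \<Phi> m w\<bar> \<le> real m * 1"
    by (rule birkhoff_sum_bound) (rule assms)
  moreover have "\<bar>birkhoff_sum u \<Phi> m ((u ^^ n) w)\<bar> \<le> real m * 1"
  proof (rule birkhoff_sum_bound)
    fix t
    have "(u ^^ t) ((u ^^ n) w) = (u ^^ (t + n)) w" by (simp add: funpow_add)
    then show "\<bar>\<Phi> ((u ^^ t) ((u ^^ n) w))\<bar> \<le> 1" using assms[of "t + n"] by simp
  qed
  ultimately show ?thesis by (simp add: add.commute)
qed

context covering_map
begin

text \<open>The orbit of \<open>y\<close> up to time \<open>T\<close> follows the orbit segments of length \<open>n\<close> of the points \<open>zs\<close>,
  with gaps of length at most \<open>M\<close>; \<open>\<kappa>\<close> is the oscillation of \<open>\<Phi>\<close> at scale \<open>\<epsilon>\<close>.\<close>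

definition follows :: "real \<Rightarrow> nat \<Rightarrow> nat \<Rightarrow> real list \<Rightarrow> real \<Rightarrow> nat \<Rightarrow> bool" where
  "follows \<epsilon> M n zs y T \<longleftrightarrow> length zs * n \<le> T \<and> T \<le> length zs * (n + M) \<and>
    (\<forall>\<Phi> (\<kappa>::real). (\<forall>x\<in>{a..b}. \<bar>\<Phi> x\<bar> \<le> 1) \<and>
        (\<forall>x\<in>{a..b}. \<forall>y\<in>{a..b}. \<bar>x - y\<bar> \<le> \<epsilon> \<longrightarrow> \<bar>\<Phi> x - \<Phi> y\<bar> \<le> \<kappa>) \<longrightarrow>
      \<bar>birkhoff_sum u \<Phi> T y - (\<Sum>z\<leftarrow>zs. birkhoff_sum u \<Phi> n z)\<bar> \<le> length zs * (M + n * \<kappa>))"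

text \<open>Induction on the list: within \<open>M\<close> steps the current interval covers the
  side of \<open>q\<close> on which the next point \<open>z\<close> lies; there
  \<open>bowen_interval\<close> selects a subinterval following \<open>z\<close>, and its
  \<open>n\<close>-th image is long enough to serve as the interval for the remaining points. The
  shadowing point is found by pulling back.\<close>

lemma shadowing_chain:
  assumes \<epsilon>: "0 < \<epsilon>" and \<eta>: "0 < \<eta>" "a + \<eta> < q" "q < b - \<eta>" and \<delta>: "0 < \<delta>"
  obtains M where
    "\<And>zs c d n. \<lbrakk>set zs \<subseteq> {a + \<eta>..b - \<eta>}; a \<le> c; d \<le> b; \<delta> \<le> d - c\<rbrakk> \<Longrightarrow>
      \<exists>y\<in>{c..d}. \<exists>T. follows \<epsilon> M n zs y T"
proof -
  define l where "l = min (q - (a + \<eta>)) (b - \<eta> - q)"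
  have l: "0 < l" using \<eta> unfolding l_def by simp
  obtain e where e: "0 < e"
    "\<And>p1 p2 z n. \<lbrakk>a \<le> p1; p2 \<le> b; l \<le> p2 - p1; z \<in> {p1..p2}\<rbrakk> \<Longrightarrow>
      \<exists>c d. p1 \<le> c \<and> c \<le> d \<and> d \<le> p2 \<and> (\<forall>y\<in>{c..d}. \<forall>i<n. \<bar>(u ^^ i) y - (u ^^ i) z\<bar> \<le> \<epsilon>) \<and>
        spread ((u ^^ n) ` {c..d}) e"
    using bowen_interval[OF \<epsilon> l] by blast
  \<comment> \<open>One \<open>M\<close> has to serve both the given interval, of length at least
    \<open>\<delta>\<close>, and the later ones, of length at least \<open>e\<close>.\<close>
  define \<delta>' where "\<delta>' = min \<delta> e"
  have \<delta>': "0 < \<delta>'" "\<delta>' \<le> \<delta>" "\<delta>' \<le> e" using \<delta> e(1) unfolding \<delta>'_def by auto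
  obtain M where M: "\<And>c d. a \<le> c \<Longrightarrow> d \<le> b \<Longrightarrow> \<delta>' \<le> d - c \<Longrightarrow>
    (\<exists>m\<le>M. {a + \<eta>..q} \<subseteq> (u ^^ m) ` {c..d}) \<and> (\<exists>m\<le>M. {q..b - \<eta>} \<subseteq> (u ^^ m) ` {c..d})"
    using cover_uniform[OF \<delta>'(1) \<eta>(1)] by blast
  define good :: "(real \<Rightarrow> real) \<Rightarrow> real \<Rightarrow> bool" where "good \<Phi> \<kappa> \<longleftrightarrow> (\<forall>x\<in>{a..b}. \<bar>\<Phi> x\<bar> \<le> 1) \<and>
          (\<forall>x\<in>{a..b}. \<forall>y\<in>{a..b}. \<bar>x - y\<bar> \<le> \<epsilon> \<longrightarrow> \<bar>\<Phi> x - \<Phi> y\<bar> \<le> \<kappa>)" for \<Phi> \<kappa>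
  have follows_good: "follows \<epsilon> M n zs y T \<longleftrightarrow> length zs * n \<le> T \<and> T \<le> length zs * (n + M) \<and>
    (\<forall>\<Phi> (\<kappa>::real). good \<Phi> \<kappa> \<longrightarrow> \<bar>birkhoff_sum u \<Phi> T y - (\<Sum>z\<leftarrow>zs. birkhoff_sum u \<Phi> n z)\<bar> \<le> length zs * (M + n * \<kappa>))"
    for n zs y T unfolding follows_def good_def by simp
  have main: "\<exists>y\<in>{c..d}. \<exists>T. follows \<epsilon> M n zs y T"
    if "set zs \<subseteq> {a + \<eta>..b - \<eta>}" "a \<le> c" "d \<le> b" "\<delta>' \<le> d - c" for zs c d n
    using that
  proof (induction zs arbitrary: c d)
    case Nil
    show ?case
    proof (intro bexI[of _ c] exI[of _ 0])
      show "c \<in> {c..d}" using Nil(4) \<delta>'(1) by auto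
    qed (simp add: follows_def birkhoff_sum_def)
  next
    case (Cons z zs)
    note cd = Cons.prems(2,3,4)
    obtain m p1 p2 where m: "m \<le> M" "{p1..p2} \<subseteq> (u ^^ m) ` {c..d}"
      and p: "a \<le> p1" "p2 \<le> b" "l \<le> p2 - p1" "z \<in> {p1..p2}"
    proof (cases "z \<le> q")
      case True
      obtain m where "m \<le> M" "{a + \<eta>..q} \<subseteq> (u ^^ m) ` {c..d}" using M[OF cd] by blast
      then show thesis using True Cons.prems(1) \<eta> q
        by (intro that[of m "a + \<eta>" q]) (auto simp: l_def)
    next
      case False
      obtain m where "m \<le> M" "{q..b - \<eta>} \<subseteq> (u ^^ m) ` {c..d}" using M[OF cd] by blast
      then show thesis using False Cons.prems(1) \<eta> q
        by (intro that[of m q "b - \<eta>"]) (auto simp: l_def)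
    qed
    obtain c1 d1 where cd1: "p1 \<le> c1" "c1 \<le> d1" "d1 \<le> p2"
      and near: "\<forall>y\<in>{c1..d1}. \<forall>i<n. \<bar>(u ^^ i) y - (u ^^ i) z\<bar> \<le> \<epsilon>"
      and spr: "spread ((u ^^ n) ` {c1..d1}) e"
      using e(2)[OF p] by blast
    obtain c2 d2 where im: "(u ^^ n) ` {c1..d1} = {c2..d2}" "a \<le> c2" "c2 \<le> d2" "d2 \<le> b"
      using iter_image_interval[of c1 d1 n] cd1 p(1,2) by auto
    have "\<delta>' \<le> d2 - c2" using spr \<delta>'(3) unfolding im(1) spread_def by auto
    then obtain y2 T2 where y2: "y2 \<in> {c2..d2}"
      and T2: "length zs * n \<le> T2" "T2 \<le> length zs * (n + M)"
      and sh2: "\<forall>\<Phi> \<kappa>. good \<Phi> \<kappa> \<longrightarrow>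
          \<bar>birkhoff_sum u \<Phi> T2 y2 - (\<Sum>z\<leftarrow>zs. birkhoff_sum u \<Phi> n z)\<bar> \<le> real (length zs) * (real M + real n * \<kappa>)"
      using Cons.IH[OF _ im(2,4)] Cons.prems(1) unfolding follows_good by auto
    obtain y1 where y1: "y1 \<in> {c1..d1}" "y2 = (u ^^ n) y1" using y2 unfolding im(1)[symmetric] by blast
    have "y1 \<in> {p1..p2}" using y1(1) cd1 by auto
    then obtain y where y: "y \<in> {c..d}" "y1 = (u ^^ m) y" using m(2) by blast
    have z01: "z \<in> {a..b}" and y101: "y1 \<in> {a..b}" and y01: "y \<in> {a..b}"
      using p cd1 y1(1) y(1) cd by auto
    show ?case
      unfolding follows_good
    proof (intro bexI[OF _ y(1)] exI[of _ "m + (n + T2)"] conjI allI impI)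
      show "length (z # zs) * n \<le> m + (n + T2)" using T2(1) by simp
      show "m + (n + T2) \<le> length (z # zs) * (n + M)" using T2(2) m(1) by simp
      fix \<Phi> \<kappa> assume g: "good \<Phi> \<kappa>"
      have "birkhoff_sum u \<Phi> (m + (n + T2)) y =
          birkhoff_sum u \<Phi> m y + birkhoff_sum u \<Phi> n y1 + birkhoff_sum u \<Phi> T2 y2"
        unfolding birkhoff_sum_add y(2)[symmetric] y1(2)[symmetric] by simp
      moreover have "\<bar>birkhoff_sum u \<Phi> m y\<bar> \<le> real m * 1"
        by (rule birkhoff_sum_bound) (use g iter_mem[OF y01] good_def in blast)
      moreover have "\<bar>birkhoff_sum u \<Phi> n y1 - birkhoff_sum u \<Phi> n z\<bar> \<le> real n * \<kappa>"
      proof (rule birkhoff_sum_diff)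
        fix t assume "t < n"
        then have "\<bar>(u ^^ t) y1 - (u ^^ t) z\<bar> \<le> \<epsilon>" using near y1(1) by blast
        then show "\<bar>\<Phi> ((u ^^ t) y1) - \<Phi> ((u ^^ t) z)\<bar> \<le> \<kappa>"
          using g iter_mem[OF y101, of t] iter_mem[OF z01, of t] unfolding good_def by blast
      qed
      moreover have "\<bar>birkhoff_sum u \<Phi> T2 y2 - (\<Sum>z\<leftarrow>zs. birkhoff_sum u \<Phi> n z)\<bar>
          \<le> real (length zs) * (real M + real n * \<kappa>)"
        using sh2 g by blast
      moreover have "real m \<le> real M" using m(1) by simp
      moreover have "real (length (z # zs)) * (real M + real n * \<kappa>) =
          real (length zs) * (real M + real n * \<kappa>) + (real M + real n * \<kappa>)"
        by (simp add: algebra_simps)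
      ultimately show "\<bar>birkhoff_sum u \<Phi> (m + (n + T2)) y - (\<Sum>z\<leftarrow>z # zs. birkhoff_sum u \<Phi> n z)\<bar>
          \<le> real (length (z # zs)) * (real M + real n * \<kappa>)"
        by simp
    qed
  qed
  show thesis
    by (rule that[of M], rule main) (use \<delta>'(2) in auto)
qed

lemma shadowing_average:
  fixes \<Phi> :: "nat \<Rightarrow> real \<Rightarrow> real"
  assumes \<Phi>: "\<And>j. j < r \<Longrightarrow> continuous_on {a..b} (\<Phi> j)" "\<And>j x. j < r \<Longrightarrow> x \<in> {a..b} \<Longrightarrow> \<bar>\<Phi> j x\<bar> \<le> 1"
    and \<epsilon>: "0 < \<epsilon>" and \<eta>: "0 < \<eta>" "a + \<eta> < q" "q < b - \<eta>"
    and cd: "a \<le> c" "c < d" "d \<le> b" and Q: "0 < Q"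
  shows "\<exists>n0. \<forall>n\<ge>n0. \<forall>zs. length zs = Q \<longrightarrow> set zs \<subseteq> {a + \<eta>..b - \<eta>} \<longrightarrow>
    (\<exists>y\<in>{c..d}. \<exists>T\<ge>n. \<forall>j<r. \<bar>birkhoff_sum u (\<Phi> j) T y / T - (\<Sum>z\<leftarrow>zs. birkhoff_sum u (\<Phi> j) n z) / (real Q * real n)\<bar> \<le> \<epsilon>)"
proof -
  obtain e where e: "0 < e"
    "\<And>j x y. \<lbrakk>j < r; x \<in> {a..b}; y \<in> {a..b}; \<bar>x - y\<bar> \<le> e\<rbrakk> \<Longrightarrow> \<bar>\<Phi> j x - \<Phi> j y\<bar> \<le> \<epsilon> / 2"
    using uniform_modulus[where \<Phi> = \<Phi> and r = r, OF \<Phi>(1) half_gt_zero[OF \<epsilon>]] by metis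
  have dc: "0 < d - c" using cd by simp
  obtain M where M: "\<And>zs c' d' n. \<lbrakk>set zs \<subseteq> {a + \<eta>..b - \<eta>}; a \<le> c'; d' \<le> b; d - c \<le> d' - c'\<rbrakk> \<Longrightarrow>
      \<exists>y\<in>{c'..d'}. \<exists>T. follows e M n zs y T"
    using shadowing_chain[OF e(1) \<eta> dc] by blast
  \<comment> \<open>This makes \<open>2 * M / n\<close> at most \<open>\<epsilon> / 2\<close>: one
    \<open>M / n\<close> is the contribution of the gaps to the sum, the other comes from
    \<open>T\<close> exceeding \<open>Q * n\<close>. The remaining \<open>\<epsilon> / 2\<close> is
    the oscillation of the functions at scale \<open>e\<close>.\<close>
  obtain n0 :: nat where n0: "4 * real M / \<epsilon> + 1 < real n0" using reals_Archimedean2 by blast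
  show ?thesis
  proof (intro exI[of _ n0] allI impI)
    fix n zs assume n: "n0 \<le> n" and zs: "length zs = Q" "set zs \<subseteq> {a + \<eta>..b - \<eta>}"
    obtain y T where y: "y \<in> {c..d}" and f: "follows e M n zs y T"
      using M[OF zs(2) cd(1,3) order_refl] by blast
    have T: "Q * n \<le> T" "T \<le> Q * (n + M)" using f unfolding follows_def zs(1) by auto
    have "4 * real M / \<epsilon> + 1 < real n" using n0 n by (meson less_le_trans of_nat_le_iff)
    moreover have "0 \<le> 4 * real M / \<epsilon>" using \<epsilon> by simp
    ultimately have n_pos: "0 < real n" and nM: "4 * real M / \<epsilon> \<le> real n" by linarith+
    have Mn: "2 * (real M / real n) \<le> \<epsilon> / 2"
      using nM \<epsilon> n_pos by (simp add: field_simps)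
    have N: "0 < real Q * real n" using Q n_pos by simp
    have T1: "real Q * real n \<le> real T" using T(1) by (metis of_nat_le_iff of_nat_mult)
    have T2: "real T \<le> real Q * real n + real Q * real M"
      using T(2) by (metis distrib_left of_nat_add of_nat_le_iff of_nat_mult)
    have T_pos: "0 < real T" using T1 N by linarith
    have "n \<le> Q * n" using Q by simp
    then have "n \<le> T" using T(1) by linarith
    moreover have "\<bar>birkhoff_sum u (\<Phi> j) T y / T - (\<Sum>z\<leftarrow>zs. birkhoff_sum u (\<Phi> j) n z) / (real Q * real n)\<bar> \<le> \<epsilon>"
      if j: "j < r" for j
    proof -
      define S where "S = birkhoff_sum u (\<Phi> j) T y"
      define S' where "S' = (\<Sum>z\<leftarrow>zs. birkhoff_sum u (\<Phi> j) n z)"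
      have 1: "\<bar>S - S'\<bar> \<le> real Q * (real M + real n * (\<epsilon> / 2))"
        unfolding S_def S'_def using f \<Phi>(2)[OF j] e(2)[OF j] unfolding follows_def zs(1) by blast
      have "\<bar>\<Sum>z\<leftarrow>zs'. birkhoff_sum u (\<Phi> j) n z\<bar> \<le> real (length zs') * real n" if "set zs' \<subseteq> {a + \<eta>..b - \<eta>}" for zs'
        using that
      proof (induction zs')
        case (Cons z zs')
        have "\<bar>birkhoff_sum u (\<Phi> j) n z\<bar> \<le> real n * 1"
          by (rule birkhoff_sum_bound) (use Cons.prems \<eta> \<Phi>(2)[OF j] iter_mem in auto)
        then show ?case using Cons by (simp add: algebra_simps)
      qed simp
      from this[OF zs(2)] have 2: "\<bar>S'\<bar> \<le> real Q * real n" unfolding S'_def zs(1) .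
      have "S / t - S' / D = (S - S') / t + S' * (D - t) / (t * D)" if "0 < t" "0 < D" for t D :: real
        using that by (simp add: field_simps)
      from this[OF T_pos N]
      have "S / T - S' / (real Q * real n) = (S - S') / T + S' * (real Q * real n - T) / (T * (real Q * real n))" .
      also have "\<bar>\<dots>\<bar> \<le> \<bar>S - S'\<bar> / T + \<bar>S'\<bar> * \<bar>real Q * real n - T\<bar> / (T * (real Q * real n))"
        using T_pos N by (intro abs_triangle_ineq[THEN order_trans]) (simp add: abs_mult)
      also have "\<bar>S - S'\<bar> / T \<le> (real Q * (real M + real n * (\<epsilon> / 2))) / (real Q * real n)"
        using 1 T1 N by (intro frac_le) auto
      also have "\<dots> = real M / real n + \<epsilon> / 2" using Q n_pos by (simp add: field_simps)
      also have "\<bar>S'\<bar> * \<bar>real Q * real n - T\<bar> / (T * (real Q * real n)) \<le>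
          (real Q * real n) * (real Q * real M) / ((real Q * real n) * (real Q * real n))"
        using 2 T1 T2 Q n_pos by (intro frac_le mult_mono mult_pos_pos) auto
      also have "\<dots> = real M / real n" using Q n_pos by (simp add: field_simps)
      finally have "\<bar>S / T - S' / (real Q * real n)\<bar> \<le> real M / real n + \<epsilon> / 2 + real M / real n" by simp
      then show ?thesis using Mn unfolding S_def S'_def by linarith
    qed
    ultimately show "\<exists>y\<in>{c..d}. \<exists>T\<ge>n. \<forall>j<r. \<bar>birkhoff_sum u (\<Phi> j) T y / T - (\<Sum>z\<leftarrow>zs. birkhoff_sum u (\<Phi> j) n z) / (real Q * real n)\<bar> \<le> \<epsilon>"
      using y by blast
  qed
qed

section \<open>Orbits through the endpoints\<close>

lemma surj: "u ` {a..b} = {a..b}"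
proof (rule image_full)
  fix p assume p: "a < p" "p < b"
  obtain m where m: "m \<ge> 1" "p \<in> (u ^^ m) ` {a..b}"
    using cover[OF order_refl _ order_refl p, of 1] q by auto
  then obtain y where y: "y \<in> {a..b}" "p = (u ^^ m) y" by blast
  have "(u ^^ m) y = u ((u ^^ (m - 1)) y)"
    using m(1) by (metis Suc_diff_1 Suc_le_eq One_nat_def comp_apply funpow.simps(2))
  then show "p \<in> closure (u ` {a..b})"
    using y iter_mem[OF y(1)] closure_subset[of "u ` {a..b}"] by auto
qed (use q in simp)

text \<open>Measures may charge the endpoints, while shadowed points must keep a distance
  \<open>\<eta>\<close> from them that does not depend on \<open>n\<close>. If \<open>c\<close> is
  the \<open>m\<close>-th image of an interior point, that point serves, with an error of at most
  \<open>2 * m\<close>.\<close>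

lemma interior_companion:
  fixes \<Phi> :: "nat \<Rightarrow> real \<Rightarrow> real" and \<epsilon> :: real
  assumes \<Phi>: "\<And>j. j < r \<Longrightarrow> continuous_on {a..b} (\<Phi> j)" "\<And>j x. j < r \<Longrightarrow> x \<in> {a..b} \<Longrightarrow> \<bar>\<Phi> j x\<bar> \<le> 1"
    and \<epsilon>: "0 < \<epsilon>" and c: "c \<in> {a, b}"
  shows "\<exists>\<eta>>0. \<exists>n0. \<forall>n\<ge>n0. \<exists>w\<in>{a + \<eta>..b - \<eta>}. \<forall>j<r.
    \<bar>birkhoff_sum u (\<Phi> j) n w - birkhoff_sum u (\<Phi> j) n c\<bar> \<le> \<epsilon> * n"
proof -
  have ab: "a < b" using q by simp
  have c01: "c \<in> {a..b}" using c ab by auto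
  have bnd: "\<And>t. \<bar>\<Phi> j ((u ^^ t) w)\<bar> \<le> 1" if "j < r" "w \<in> {a..b}" for j w
    using \<Phi>(2)[OF that(1) iter_mem[OF that(2)]] by blast
  define acc where "acc y \<longleftrightarrow> (\<exists>m w. a < w \<and> w < b \<and> (u ^^ m) w = y)" for y
  show ?thesis
  proof (cases "acc c")
    case True
    then obtain m w where w: "a < w" "w < b" "(u ^^ m) w = c" unfolding acc_def by blast
    obtain n0 :: nat where n0: "2 * real m / \<epsilon> < real n0" using reals_Archimedean2 by blast
    show ?thesis
    proof (intro exI[of _ "min (w - a) (b - w)"] conjI exI[of _ n0] allI impI bexI[of _ w])
      show "0 < min (w - a) (b - w)" using w by simp
      show "w \<in> {a + min (w - a) (b - w)..b - min (w - a) (b - w)}" by auto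
      fix n j assume n: "n0 \<le> n" and j: "j < r"
      have "\<bar>birkhoff_sum u (\<Phi> j) n w - birkhoff_sum u (\<Phi> j) n ((u ^^ m) w)\<bar> \<le> 2 * real m"
        by (rule birkhoff_sum_shift) (rule bnd[OF j], use w in simp)
      moreover have "2 * real m \<le> \<epsilon> * n"
      proof -
        have "2 * real m / \<epsilon> \<le> real n" using n0 n by (meson less_imp_le less_le_trans of_nat_le_iff)
        then show ?thesis using \<epsilon> by (simp add: field_simps)
      qed
      ultimately show "\<bar>birkhoff_sum u (\<Phi> j) n w - birkhoff_sum u (\<Phi> j) n c\<bar> \<le> \<epsilon> * n"
        unfolding w(3) by linarith
    qed
  next
    case False
    \<comment> \<open>Now \<open>c\<close> lies in a totally invariant cycle \<open>P\<close> of endpoints.  An orbit that approaches \<open>P\<close> enters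
      its \<open>\<theta>\<close>-neighbourhood from the compact complement \<open>N\<close>, hence at a distance at least \<open>\<eta>\<close> from \<open>P\<close>,
      where \<open>\<eta>\<close> does not depend on how long the orbit then stays near \<open>P\<close>.\<close>
    have acc_int: "acc y" if "a < y" "y < b" for y
      unfolding acc_def using that by (intro exI[of _ 0] exI[of _ y]) simp
    have acc_step: "acc (u y)" if "acc y" for y
    proof -
      obtain m w where "a < w" "w < b" "(u ^^ m) w = y" using \<open>acc y\<close> unfolding acc_def by blast
      then show ?thesis unfolding acc_def by (intro exI[of _ "Suc m"] exI[of _ w]) simp
    qed
    have pre: "y \<in> {a, b} \<and> \<not> acc y" if "y \<in> {a..b}" "\<not> acc (u y)" for y
    proof -
      have "\<not> acc y" using acc_step that(2) by blast
      moreover have "\<not> (a < y \<and> y < b)" using acc_int calculation by blast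
      moreover have "a \<le> y" "y \<le> b" using that(1) by simp_all
      ultimately have "y = a \<or> y = b" by linarith
      with \<open>\<not> acc y\<close> show ?thesis by simp
    qed
    have ex_pre: "\<exists>y\<in>{a, b}. u y = z \<and> \<not> acc y" if "z \<in> {a..b}" "\<not> acc z" for z
    proof -
      have "z \<in> u ` {a..b}" unfolding surj by (rule that(1))
      then obtain y where "y \<in> {a..b}" "u y = z" by blast
      then show ?thesis using pre[of y] that(2) by blast
    qed
    obtain c1 where c1: "c1 \<in> {a, b}" "u c1 = c" "\<not> acc c1" using ex_pre[OF c01 False] by blast
    \<comment> \<open>Either \<open>{c}\<close> or \<open>{a, b}\<close>. If \<open>c1 = c\<close>,
      a further preimage of \<open>c\<close> would be the other endpoint, which would itself have no
      preimage, contrary to surjectivity; if \<open>c1\<close> differs from \<open>c\<close>, the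
      endpoints are exchanged.\<close>
    obtain P where P: "c \<in> P" "P \<subseteq> {a, b}" "u ` P \<subseteq> P" "\<And>y. y \<in> {a..b} \<Longrightarrow> u y \<in> P \<Longrightarrow> y \<in> P"
      "\<And>p. p \<in> P \<Longrightarrow> p = c \<or> p = u c"
    proof (cases "c1 = c")
      case True
      show thesis
      proof (rule that[of "{c}"])
        fix y assume y: "y \<in> {a..b}" "u y \<in> {c}"
        show "y \<in> {c}"
        proof (rule ccontr)
          assume "y \<notin> {c}"
          have y': "y \<in> {a, b}" "\<not> acc y" using pre[OF y(1)] y(2) False by auto
          obtain y2 where y2: "y2 \<in> {a, b}" "u y2 = y" using ex_pre[OF y(1) y'(2)] by blast
          then have "y2 = c \<or> y2 = y" using y'(1) c \<open>y \<notin> {c}\<close> by auto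
          then show False using y2(2) y(2) \<open>y \<notin> {c}\<close> c1(2) True by auto
        qed
      qed (use c c1(2) True in auto)
    next
      case neq: False
      have c101: "c1 \<in> {a..b}" using c1(1) ab by auto
      obtain c2 where c2: "c2 \<in> {a, b}" "u c2 = c1" using ex_pre[OF c101 c1(3)] by blast
      have "c2 = c" using c2 c1 c neq by auto
      then have uc: "u c = c1" using c2(2) by simp
      have Pab: "{c, c1} = {a, b}" using c c1(1) neq by auto
      show thesis
      proof (rule that[of "{c, c1}"])
        fix y assume y: "y \<in> {a..b}" "u y \<in> {c, c1}"
        have "u y = c \<or> u y = c1" using y(2) by simp
        then have "\<not> acc (u y)" using False c1(3) by metis
        then show "y \<in> {c, c1}" unfolding Pab using pre[OF y(1)] by simp
      next
        show "{c, c1} \<subseteq> {a, b}" unfolding Pab ..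
      qed (simp_all add: uc c1(2))
    qed
    have P01: "P \<subseteq> {a..b}" using P(2) ab by auto
    have P_iter: "(u ^^ t) p \<in> P" if "p \<in> P" for t p
      using funpow_image_subset[OF P(3), of t] that by blast
    obtain e1 where e1: "0 < e1" "\<And>j x y. \<lbrakk>j < r; x \<in> {a..b}; y \<in> {a..b}; \<bar>x - y\<bar> \<le> e1\<rbrakk> \<Longrightarrow> \<bar>\<Phi> j x - \<Phi> j y\<bar> \<le> \<epsilon> / 2"
      using uniform_modulus[where \<Phi> = \<Phi> and r = r, OF \<Phi>(1) half_gt_zero[OF \<epsilon>]] by metis
    define l where "l = b - a"
    have l: "0 < l" using ab unfolding l_def by simp
    obtain e2 where e2: "0 < e2" "\<And>x y. \<lbrakk>x \<in> {a..b}; y \<in> {a..b}; \<bar>x - y\<bar> \<le> e2\<rbrakk> \<Longrightarrow> \<bar>u x - u y\<bar> \<le> l / 2"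
      using uniform_modulus[where \<Phi> = "\<lambda>_. u" and r = 1, OF cont half_gt_zero[OF l]] by (metis zero_less_one)
    \<comment> \<open>The bound \<open>e1\<close> controls the functions along the orbit. With
      \<open>e2\<close> and \<open>l / 4\<close>, a point near an element of \<open>P\<close> whose
      image is again near \<open>P\<close> has that image near the correct endpoint: a wrong one
      would be at distance \<open>l\<close>.\<close>
    define \<theta> where "\<theta> = min (min e1 e2) (l / 4)"
    have \<theta>: "0 < \<theta>" "\<theta> \<le> e1" "\<theta> \<le> e2" "\<theta> \<le> l / 4" using e1(1) e2(1) l unfolding \<theta>_def by auto
    define N where "N = {y \<in> {a..b}. \<forall>p\<in>P. \<theta> \<le> \<bar>y - p\<bar>}"
    have N01: "N \<subseteq> {a..b}" unfolding N_def by blast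
    have comN: "compact N"
    proof -
      have "N = {a..b} \<inter> (\<Inter>p\<in>P. {y. \<theta> \<le> \<bar>y - p\<bar>})" unfolding N_def by blast
      moreover have "closed (\<Inter>p\<in>P. {y. \<theta> \<le> \<bar>y - p\<bar>})"
        by (intro closed_INT ballI closed_Collect_le continuous_intros)
      ultimately show ?thesis using compact_Int_closed[OF compact_Icc] by metis
    qed
    have mid: "{a + l / 4..b - l / 4} \<subseteq> N"
    proof
      fix x assume x: "x \<in> {a + l / 4..b - l / 4}"
      have "\<theta> \<le> \<bar>x - p\<bar>" if "p \<in> P" for p
      proof -
        have "p = a \<or> p = b" using P(2) that by blast
        then show ?thesis using x \<theta>(4) by auto
      qed
      then show "x \<in> N" unfolding N_def using x l by auto
    qed
    have dist_P: "\<exists>e>0. p \<in> P \<longrightarrow> (\<forall>y\<in>N. e \<le> \<bar>u y - p\<bar>)" for p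
    proof (cases "p \<in> P")
      case True
      have "(a + b) / 2 \<in> {a + l / 4..b - l / 4}" using l unfolding l_def by (simp add: field_simps)
      then have "N \<noteq> {}" using mid by blast
      moreover have "continuous_on N (\<lambda>y. \<bar>u y - p\<bar>)"
        by (intro continuous_intros continuous_on_subset[OF cont N01])
      ultimately obtain y where y: "y \<in> N" "\<forall>y'\<in>N. \<bar>u y - p\<bar> \<le> \<bar>u y' - p\<bar>"
        using continuous_attains_inf[OF comN] by blast
      have "u y \<noteq> p"
      proof
        assume "u y = p"
        then have "y \<in> P" using P(4) y(1) N01 True by blast
        then show False using y(1) \<theta>(1) unfolding N_def by force
      qed
      then show ?thesis using y(2) by (intro exI[of _ "\<bar>u y - p\<bar>"]) auto
    qed (auto intro: exI[of _ 1])
    obtain ea where ea: "0 < ea" "a \<in> P \<Longrightarrow> \<forall>y\<in>N. ea \<le> \<bar>u y - a\<bar>" using dist_P[of a] by blast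
    obtain eb where eb: "0 < eb" "b \<in> P \<Longrightarrow> \<forall>y\<in>N. eb \<le> \<bar>u y - b\<bar>" using dist_P[of b] by blast
    define \<eta> where "\<eta> = min (min ea eb) (l / 4)"
    have \<eta>: "0 < \<eta>" "\<eta> \<le> ea" "\<eta> \<le> eb" "\<eta> \<le> l / 4" using ea(1) eb(1) l unfolding \<eta>_def by auto
    have near_P: "\<exists>p\<in>P. \<bar>y - p\<bar> < \<theta>" if "y \<in> {a..b}" "y \<notin> N" for y
      using that unfolding N_def by (auto simp: not_le)
    obtain n0 :: nat where n0: "4 / \<epsilon> < real n0" using reals_Archimedean2 by blast
    show ?thesis
    proof (intro exI[of _ \<eta>] conjI exI[of _ n0] allI impI)
      show "0 < \<eta>" by (rule \<eta>(1))
      fix n assume n: "n0 \<le> n"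
      \<comment> \<open>Unlike \<open>\<eta>\<close>, this depends on \<open>n\<close>: a point
        within \<open>\<rho>\<close> of \<open>c\<close> follows the orbit of \<open>c\<close> for
        \<open>n\<close> steps.\<close>
      obtain \<rho> where \<rho>: "0 < \<rho>" "\<And>j x y. \<lbrakk>j < Suc n; x \<in> {a..b}; y \<in> {a..b}; \<bar>x - y\<bar> \<le> \<rho>\<rbrakk> \<Longrightarrow>
          \<bar>(u ^^ j) x - (u ^^ j) y\<bar> \<le> \<theta> / 2"
        using uniform_modulus[where \<Phi> = "\<lambda>j. u ^^ j" and r = "Suc n", OF iter_cont half_gt_zero[OF \<theta>(1)]] by metis
      define s where "s = min \<rho> (l / 2)"
      have s: "0 < s" "s \<le> \<rho>" "s \<le> l / 2" using \<rho>(1) l unfolding s_def by auto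
      define y where "y = (if c = a then a + s else b - s)"
      have y: "a < y" "y < b" "\<bar>y - c\<bar> \<le> \<rho>" using s c l ab unfolding y_def l_def by auto
      have y01: "y \<in> {a..b}" using y by auto
      obtain m where m: "y \<in> (u ^^ m) ` {a + l / 4..b - l / 4}"
      proof -
        have "a \<le> a + l / 4" "a + l / 4 < b - l / 4" "b - l / 4 \<le> b"
          using l unfolding l_def by simp_all argo
        from cover[OF this y(1,2), of 0] show thesis using that by blast
      qed
      then obtain y0 where y0: "y0 \<in> N" "y = (u ^^ m) y0" using mid by blast
      have y001: "y0 \<in> {a..b}" using y0(1) N01 by blast
      have near_y: "\<bar>(u ^^ t) y - (u ^^ t) c\<bar> < \<theta>" if "t \<le> n" for t
        using \<rho>(2)[of t y c] that y01 c01 y(3) \<theta>(1) by simp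
      define i where "i = Max {i. i \<le> m \<and> (u ^^ i) y0 \<in> N}"
      have fin: "finite {i. i \<le> m \<and> (u ^^ i) y0 \<in> N}" by simp
      have "0 \<in> {i. i \<le> m \<and> (u ^^ i) y0 \<in> N}" using y0(1) by simp
      then have "i \<in> {i. i \<le> m \<and> (u ^^ i) y0 \<in> N}"
        unfolding i_def by (intro Max_in fin) blast
      then have i: "i \<le> m" "(u ^^ i) y0 \<in> N" by auto
      have last: "(u ^^ t) y0 \<notin> N" if "i < t" "t \<le> m" for t
      proof
        assume "(u ^^ t) y0 \<in> N"
        then have "t \<le> i" unfolding i_def using that by (intro Max_ge fin) simp
        then show False using that by simp
      qed
      have "y \<notin> N"
        using near_y[of 0] P(1) unfolding N_def by force
      then have "i \<noteq> m" using i(2) y0(2) by auto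
      then have im: "i < m" using i(1) by simp
      \<comment> \<open>The first point after the last visit to \<open>N\<close>. Up to time
        \<open>m\<close> its orbit avoids \<open>N\<close>, then it continues as the orbit of
        \<open>y\<close>; so it stays near \<open>P\<close> during \<open>n\<close> steps.\<close>
      define w where "w = (u ^^ Suc i) y0"
      have w01: "w \<in> {a..b}" unfolding w_def by (rule iter_mem[OF y001])
      have w_iter: "(u ^^ t) w = (u ^^ (t + Suc i)) y0" for t
        unfolding w_def by (simp only: funpow_add comp_apply)
      have stay: "\<exists>p\<in>P. \<bar>(u ^^ t) w - p\<bar> < \<theta>" if t: "t \<le> n" for t
      proof (cases "t + Suc i \<le> m")
        case True
        then have "(u ^^ t) w \<notin> N" unfolding w_iter by (intro last) simp
        then show ?thesis by (intro near_P iter_mem[OF w01])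
      next
        case False
        define t' where "t' = t + Suc i - m"
        have t': "t' \<le> n" "t + Suc i = t' + m" using False t im unfolding t'_def by auto
        have "(u ^^ t) w = (u ^^ t') y" unfolding w_iter t'(2) y0(2) by (simp only: funpow_add comp_apply)
        then show ?thesis using near_y[OF t'(1)] P_iter[OF P(1), of t'] by auto
      qed
      obtain p where p: "p \<in> P" "\<bar>w - p\<bar> < \<theta>" using stay[of 0] by auto
      have p01: "p \<in> {a..b}" using p(1) P01 by blast
      have shadow: "\<bar>(u ^^ t) w - (u ^^ t) p\<bar> < \<theta>" if "t \<le> n" for t
        using that
      proof (induction t)
        case 0
        then show ?case using p(2) by simp
      next
        case (Suc t)
        have "\<bar>u ((u ^^ t) w) - u ((u ^^ t) p)\<bar> \<le> l / 2"
          using Suc \<theta>(3) by (intro e2(2) iter_mem w01 p01) simp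
        then have 1: "\<bar>(u ^^ Suc t) w - (u ^^ Suc t) p\<bar> \<le> l / 2" by simp
        obtain p' where p': "p' \<in> P" "\<bar>(u ^^ Suc t) w - p'\<bar> < \<theta>" using stay[OF Suc.prems] by blast
        have "\<bar>p' - (u ^^ Suc t) p\<bar> < l" using 1 p'(2) \<theta>(4) l by linarith
        moreover have "p' \<in> {a, b}" "(u ^^ Suc t) p \<in> {a, b}" using p'(1) P_iter[OF p(1)] P(2) by blast+
        ultimately have "p' = (u ^^ Suc t) p" unfolding l_def by auto
        then show ?case using p'(2) by simp
      qed
      have w_far: "\<eta> \<le> \<bar>w - a\<bar>" if "a \<in> P"
        using ea(2)[OF that] i(2) \<eta>(2) unfolding w_def by fastforce
      have w_far': "\<eta> \<le> \<bar>w - b\<bar>" if "b \<in> P"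
        using eb(2)[OF that] i(2) \<eta>(3) unfolding w_def by fastforce
      have "w \<in> {a + \<eta>..b - \<eta>}"
      proof -
        have "p = a \<or> p = b" using p(1) P(2) by blast
        then have "(a \<in> P \<and> \<bar>w - a\<bar> < \<theta>) \<or> (b \<in> P \<and> \<bar>w - b\<bar> < \<theta>)" using p by auto
        then have "\<eta> \<le> \<bar>w - a\<bar> \<and> \<eta> \<le> \<bar>w - b\<bar>"
        proof
          assume h: "a \<in> P \<and> \<bar>w - a\<bar> < \<theta>"
          then have "\<eta> \<le> \<bar>w - a\<bar>" using w_far by simp
          have "\<eta> \<le> b - w"
          proof -
            have "w - a < l / 4" using h \<theta>(4) by auto
            then have "b - w > l / 2 + l / 4" unfolding l_def by argo
            then show ?thesis using \<eta>(4) l by linarith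
          qed
          then have "\<eta> \<le> \<bar>w - b\<bar>" by simp
          with \<open>\<eta> \<le> \<bar>w - a\<bar>\<close> show ?thesis ..
        next
          assume h: "b \<in> P \<and> \<bar>w - b\<bar> < \<theta>"
          then have "\<eta> \<le> \<bar>w - b\<bar>" using w_far' by simp
          have "\<eta> \<le> w - a"
          proof -
            have "b - w < l / 4" using h \<theta>(4) by auto
            then have "w - a > l / 2 + l / 4" unfolding l_def by argo
            then show ?thesis using \<eta>(4) l by linarith
          qed
          then have "\<eta> \<le> \<bar>w - a\<bar>" by simp
          then show ?thesis using \<open>\<eta> \<le> \<bar>w - b\<bar>\<close> ..
        qed
        then show ?thesis using w01 by auto
      qed
      moreover have "\<bar>birkhoff_sum u (\<Phi> j) n w - birkhoff_sum u (\<Phi> j) n c\<bar> \<le> \<epsilon> * n" if j: "j < r" for j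
      proof -
        have 1: "\<bar>birkhoff_sum u (\<Phi> j) n w - birkhoff_sum u (\<Phi> j) n p\<bar> \<le> n * (\<epsilon> / 2)"
        proof (rule birkhoff_sum_diff)
          fix t assume "t < n"
          then have "\<bar>(u ^^ t) w - (u ^^ t) p\<bar> \<le> e1" using shadow[of t] \<theta>(2) by simp
          then show "\<bar>\<Phi> j ((u ^^ t) w) - \<Phi> j ((u ^^ t) p)\<bar> \<le> \<epsilon> / 2"
            by (rule e1(2)[OF j iter_mem[OF w01] iter_mem[OF p01]])
        qed
        \<comment> \<open>The point \<open>p\<close> is \<open>c\<close> or \<open>u c\<close>, and
          a shift by one step changes the sum by at most 2.\<close>
        have "\<bar>birkhoff_sum u (\<Phi> j) n c - birkhoff_sum u (\<Phi> j) n p\<bar> \<le> 2"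
        proof (cases "p = c")
          case False
          then have "p = (u ^^ 1) c" using P(5)[OF p(1)] by simp
          then show ?thesis
            using birkhoff_sum_shift[of "\<Phi> j" u c n 1] bnd[OF j c01] by simp
        qed simp
        moreover have "2 \<le> n * (\<epsilon> / 2)"
        proof -
          have "4 / \<epsilon> \<le> real n" using n0 n by (meson less_imp_le less_le_trans of_nat_le_iff)
          then show ?thesis using \<epsilon> by (simp add: field_simps)
        qed
        ultimately have 2: "\<bar>birkhoff_sum u (\<Phi> j) n c - birkhoff_sum u (\<Phi> j) n p\<bar> \<le> n * (\<epsilon> / 2)"
          by (rule order_trans)
        have "\<bar>birkhoff_sum u (\<Phi> j) n w - birkhoff_sum u (\<Phi> j) n c\<bar> \<le> n * (\<epsilon> / 2) + n * (\<epsilon> / 2)"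
          using dist_triangle2[of "birkhoff_sum u (\<Phi> j) n w" "birkhoff_sum u (\<Phi> j) n c" "birkhoff_sum u (\<Phi> j) n p"]
            add_mono[OF 1 2] unfolding dist_real_def by (rule order_trans)
        then show ?thesis by (simp add: mult.commute)
      qed
      ultimately show "\<exists>w\<in>{a + \<eta>..b - \<eta>}. \<forall>j<r.
          \<bar>birkhoff_sum u (\<Phi> j) n w - birkhoff_sum u (\<Phi> j) n c\<bar> \<le> \<epsilon> * n" by blast
    qed
  qed
qed

end

section \<open>Transitive interval maps\<close>

lemma connected_UN_linked:
  fixes B :: "nat \<Rightarrow> 'a::topological_space set"
  assumes conn: "\<And>j. connected (B j)" and link: "\<And>j. B j \<inter> B (Suc j) \<noteq> {}"
  shows "connected (\<Union>j. B j)"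
proof -
  have fin: "connected (\<Union>j\<le>n. B j)" for n
  proof (induction n)
    case (Suc n)
    have "(\<Union>j\<le>Suc n. B j) = (\<Union>j\<le>n. B j) \<union> B (Suc n)" by (simp add: atMost_Suc Un_commute)
    moreover have "(\<Union>j\<le>n. B j) \<inter> B (Suc n) \<noteq> {}" using link[of n] by blast
    ultimately show ?case by (metis connected_Un[OF Suc.IH conn])
  qed (simp add: conn)
  obtain z where z: "z \<in> B 0" using link[of 0] by blast
  have "connected (\<Union>(range (\<lambda>n. \<Union>j\<le>n. B j)))"
  proof (rule connected_Union)
    show "\<Inter> (range (\<lambda>n. \<Union>j\<le>n. B j)) \<noteq> {}" using z by blast
  qed (use fin in blast)
  moreover have "\<Union>(range (\<lambda>n. \<Union>j\<le>n. B j)) = (\<Union>j. B j)" by blast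
  ultimately show ?thesis by simp
qed

text \<open>Each \<open>L i\<close> is connected and misses \<open>F\<close>, so it lies entirely on
  one side of each point of \<open>F\<close>. Two points of \<open>F\<close> are separated by some
  \<open>L i\<close> with \<open>i < t\<close>, so the set of those \<open>i\<close> for which
  \<open>L i\<close> lies to the left determines the point.\<close>

lemma finite_dense_complement:
  fixes L :: "nat \<Rightarrow> real set"
  assumes conn: "\<And>i. connected (L i)"
    and dense: "\<And>y y'. y \<in> F \<Longrightarrow> y' \<in> F \<Longrightarrow> y < y' \<Longrightarrow> \<exists>i<t. \<exists>s\<in>L i. y < s \<and> s < y'"
    and disj: "\<And>i. F \<inter> L i = {}"
  shows "finite F"
proof -
  define g where "g y = {i. i < t \<and> (\<exists>s\<in>L i. s < y)}" for y
  have neq: "g y \<noteq> g y'" if y: "y \<in> F" "y' \<in> F" "y < y'" for y y'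
  proof -
    obtain i s where i: "i < t" "s \<in> L i" "y < s" "s < y'" using dense[OF y] by blast
    have "i \<in> g y'" using i unfolding g_def by blast
    moreover have "i \<notin> g y"
    proof
      assume "i \<in> g y"
      then obtain s' where "s' \<in> L i" "s' < y" unfolding g_def by blast
      then have "y \<in> L i" using connectedD_interval[OF conn[of i] _ i(2), of s' y] i(3) by simp
      then show False using disj[of i] y(1) by blast
    qed
    ultimately show ?thesis by blast
  qed
  have "inj_on g F"
  proof (rule inj_onI)
    fix y y' assume "y \<in> F" "y' \<in> F" "g y = g y'"
    then show "y = y'" using neq[of y y'] neq[of y' y] by (cases y y' rule: linorder_cases) auto
  qed
  moreover have "g ` F \<subseteq> Pow {..<t}" unfolding g_def by auto
  ultimately show ?thesis using inj_on_finite[of g F "Pow {..<t}"] by simp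
qed

locale transitive_map = interval_map +
  fixes x0 :: real
  assumes ab: "a < b" and x0: "x0 \<in> {a..b}"
    and dense_orbit: "\<And>c d N. \<lbrakk>a \<le> c; c < d; d \<le> b\<rbrakk> \<Longrightarrow> \<exists>n\<ge>N. (u ^^ n) x0 \<in> {c<..<d}"
begin

lemma iter_diff: "m \<le> n \<Longrightarrow> (u ^^ n) y = (u ^^ (n - m)) ((u ^^ m) y)"
  by (metis comp_apply funpow_add le_add_diff_inverse2)

text \<open>The dense orbit enters \<open>{c..d}\<close> and can never leave it.\<close>

lemma invariant_interval_full:
  assumes "a \<le> c" "c < d" "d \<le> b" "u ` {c..d} \<subseteq> {c..d}"
  shows "c = a \<and> d = b"
proof -
  obtain n where n: "(u ^^ n) x0 \<in> {c<..<d}" using dense_orbit[OF assms(1-3), of 0] by blast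
  have later: "(u ^^ m) x0 \<in> {c..d}" if "n \<le> m" for m
  proof -
    have "(u ^^ n) x0 \<in> {c..d}" using n by simp
    then show ?thesis unfolding iter_diff[OF that] using funpow_image_subset[OF assms(4), of "m - n"] by blast
  qed
  have "c = a"
  proof (rule ccontr)
    assume "c \<noteq> a"
    then obtain m where "n \<le> m" "(u ^^ m) x0 \<in> {a<..<c}"
      using dense_orbit[of a c n] assms by auto
    then show False using later[of m] by simp
  qed
  moreover have "d = b"
  proof (rule ccontr)
    assume "d \<noteq> b"
    then obtain m where "n \<le> m" "(u ^^ m) x0 \<in> {d<..<b}"
      using dense_orbit[of d b n] assms by auto
    then show False using later[of m] by simp
  qed
  ultimately show ?thesis ..
qed

text \<open>Suppose the midpoint \<open>m\<close> moves to the right. Without interior fixed points,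
  no point of \<open>{m..b}\<close> can be sent below \<open>m\<close>, so this is a proper
  invariant interval, against density of the orbit. The other case is symmetric.\<close>

lemma interior_fixed_point: "\<exists>q. a < q \<and> q < b \<and> u q = q"
proof (rule ccontr)
  assume no: "\<not> ?thesis"
  define m where "m = (a + b) / 2"
  have m: "a < m" "m < b" using ab unfolding m_def by auto
  have cont': "continuous_on {c..d} (\<lambda>y. u y - y)" if "a \<le> c" "d \<le> b" for c d
    using iter_cont_sub[OF that, of 1] by (intro continuous_intros) simp
  have u_ab: "a \<le> u y" "u y \<le> b" if "a \<le> y" "y \<le> b" for y
    using iter_mem[of y 1] that by auto
  consider "m < u m" | "u m < m" using no m by force
  then show False
  proof cases
    case 1
    have "m \<le> u y" if y: "m \<le> y" "y \<le> b" for y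
    proof (rule ccontr)
      assume "\<not> m \<le> u y"
      then have "\<exists>z\<in>{m..y}. u z - z = 0"
        using 1 y m by (intro between_image[OF cont', of m y y m]) auto
      then obtain z where z: "m \<le> z" "z \<le> y" "u z = z" by auto
      moreover have "\<not> (a < z \<and> z < b)" using no z(3) by blast
      ultimately have "z = b" using m y(2) by linarith
      then show False using z y \<open>\<not> m \<le> u y\<close> by auto
    qed
    then have "u ` {m..b} \<subseteq> {m..b}" using u_ab m by auto
    then show False using invariant_interval_full[of m b] m by simp
  next
    case 2
    have "u y \<le> m" if y: "a \<le> y" "y \<le> m" for y
    proof (rule ccontr)
      assume "\<not> u y \<le> m"
      then have "\<exists>z\<in>{y..m}. u z - z = 0"
        using 2 y m by (intro between_image[OF cont', of y m m y]) auto
      then obtain z where z: "y \<le> z" "z \<le> m" "u z = z" by auto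
      moreover have "\<not> (a < z \<and> z < b)" using no z(3) by blast
      ultimately have "z = a" using m y(1) by linarith
      then show False using z y \<open>\<not> u y \<le> m\<close> by auto
    qed
    then have "u ` {a..m} \<subseteq> {a..m}" using u_ab m by auto
    then show False using invariant_interval_full[of a m] m by simp
  qed
qed

lemma surj: "u ` {a..b} = {a..b}"
proof (rule image_full[OF ab])
  fix p assume p: "a < p" "p < b"
  show "p \<in> closure (u ` {a..b})"
    unfolding closure_approachable
  proof (intro allI impI)
    fix e :: real assume e: "0 < e"
    define d where "d = min b (p + e)"
    have "p < d" "d \<le> b" using p e unfolding d_def by auto
    then obtain n where n: "n \<ge> 1" "(u ^^ n) x0 \<in> {p<..<d}" using dense_orbit[of p d 1] p by auto
    have "(u ^^ n) x0 = u ((u ^^ (n - 1)) x0)"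
      using n(1) by (metis Suc_diff_1 Suc_le_eq One_nat_def comp_apply funpow.simps(2))
    then have "(u ^^ n) x0 \<in> u ` {a..b}" using iter_mem[OF x0] by simp
    moreover have "dist ((u ^^ n) x0) p < e" using n(2) unfolding d_def dist_real_def by auto
    ultimately show "\<exists>y\<in>u ` {a..b}. dist y p < e" by blast
  qed
qed

text \<open>Once \<open>q\<close> is known to have no preimage but itself, connectedness sends each
  side of \<open>q\<close> into one side. Neither side can be invariant because of the dense orbit,
  so the two are exchanged.\<close>

lemma swap_at_inaccessible:
  assumes q: "a < q" "q < b" "u q = q"
    and cd: "a \<le> c" "c < d" "d \<le> b" and no: "\<And>m. q \<notin> (u ^^ m) ` {c..d}"
  shows "u ` {a..q} \<subseteq> {q..b}" "u ` {q..b} \<subseteq> {a..q}"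
proof -
  obtain n1 where n1: "(u ^^ n1) x0 \<in> {c<..<d}" using dense_orbit[OF cd, of 0] by blast
  obtain n2 where n2: "n2 \<ge> Suc n1" "(u ^^ n2) x0 \<in> {c<..<d}" using dense_orbit[OF cd, of "Suc n1"] by blast
  define t where "t = n2 - n1"
  have t: "0 < t" using n2(1) unfolding t_def by simp
  define K where "K = {c..d}"
  have K: "K \<subseteq> {a..b}" using cd unfolding K_def by auto
  define S where "S = (\<Union>m. (u ^^ m) ` K)"
  have S01: "S \<subseteq> {a..b}" unfolding S_def using iter_mem K by blast
  have uS: "u y \<in> S" if y: "y \<in> S" for y
  proof -
    obtain m z where "z \<in> K" "y = (u ^^ m) z" using y unfolding S_def by blast
    then have "u y \<in> (u ^^ Suc m) ` K" by simp
    then show ?thesis unfolding S_def by blast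
  qed
  define F where "F = {a..b} - S"
  have K_conn: "connected ((u ^^ m) ` K)" for m
    by (rule connected_continuous_image[OF continuous_on_subset[OF iter_cont K]]) (simp add: K_def)
  \<comment> \<open>Since \<open>K\<close> meets its \<open>t\<close>-th image, the images along one
    residue class modulo \<open>t\<close> overlap in a chain and have a connected union.\<close>
  define L where "L i = (\<Union>j. (u ^^ (j * t + i)) ` K)" for i
  have ret: "(u ^^ n2) x0 \<in> K \<inter> (u ^^ t) ` K"
    using n1 n2 iter_diff[of n1 n2 x0] unfolding t_def K_def by auto
  have L_conn: "connected (L i)" for i
    unfolding L_def
  proof (rule connected_UN_linked[OF K_conn])
    fix j
    have "(u ^^ (j * t + i)) ((u ^^ n2) x0) \<in> (u ^^ (j * t + i)) ` K" using ret by blast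
    moreover have "(u ^^ (j * t + i)) ((u ^^ n2) x0) \<in> (u ^^ (j * t + i)) ` (u ^^ t) ` K" using ret by blast
    then have "(u ^^ (j * t + i)) ((u ^^ n2) x0) \<in> (u ^^ (Suc j * t + i)) ` K"
      unfolding funpow_image_add[symmetric] by (simp add: ac_simps)
    ultimately show "(u ^^ (j * t + i)) ` K \<inter> (u ^^ (Suc j * t + i)) ` K \<noteq> {}" by blast
  qed
  have S_L: "\<exists>i<t. y \<in> L i" if y: "y \<in> S" for y
  proof -
    obtain m where m: "y \<in> (u ^^ m) ` K" using y unfolding S_def by blast
    have "y \<in> (u ^^ (m div t * t + m mod t)) ` K" using m by simp
    then have "y \<in> L (m mod t)" unfolding L_def by blast
    then show ?thesis using t by (intro exI[of _ "m mod t"]) simp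
  qed
  have L_S: "L i \<subseteq> S" for i unfolding L_def S_def by blast
  \<comment> \<open>\<open>F\<close> is finite and backward invariant, so \<open>u\<close> is injective on \<open>F\<close> and \<open>q\<close> is its own only preimage.\<close>
  have "finite F"
  proof (rule finite_dense_complement[OF L_conn])
    fix y y' assume y: "y \<in> F" "y' \<in> F" "y < y'"
    have "a \<le> y" "y' \<le> b" using y unfolding F_def by auto
    then obtain n where n: "n \<ge> n1" "(u ^^ n) x0 \<in> {y<..<y'}" using dense_orbit[OF _ y(3), of n1] by blast
    have "(u ^^ n1) x0 \<in> K" using n1 unfolding K_def by simp
    then have "(u ^^ n) x0 \<in> S" unfolding iter_diff[OF n(1)] S_def by blast
    then show "\<exists>i<t. \<exists>s\<in>L i. y < s \<and> s < y'" using S_L n(2) by (meson greaterThanLessThan_iff)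
  next
    show "F \<inter> L i = {}" for i using L_S[of i] unfolding F_def by blast
  qed
  have "F \<subseteq> u ` F"
  proof
    fix y assume y: "y \<in> F"
    then have "y \<in> u ` {a..b}" unfolding surj F_def by blast
    then obtain w where w: "w \<in> {a..b}" "y = u w" by blast
    then have "w \<in> F" using uS[of w] y unfolding F_def by blast
    then show "y \<in> u ` F" using w(2) by blast
  qed
  then have "card F \<le> card (u ` F)" by (intro card_mono finite_imageI \<open>finite F\<close>)
  then have "card (u ` F) = card F" using card_image_le[OF \<open>finite F\<close>, of u] by simp
  then have inj: "inj_on u F" by (rule eq_card_imp_inj_on[OF \<open>finite F\<close>])
  have qS: "q \<notin> S" using no unfolding S_def K_def by blast
  have qF: "q \<in> F" using qS q unfolding F_def by simp
  have ne: "u w \<noteq> q" if "w \<in> {a..b}" "w \<noteq> q" for w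
  proof
    assume uw: "u w = q"
    then have "w \<in> F" using that(1) uS[of w] qS unfolding F_def by auto
    then show False using inj_onD[OF inj _ _ qF, of w] uw q(3) that(2) by simp
  qed
  have side: "(\<forall>y\<in>A. u y < q) \<or> (\<forall>y\<in>A. q < u y)"
    if A: "connected A" "A \<subseteq> {a..b} - {q}" for A
  proof (rule ccontr)
    assume "\<not> ?thesis"
    then obtain y z where yz: "y \<in> A" "z \<in> A" "q \<le> u y" "u z \<le> q" by (auto simp: not_less)
    have "connected (u ` A)"
      by (rule connected_continuous_image[OF continuous_on_subset[OF cont] A(1)]) (use A(2) in blast)
    then have "q \<in> u ` A" by (rule connectedD_interval[of _ "u z" "u y"]) (use yz in auto)
    then show False using ne A(2) by blast
  qed
  have bounds: "a \<le> u y \<and> u y \<le> b" if "a \<le> y" "y \<le> b" for y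
    using iter_mem[of y 1] that by auto
  show "u ` {a..q} \<subseteq> {q..b}"
  proof (rule ccontr)
    assume not: "\<not> ?thesis"
    have "(\<forall>y\<in>{a..<q}. u y < q) \<or> (\<forall>y\<in>{a..<q}. q < u y)" by (rule side) (use q in auto)
    then have "\<forall>y\<in>{a..<q}. u y < q"
    proof
      assume h: "\<forall>y\<in>{a..<q}. q < u y"
      have "u y \<in> {q..b}" if "y \<in> {a..q}" for y
        using h that q bounds[of y] by (cases "y = q") (auto simp: less_le)
      then show ?thesis using not by blast
    qed
    then have "u y \<in> {a..q}" if "y \<in> {a..q}" for y
      using that q bounds[of y] by (cases "y = q") (auto simp: less_le)
    then have "u ` {a..q} \<subseteq> {a..q}" by blast
    then show False using invariant_interval_full[of a q] q by simp
  qed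
  show "u ` {q..b} \<subseteq> {a..q}"
  proof (rule ccontr)
    assume not: "\<not> ?thesis"
    have "(\<forall>y\<in>{q<..b}. u y < q) \<or> (\<forall>y\<in>{q<..b}. q < u y)" by (rule side) (use q in auto)
    then have "\<forall>y\<in>{q<..b}. q < u y"
    proof
      assume h: "\<forall>y\<in>{q<..b}. u y < q"
      have "u y \<in> {a..q}" if "y \<in> {q..b}" for y
        using h that q bounds[of y] by (cases "y = q") (auto simp: less_le)
      then show ?thesis using not by blast
    qed simp
    then have "u y \<in> {q..b}" if "y \<in> {q..b}" for y
      using that q bounds[of y] by (cases "y = q") (auto simp: less_le)
    then have "u ` {q..b} \<subseteq> {q..b}" by blast
    then show False using invariant_interval_full[of q b] q by simp
  qed
qed

text \<open>From time \<open>max m0 M\<close> on all images contain \<open>q\<close>, so their union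
  is connected. It contains a tail of the dense orbit, hence points on both sides of
  \<open>p\<close>.\<close>

lemma covering_if_accessible:
  assumes q: "a < q" "q < b" "u q = q"
    and acc: "\<And>c d. a \<le> c \<Longrightarrow> c < d \<Longrightarrow> d \<le> b \<Longrightarrow> \<exists>m. q \<in> (u ^^ m) ` {c..d}"
  shows "covering_map u a b q"
proof (unfold_locales)
  show "a < q" "q < b" "u q = q" by (rule q)+
  have q_iter: "(u ^^ n) q = q" for n by (induction n) (simp_all add: q(3))
  fix c d p M assume cd: "a \<le> c" "c < d" "d \<le> b" and p: "a < p" "p < b"
  define K where "K = {c..d}"
  have K: "K \<subseteq> {a..b}" using cd unfolding K_def by auto
  obtain m0 where m0: "q \<in> (u ^^ m0) ` K" using acc[OF cd] unfolding K_def by blast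
  obtain n1 where n1: "(u ^^ n1) x0 \<in> {c<..<d}" using dense_orbit[OF cd, of 0] by blast
  define N where "N = max m0 M"
  define B where "B j = (u ^^ (N + j)) ` K" for j
  have qB: "q \<in> B j" for j
  proof -
    have "(u ^^ (N + j - m0)) q \<in> (u ^^ (N + j - m0)) ` (u ^^ m0) ` K" using m0 by (rule imageI)
    then show ?thesis unfolding funpow_image_add[symmetric] q_iter B_def N_def by simp
  qed
  have "connected (B j)" for j
    unfolding B_def
    by (rule connected_continuous_image[OF continuous_on_subset[OF iter_cont K]]) (simp add: K_def)
  then have conn: "connected (\<Union>j. B j)"
    by (rule connected_UN_linked) (use qB in blast)
  have orbit_B: "(u ^^ n) x0 \<in> (\<Union>j. B j)" if "n \<ge> N + n1" for n
  proof -
    have "n \<ge> n1" "n - n1 = N + (n - n1 - N)" using that by auto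
    have n1K: "(u ^^ n1) x0 \<in> K" using n1 unfolding K_def by simp
    have "(u ^^ n) x0 = (u ^^ (N + (n - n1 - N))) ((u ^^ n1) x0)"
      using iter_diff[OF \<open>n \<ge> n1\<close>] \<open>n - n1 = N + (n - n1 - N)\<close> by metis
    then have "(u ^^ n) x0 \<in> B (n - n1 - N)" unfolding B_def using n1K by (simp only: imageI)
    then show ?thesis by blast
  qed
  obtain n where n: "n \<ge> N + n1" "(u ^^ n) x0 \<in> {a<..<p}" using dense_orbit[of a p "N + n1"] p by auto
  obtain n' where n': "n' \<ge> N + n1" "(u ^^ n') x0 \<in> {p<..<b}" using dense_orbit[of p b "N + n1"] p by auto
  have "p \<in> (\<Union>j. B j)"
    using connectedD_interval[OF conn orbit_B[OF n(1)] orbit_B[OF n'(1)], of p] n(2) n'(2) by simp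
  then obtain j where "p \<in> (u ^^ (N + j)) ` {c..d}" unfolding B_def K_def by blast
  then show "\<exists>m\<ge>M. p \<in> (u ^^ m) ` {c..d}"
    by (intro exI[of _ "N + j"]) (simp add: N_def)
qed

lemma covering_or_swap:
  "(\<exists>q. covering_map u a b q) \<or>
   (\<exists>q. a < q \<and> q < b \<and> u q = q \<and> u ` {a..q} \<subseteq> {q..b} \<and> u ` {q..b} \<subseteq> {a..q})"
proof -
  obtain q where q: "a < q" "q < b" "u q = q" using interior_fixed_point by blast
  show ?thesis
  proof (cases "\<forall>c d. a \<le> c \<longrightarrow> c < d \<longrightarrow> d \<le> b \<longrightarrow> (\<exists>m. q \<in> (u ^^ m) ` {c..d})")
    case True
    have "covering_map u a b q" by (rule covering_if_accessible[OF q]) (use True in simp)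
    then show ?thesis by blast
  next
    case False
    then obtain c d where cd: "a \<le> c" "c < d" "d \<le> b" "\<And>m. q \<notin> (u ^^ m) ` {c..d}" by auto
    then show ?thesis using q swap_at_inaccessible[OF q cd] by blast
  qed
qed

text \<open>If the two sides of \<open>q\<close> are exchanged, \<open>u ^^ 2\<close> is transitive
  on \<open>{a..q}\<close>, and no exchange can occur again: one at \<open>q'\<close> would move the
  fixed endpoint \<open>q\<close> to the left of \<open>q'\<close>. The last conclusion allows
  samples from all of \<open>{a..b}\<close> to be brought into the smaller interval.\<close>

lemma covering_power:
  "\<exists>s \<beta> q. 0 < s \<and> \<beta> \<le> b \<and> covering_map (u ^^ s) a \<beta> q \<and> (\<forall>z\<in>{a..b}. z \<in> {a..\<beta>} \<or> u z \<in> {a..\<beta>})"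
  using covering_or_swap
proof
  assume "\<exists>q. covering_map u a b q"
  then obtain q where "covering_map u a b q" ..
  then have "covering_map (u ^^ 1) a b q" by simp
  then show ?thesis by (intro exI[of _ 1] exI[of _ b] exI[of _ q]) auto
next
  assume "\<exists>q. a < q \<and> q < b \<and> u q = q \<and> u ` {a..q} \<subseteq> {q..b} \<and> u ` {q..b} \<subseteq> {a..q}"
  then obtain q where q: "a < q" "q < b" "u q = q" "u ` {a..q} \<subseteq> {q..b}" "u ` {q..b} \<subseteq> {a..q}" by blast
  let ?v = "u ^^ 2"
  have v: "?v y = u (u y)" for y by (simp add: numeral_2_eq_2)
  have v_maps: "?v ` {a..q} \<subseteq> {a..q}" using q(4,5) unfolding v image_subset_iff by blast
  obtain n0 where n0: "(u ^^ n0) x0 \<in> {a<..<q}" using dense_orbit[of a q 0] q by auto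
  define y0 where "y0 = (u ^^ n0) x0"
  have y0: "y0 \<in> {a..q}" using n0 unfolding y0_def by simp
  have v_y0: "(?v ^^ j) y0 \<in> {a..q}" for j using funpow_image_subset[OF v_maps, of j] y0 by blast
  have "transitive_map ?v a q y0"
  proof (unfold_locales)
    show "continuous_on {a..q} ?v" by (rule iter_cont_sub) (use q in auto)
    show "?v \<in> {a..q} \<rightarrow> {a..q}" using v_maps by blast
    show "a < q" "y0 \<in> {a..q}" by (rule q(1), rule y0)
    fix c d N assume cd: "a \<le> c" "c < d" "d \<le> q"
    obtain n where n: "n \<ge> n0 + 2 * N" "(u ^^ n) x0 \<in> {c<..<d}"
      using dense_orbit[of c d "n0 + 2 * N"] cd q(2) by auto
    have un: "(u ^^ n) x0 = (u ^^ (n - n0)) y0" unfolding y0_def using iter_diff[of n0 n] n(1) by simp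
    obtain j where j: "n - n0 = 2 * j \<or> n - n0 = Suc (2 * j)" by (metis evenE oddE Suc_eq_plus1)
    \<comment> \<open>After an odd number of steps the orbit is in \<open>{q..b}\<close>, so it
      visits \<open>{c<..<d}\<close> only after even numbers of steps.\<close>
    have "n - n0 \<noteq> Suc (2 * j)"
    proof
      assume "n - n0 = Suc (2 * j)"
      then have "(u ^^ n) x0 = u ((?v ^^ j) y0)" unfolding un by (simp add: funpow_mult)
      then have "(u ^^ n) x0 \<in> u ` {a..q}" using v_y0[of j] by (simp only: imageI)
      then have "(u ^^ n) x0 \<in> {q..b}" using q(4) by blast
      then show False using n(2) cd(3) by simp
    qed
    then have e: "n - n0 = 2 * j" using j by blast
    then have "(u ^^ n) x0 = (?v ^^ j) y0" unfolding un by (simp add: funpow_mult)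
    moreover have "j \<ge> N" using e n(1) by linarith
    ultimately show "\<exists>n\<ge>N. (?v ^^ n) y0 \<in> {c<..<d}" using n(2) by (intro exI[of _ j]) simp
  qed
  then interpret v: transitive_map ?v a q y0 .
  have "\<not> (\<exists>q'. a < q' \<and> q' < q \<and> ?v q' = q' \<and> ?v ` {a..q'} \<subseteq> {q'..q} \<and> ?v ` {q'..q} \<subseteq> {a..q'})"
  proof
    assume "\<exists>q'. a < q' \<and> q' < q \<and> ?v q' = q' \<and> ?v ` {a..q'} \<subseteq> {q'..q} \<and> ?v ` {q'..q} \<subseteq> {a..q'}"
    then obtain q' where q': "q' < q" "?v ` {q'..q} \<subseteq> {a..q'}" by blast
    have "?v q \<in> ?v ` {q'..q}" using q'(1) by (intro imageI) simp
    then have "?v q \<in> {a..q'}" using q'(2) by blast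
    then show False using q'(1) unfolding v q(3) by simp
  qed
  then obtain q' where "covering_map ?v a q q'" using v.covering_or_swap by blast
  moreover have "z \<in> {a..q} \<or> u z \<in> {a..q}" if "z \<in> {a..b}" for z
  proof (cases "z \<le> q")
    case False
    then have "z \<in> {q..b}" using that by simp
    then show ?thesis using q(5) by blast
  qed (use that in simp)
  ultimately show ?thesis
    using q(2) by (intro exI[of _ 2] exI[of _ q] exI[of _ q']) auto
qed

end

section \<open>Measures on the unit interval\<close>

lemma measurable_unit:
  assumes "sets M = sets unit_borel"
  shows "space M = {0..1}" "continuous_on {0..1} \<phi> \<Longrightarrow> (\<phi> :: real \<Rightarrow> real) \<in> borel_measurable M"
    "continuous_on {0..1} h \<Longrightarrow> h \<in> {0..1} \<rightarrow> {0..1} \<Longrightarrow> h \<in> measurable M unit_borel"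
proof -
  have s: "space unit_borel = {0..1}" by (simp add: space_restrict_space)
  show sp: "space M = {0..1}" using sets_eq_imp_space_eq[OF assms] s by simp
  have b: "\<phi> \<in> borel_measurable M" if "continuous_on {0..1} \<phi>" for \<phi> :: "real \<Rightarrow> real"
    using borel_measurable_continuous_on_restrict[OF that] measurable_cong_sets[OF assms refl] by blast
  show "continuous_on {0..1} \<phi> \<Longrightarrow> \<phi> \<in> borel_measurable M" by (rule b)
  show "continuous_on {0..1} h \<Longrightarrow> h \<in> {0..1} \<rightarrow> {0..1} \<Longrightarrow> h \<in> measurable M unit_borel"
    by (rule measurable_restrict_space2) (simp_all add: sp b)
qed

lemma integrable_unit:
  fixes \<phi> :: "real \<Rightarrow> real"
  assumes M: "sets M = sets unit_borel" "prob_space M" and \<phi>: "continuous_on {0..1} \<phi>"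
  shows "integrable M \<phi>"
proof -
  interpret prob_space M by fact
  have "compact (\<phi> ` {0..1})" by (rule compact_continuous_image[OF \<phi> compact_Icc])
  then obtain B where B: "\<And>x. x \<in> {0..1} \<Longrightarrow> norm (\<phi> x) \<le> B"
    by (meson bounded_iff compact_imp_bounded imageI)
  show ?thesis
    by (rule integrable_const_bound[of _ B])
      (use B measurable_unit(1)[OF M(1)] measurable_unit(2)[OF M(1) \<phi>] in auto)
qed

lemma integral_unit_le:
  fixes \<phi> \<psi> :: "real \<Rightarrow> real"
  assumes M: "sets M = sets unit_borel" "prob_space M"
    and c: "continuous_on {0..1} \<phi>" "continuous_on {0..1} \<psi>"
    and le: "\<And>x. x \<in> {0..1} \<Longrightarrow> \<bar>\<phi> x - \<psi> x\<bar> \<le> e"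
  shows "\<bar>integral\<^sup>L M \<phi> - integral\<^sup>L M \<psi>\<bar> \<le> e"
proof -
  interpret prob_space M by fact
  have i: "integrable M (\<lambda>x. \<phi> x - \<psi> x)"
    by (intro Bochner_Integration.integrable_diff integrable_unit[OF M] c)
  have "\<bar>integral\<^sup>L M \<phi> - integral\<^sup>L M \<psi>\<bar> = \<bar>integral\<^sup>L M (\<lambda>x. \<phi> x - \<psi> x)\<bar>"
    by (simp add: Bochner_Integration.integral_diff integrable_unit[OF M] c)
  also have "\<dots> \<le> integral\<^sup>L M (\<lambda>x. \<bar>\<phi> x - \<psi> x\<bar>)" by (rule integral_abs_bound)
  also have "\<dots> \<le> integral\<^sup>L M (\<lambda>_. e)"
    by (rule integral_mono) (use i le measurable_unit(1)[OF M(1)] in auto)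
  also have "\<dots> = e" by (simp add: prob_space)
  finally show ?thesis .
qed

text \<open>The continuous ramps \<open>\<phi> t n\<close> tend to the indicator of
  \<open>{..t}\<close>, so the two distribution functions agree.\<close>

lemma measure_unit_eqI:
  assumes M: "sets M = sets unit_borel" "prob_space M" and N: "sets N = sets unit_borel" "prob_space N"
    and eq: "\<And>\<phi>. continuous_on {0..1} \<phi> \<Longrightarrow> integral\<^sup>L M \<phi> = integral\<^sup>L N (\<phi> :: real \<Rightarrow> real)"
  shows "M = N"
proof -
  define \<phi> where "\<phi> t n x = max 0 (min 1 (1 - real n * (x - t)))" for t :: real and n x
  have c: "continuous_on {0..1} (\<phi> t n)" for t n
    unfolding \<phi>_def[abs_def] by (intro continuous_intros)
  have lim: "(\<lambda>n. \<phi> t n x) \<longlonglongrightarrow> indicator {..t} x" for t x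
  proof (cases "x \<le> t")
    case True
    have "\<phi> t n x = 1" for n
    proof -
      have "real n * (x - t) \<le> 0" using True by (simp add: mult_nonneg_nonpos)
      then show ?thesis unfolding \<phi>_def by simp
    qed
    then show ?thesis using True by simp
  next
    case False
    obtain n0 :: nat where n0: "1 / (x - t) < real n0" using reals_Archimedean2 by blast
    have "\<phi> t n x = 0" if "n \<ge> n0" for n
    proof -
      have "1 / (x - t) \<le> real n" using n0 that by (meson less_imp_le less_le_trans of_nat_le_iff)
      then have "1 \<le> real n * (x - t)" using False by (simp add: field_simps)
      then show ?thesis unfolding \<phi>_def by simp
    qed
    then have "\<forall>\<^sub>F n in sequentially. \<phi> t n x = 0" unfolding eventually_sequentially by blast
    then show ?thesis using False by (simp add: tendsto_eventually)
  qed
  have conv: "(\<lambda>n. integral\<^sup>L L (\<phi> t n)) \<longlonglongrightarrow> measure L ({..t} \<inter> {0..1})"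
    if L: "sets L = sets unit_borel" "prob_space L" for L t
  proof -
    interpret prob_space L by fact
    have sp: "space L = {0..1}" by (rule measurable_unit(1)[OF L(1)])
    have mt: "{..t} \<inter> {0..1} \<in> sets L" unfolding L(1) sets_restrict_space by auto
    have "(\<lambda>n. integral\<^sup>L L (\<phi> t n)) \<longlonglongrightarrow> integral\<^sup>L L (indicator ({..t} \<inter> {0..1}))"
    proof (rule integral_dominated_convergence[where w = "\<lambda>_. 1"])
      show "(indicator ({..t} \<inter> {0..1}) :: real \<Rightarrow> real) \<in> borel_measurable L" using mt by simp
      show "\<phi> t n \<in> borel_measurable L" for n by (rule measurable_unit(2)[OF L(1) c])
      show "AE x in L. (\<lambda>n. \<phi> t n x) \<longlonglongrightarrow> indicator ({..t} \<inter> {0..1}) x"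
        using lim[of t] by (intro AE_I2) (simp add: sp indicator_def)
      show "AE x in L. norm (\<phi> t n x) \<le> 1" for n by (intro AE_I2) (simp add: \<phi>_def)
    qed simp
    then show ?thesis using mt by simp
  qed
  have half: "measure M ({..t} \<inter> {0..1}) = measure N ({..t} \<inter> {0..1})" for t
    using conv[OF M, of t] conv[OF N, of t] eq[OF c] by (simp add: LIMSEQ_unique)
  \<comment> \<open>The measures are pushed forward to the whole line, where distribution functions
    are available.\<close>
  define D where "D L = distr L borel (\<lambda>x::real. x)" for L
  have id: "(\<lambda>x::real. x) \<in> borel_measurable L" if "sets L = sets unit_borel" for L
    by (rule measurable_unit(2)[OF that]) (rule continuous_on_id)
  have rd: "real_distribution (D L)" if "sets L = sets unit_borel" "prob_space L" for L
    unfolding D_def real_distribution_def real_distribution_axioms_def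
    by (simp add: prob_space.prob_space_distr[OF that(2) id[OF that(1)]])
  have cdfD: "cdf (D L) t = measure L ({..t} \<inter> {0..1})" if "sets L = sets unit_borel" for L t
    unfolding cdf_def2 D_def
    by (subst measure_distr[OF id[OF that]]) (auto simp: measurable_unit(1)[OF that] vimage_def)
  have "D M = D N"
    by (rule cdf_unique[OF rd[OF M] rd[OF N]], rule ext, unfold cdfD[OF M(1)] cdfD[OF N(1)], rule half)
  show ?thesis
  proof (rule measure_eqI)
    show "sets M = sets N" using M(1) N(1) by simp
    fix A assume "A \<in> sets M"
    then have A: "A \<in> sets borel" "A \<subseteq> {0..1}"
      unfolding M(1) sets_restrict_space by auto
    have "emeasure (D L) A = emeasure L A" if "sets L = sets unit_borel" for L
      unfolding D_def by (subst emeasure_distr[OF id[OF that] A(1)])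
        (use A(2) measurable_unit(1)[OF that] in \<open>auto intro!: arg_cong[of _ _ "emeasure L"]\<close>)
    then show "emeasure M A = emeasure N A" using \<open>D M = D N\<close> M(1) N(1) by metis
  qed
qed

text \<open>By the Stone-Weierstrass theorem. Having only countably many test functions is what
  allows weak convergence to be encoded by countably many open sets.\<close>

lemma weakly_converges_monomials:
  assumes \<mu>s: "\<And>n. n \<ge> n0 \<Longrightarrow> sets (\<mu>s n) = sets unit_borel \<and> prob_space (\<mu>s n)"
    and \<mu>: "sets \<mu> = sets unit_borel" "prob_space \<mu>"
    and mono: "\<And>i::nat. (\<lambda>n. integral\<^sup>L (\<mu>s n) (\<lambda>x. x ^ i)) \<longlonglongrightarrow> integral\<^sup>L \<mu> (\<lambda>x. x ^ i)"
  shows "weakly_converges \<mu>s \<mu>"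
  unfolding weakly_converges_def
proof (intro allI impI LIMSEQ_I)
  fix \<phi> :: "real \<Rightarrow> real" and e :: real assume \<phi>: "continuous_on {0..1} \<phi>" and e: "0 < e"
  obtain g where g: "real_polynomial_function g" "\<And>x. x \<in> {0..1} \<Longrightarrow> \<bar>\<phi> x - g x\<bar> < e / 4"
    using Stone_Weierstrass_real_polynomial_function[OF compact_Icc \<phi>, of "e / 4"] e by auto
  obtain a d where ad: "g = (\<lambda>x. \<Sum>i\<le>d. a i * x ^ i)"
    using g(1) unfolding real_polynomial_function_iff_sum by blast
  have gc: "continuous_on {0..1} g" unfolding ad by (intro continuous_intros)
  have int_g: "integral\<^sup>L L g = (\<Sum>i\<le>d. a i * integral\<^sup>L L (\<lambda>x. x ^ i))"
    if L: "sets L = sets unit_borel" "prob_space L" for L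
  proof -
    have i: "integrable L (\<lambda>x. x ^ i)" for i :: nat by (rule integrable_unit[OF L]) (intro continuous_intros)
    show ?thesis unfolding ad
      by (subst Bochner_Integration.integral_sum) (auto intro: i)
  qed
  have "(\<lambda>n. \<Sum>i\<le>d. a i * integral\<^sup>L (\<mu>s n) (\<lambda>x. x ^ i)) \<longlonglongrightarrow> integral\<^sup>L \<mu> g"
    unfolding int_g[OF \<mu>] by (intro tendsto_intros mono)
  then obtain n1 where n1: "\<And>n. n \<ge> n1 \<Longrightarrow>
      \<bar>(\<Sum>i\<le>d. a i * integral\<^sup>L (\<mu>s n) (\<lambda>x. x ^ i)) - integral\<^sup>L \<mu> g\<bar> < e / 4"
    using e unfolding lim_sequentially dist_real_def by (metis zero_less_divide_iff zero_less_numeral)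
  show "\<exists>no. \<forall>n\<ge>no. norm (integral\<^sup>L (\<mu>s n) \<phi> - integral\<^sup>L \<mu> \<phi>) < e"
  proof (intro exI[of _ "max n0 n1"] allI impI)
    fix n assume n: "max n0 n1 \<le> n"
    then have L: "sets (\<mu>s n) = sets unit_borel" "prob_space (\<mu>s n)" using \<mu>s[of n] by auto
    have 1: "\<bar>integral\<^sup>L (\<mu>s n) \<phi> - integral\<^sup>L (\<mu>s n) g\<bar> \<le> e / 4"
      by (rule integral_unit_le[OF L \<phi> gc]) (use g(2) in \<open>simp add: less_imp_le\<close>)
    have 2: "\<bar>integral\<^sup>L \<mu> \<phi> - integral\<^sup>L \<mu> g\<bar> \<le> e / 4"
      by (rule integral_unit_le[OF \<mu> \<phi> gc]) (use g(2) in \<open>simp add: less_imp_le\<close>)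
    have 3: "\<bar>integral\<^sup>L (\<mu>s n) g - integral\<^sup>L \<mu> g\<bar> < e / 4"
      using n1[of n] n unfolding int_g[OF L] by simp
    show "norm (integral\<^sup>L (\<mu>s n) \<phi> - integral\<^sup>L \<mu> \<phi>) < e"
      using 1 2 3 e unfolding real_norm_def by argo
  qed
qed

section \<open>Means over finitely many sample points\<close>

lemma exists_below_mean:
  fixes g :: "'a \<Rightarrow> real"
  assumes M: "finite_measure M" and Z: "Z \<in> sets M" "0 < measure M Z"
    and g: "integrable M (\<lambda>z. indicator Z z * g z)" "integral\<^sup>L M (\<lambda>z. indicator Z z * g z) \<le> 0"
  shows "\<exists>z\<in>Z. g z \<le> 0"
proof (rule ccontr)
  interpret finite_measure M by fact
  assume "\<not> ?thesis"
  then have pos: "\<And>z. z \<in> Z \<Longrightarrow> 0 < g z" by (auto simp: not_le)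
  then have nn: "0 \<le> indicator Z z * g z" for z by (cases "z \<in> Z") (auto simp: less_imp_le)
  have "0 \<le> integral\<^sup>L M (\<lambda>z. indicator Z z * g z)" by (rule Bochner_Integration.integral_nonneg) (rule nn)
  then have "integral\<^sup>L M (\<lambda>z. indicator Z z * g z) = 0" using g(2) by simp
  then have "AE z in M. indicator Z z * g z = 0"
    using integral_nonneg_eq_0_iff_AE[OF g(1)] nn by simp
  then have "AE z in M. z \<notin> Z"
    by (rule AE_mp) (intro AE_I2 impI, use pos in \<open>force simp: indicator_def split: if_splits\<close>)
  then have "emeasure M {z \<in> space M. z \<in> Z} = 0" by (rule emeasure_eq_0_AE)
  moreover have "{z \<in> space M. z \<in> Z} = Z" using sets.sets_into_space[OF Z(1)] by blast
  ultimately have "emeasure M Z = 0" by simp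
  then show False using Z(2) by (simp add: measure_def)
qed

text \<open>Discarding the complement of \<open>Z\<close> changes the integral by at most its mass,
  and normalising by the measure of \<open>Z\<close> costs at most the same amount again.\<close>

lemma conditional_mean:
  fixes v :: "'a \<Rightarrow> real"
  assumes M: "prob_space M" and Z: "Z \<in> sets M" "0 < measure M Z"
    and v: "v \<in> borel_measurable M" "\<And>z. z \<in> space M \<Longrightarrow> \<bar>v z\<bar> \<le> 1"
    and m: "m * measure M Z = integral\<^sup>L M (\<lambda>z. indicator Z z * v z)"
  shows "integrable M (\<lambda>z. indicator Z z * v z)" "\<bar>m\<bar> \<le> 1"
    "\<bar>integral\<^sup>L M v - m\<bar> \<le> 2 * (1 - measure M Z)"
proof -
  interpret prob_space M by fact
  have iZ: "integrable M (indicator Z :: 'a \<Rightarrow> real)"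
    using Z(1) by (simp add: integrable_indicator_iff emeasure_eq_measure)
  show iv: "integrable M (\<lambda>z. indicator Z z * v z)"
  proof (rule integrable_const_bound[of _ 1])
    show "AE z in M. norm (indicator Z z * v z) \<le> 1"
      using v(2) by (intro AE_I2) (auto simp: indicator_def)
    show "(\<lambda>z. indicator Z z * v z) \<in> borel_measurable M" using v(1) Z(1) by measurable
  qed
  have iv': "integrable M v"
    by (rule integrable_const_bound[of _ 1]) (use v in auto)
  have "\<bar>m * measure M Z\<bar> \<le> integral\<^sup>L M (\<lambda>z. \<bar>indicator Z z * v z\<bar>)"
    unfolding m by (rule integral_abs_bound)
  also have "\<dots> \<le> integral\<^sup>L M (indicator Z)"
    by (rule integral_mono) (use iv iZ v(2) in \<open>auto simp: indicator_def\<close>)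
  also have "\<dots> = measure M Z" using Z(1) by simp
  finally show m1: "\<bar>m\<bar> \<le> 1" using Z(2) by (simp add: abs_mult)
  have "\<bar>integral\<^sup>L M v - m * measure M Z\<bar> = \<bar>integral\<^sup>L M (\<lambda>z. v z - indicator Z z * v z)\<bar>"
    unfolding m by (simp add: Bochner_Integration.integral_diff[OF iv' iv])
  also have "\<dots> \<le> integral\<^sup>L M (\<lambda>z. \<bar>v z - indicator Z z * v z\<bar>)" by (rule integral_abs_bound)
  also have "\<dots> \<le> integral\<^sup>L M (\<lambda>z. 1 - indicator Z z)"
  proof (rule integral_mono)
    show "integrable M (\<lambda>z. 1 - indicator Z z :: real)"
      by (intro Bochner_Integration.integrable_diff iZ) simp
  qed (use iv iv' v(2) in \<open>auto simp: indicator_def\<close>)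
  also have "\<dots> = 1 - measure M Z"
    using Z(1) iZ by (simp add: Bochner_Integration.integral_diff prob_space)
  finally have 1: "\<bar>integral\<^sup>L M v - m * measure M Z\<bar> \<le> 1 - measure M Z" .
  have "m * measure M Z - m = - m * (1 - measure M Z)" by (simp add: algebra_simps)
  then have "\<bar>m * measure M Z - m\<bar> = \<bar>m\<bar> * (1 - measure M Z)"
    by (simp add: abs_mult)
  also have "\<dots> \<le> 1 * (1 - measure M Z)" by (rule mult_right_mono[OF m1]) simp
  finally have 2: "\<bar>m * measure M Z - m\<bar> \<le> 1 - measure M Z" by simp
  show "\<bar>integral\<^sup>L M v - m\<bar> \<le> 2 * (1 - measure M Z)"
    using 1 2 abs_triangle_ineq[of "integral\<^sup>L M v - m * measure M Z" "m * measure M Z - m"] by simp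
qed

text \<open>Each sample is chosen such that its deviation from the mean has nonpositive inner product with the
  accumulated deviation; thus the squared error grows only linearly in \<open>Q\<close>, uniformly in \<open>v\<close>.\<close>

lemma greedy_samples:
  fixes v :: "nat \<Rightarrow> 'a \<Rightarrow> real"
  assumes M: "prob_space M" and Z: "Z \<in> sets M" "0 < measure M Z"
    and v: "\<And>j. j < r \<Longrightarrow> v j \<in> borel_measurable M" "\<And>j z. j < r \<Longrightarrow> z \<in> space M \<Longrightarrow> \<bar>v j z\<bar> \<le> 1"
    and m: "\<And>j. j < r \<Longrightarrow> m j * measure M Z = integral\<^sup>L M (\<lambda>z. indicator Z z * v j z)"
  shows "\<exists>zs. length zs = Q \<and> set zs \<subseteq> Z \<and> (\<Sum>j<r. (\<Sum>z\<leftarrow>zs. v j z - m j)\<^sup>2) \<le> 4 * real r * real Q"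
proof (induction Q)
  interpret prob_space M by fact
  case 0
  show ?case by (intro exI[of _ "[]"]) simp
next
  interpret prob_space M by fact
  case (Suc Q)
  then obtain zs where zs: "length zs = Q" "set zs \<subseteq> Z" "(\<Sum>j<r. (\<Sum>z\<leftarrow>zs. v j z - m j)\<^sup>2) \<le> 4 * real r * real Q"
    by blast
  define s where "s j = (\<Sum>z\<leftarrow>zs. v j z - m j)" for j
  have iZ: "integrable M (indicator Z :: 'a \<Rightarrow> real)"
    using Z(1) by (simp add: integrable_indicator_iff emeasure_eq_measure)
  have iv: "integrable M (\<lambda>z. indicator Z z * v j z)" and m1: "\<bar>m j\<bar> \<le> 1" if j: "j < r" for j
    by (rule conditional_mean(1)[OF M Z v(1)[OF j] v(2)[OF j] m[OF j]], assumption)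
      (rule conditional_mean(2)[OF M Z v(1)[OF j] v(2)[OF j] m[OF j]])
  have eq: "indicator Z z * (\<Sum>j<r. s j * (v j z - m j)) =
      (\<Sum>j<r. s j * (indicator Z z * v j z - m j * indicator Z z))" for z
    by (simp add: sum_distrib_left algebra_simps)
  have int: "integrable M (\<lambda>z. indicator Z z * (\<Sum>j<r. s j * (v j z - m j)))"
    unfolding eq
    by (intro Bochner_Integration.integrable_sum integrable_mult_right Bochner_Integration.integrable_diff iv iZ) auto
  have "integral\<^sup>L M (\<lambda>z. indicator Z z * (\<Sum>j<r. s j * (v j z - m j))) =
      (\<Sum>j<r. s j * (integral\<^sup>L M (\<lambda>z. indicator Z z * v j z) - m j * measure M Z))"
  proof -
    have i2: "integrable M (\<lambda>z. m j * indicator Z z)" for j by (intro integrable_mult_right iZ)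
    have "integral\<^sup>L M (\<lambda>z. indicator Z z * (\<Sum>j<r. s j * (v j z - m j))) =
        (\<Sum>j<r. integral\<^sup>L M (\<lambda>z. s j * (indicator Z z * v j z - m j * indicator Z z)))"
      unfolding eq
      by (intro Bochner_Integration.integral_sum integrable_mult_right Bochner_Integration.integrable_diff iv i2) auto
    also have "\<dots> = (\<Sum>j<r. s j * (integral\<^sup>L M (\<lambda>z. indicator Z z * v j z) - m j * measure M Z))"
    proof (rule sum.cong[OF refl])
      fix j assume "j \<in> {..<r}"
      then have j: "j < r" by simp
      show "integral\<^sup>L M (\<lambda>z. s j * (indicator Z z * v j z - m j * indicator Z z)) =
          s j * (integral\<^sup>L M (\<lambda>z. indicator Z z * v j z) - m j * measure M Z)"
        using Z(1) by (simp add: Bochner_Integration.integral_diff[OF iv[OF j] i2])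
    qed
    finally show ?thesis .
  qed
  also have "\<dots> = 0" using m by simp
  finally have "integral\<^sup>L M (\<lambda>z. indicator Z z * (\<Sum>j<r. s j * (v j z - m j))) \<le> 0" by simp
  then obtain z where z: "z \<in> Z" "(\<Sum>j<r. s j * (v j z - m j)) \<le> 0"
    using exists_below_mean[OF finite_measure_axioms Z int] by blast
  have zsp: "z \<in> space M" using z(1) Z(1) sets.sets_into_space by blast
  have sq: "(v j z - m j)\<^sup>2 \<le> 4" if "j < r" for j
  proof -
    have "\<bar>v j z - m j\<bar> \<le> 2" using v(2)[OF that zsp] m1[OF that] by linarith
    then show ?thesis using power_mono[of "\<bar>v j z - m j\<bar>" 2 2] by simp
  qed
  have "(\<Sum>j<r. (\<Sum>z\<leftarrow>z # zs. v j z - m j)\<^sup>2) = (\<Sum>j<r. (s j)\<^sup>2 + 2 * (s j * (v j z - m j)) + (v j z - m j)\<^sup>2)"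
  proof (rule sum.cong[OF refl])
    fix j
    have "(p + w)\<^sup>2 = p\<^sup>2 + 2 * (p * w) + w\<^sup>2" for p w :: real by (simp add: power2_sum)
    moreover have "(\<Sum>z\<leftarrow>z # zs. v j z - m j) = s j + (v j z - m j)" unfolding s_def by simp
    ultimately show "(\<Sum>z\<leftarrow>z # zs. v j z - m j)\<^sup>2 = (s j)\<^sup>2 + 2 * (s j * (v j z - m j)) + (v j z - m j)\<^sup>2"
      by metis
  qed
  also have "\<dots> = (\<Sum>j<r. (s j)\<^sup>2) + 2 * (\<Sum>j<r. s j * (v j z - m j)) + (\<Sum>j<r. (v j z - m j)\<^sup>2)"
    by (simp add: sum.distrib sum_distrib_left)
  also have "\<dots> \<le> 4 * real r * real Q + 2 * 0 + (\<Sum>j<r. 4)"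
    using zs(3) z(2) sq unfolding s_def by (intro add_mono mult_left_mono sum_mono) auto
  also have "\<dots> = 4 * real r * real (Suc Q)" by (simp add: algebra_simps)
  finally show ?case using zs z(1) by (intro exI[of _ "z # zs"]) simp
qed

section \<open>Time averages and their weak limits\<close>

context unit_map
begin

lemma time_average_distr:
  assumes x: "x \<in> {0..1}" and N: "0 < N"
  shows "time_average f x N = distr (uniform_count_measure {..<N}) unit_borel (\<lambda>j. (f ^^ j) x)"
    (is "_ = ?D")
proof (rule measure_eqI)
  have s: "sets (time_average f x N) = sets unit_borel"
    using sets.space_closed[of unit_borel]
    by (simp add: time_average_def sets_measure_of sets.sigma_sets_eq[of unit_borel, simplified] space_restrict_space)
  then show "sets (time_average f x N) = sets ?D" by simp
  have meas: "(\<lambda>j. (f ^^ j) x) \<in> measurable (uniform_count_measure {..<N}) unit_borel"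
    by (rule measurableI) (use iter_mem[OF x] in \<open>auto simp: space_uniform_count_measure sets_uniform_count_measure space_restrict_space\<close>)
  fix A assume "A \<in> sets (time_average f x N)"
  then have A: "A \<in> sets unit_borel" unfolding s .
  have 1: "emeasure (distr (return unit_borel x) unit_borel (f ^^ j)) A = indicator A ((f ^^ j) x)" for j
  proof -
    have m: "(f ^^ j) \<in> measurable (return unit_borel x) unit_borel"
      by (rule measurable_unit(3)[OF sets_return iter_cont]) (use iter_mem in auto)
    have "emeasure (distr (return unit_borel x) unit_borel (f ^^ j)) A =
        emeasure (return unit_borel x) ((f ^^ j) -` A \<inter> {0..1})"
      by (subst emeasure_distr[OF m A]) (simp add: space_restrict_space)
    also have "\<dots> = indicator ((f ^^ j) -` A \<inter> {0..1}) x"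
      using measurable_sets[OF m A] by (intro emeasure_return) (simp add: space_restrict_space)
    finally show ?thesis using x by (simp add: indicator_def)
  qed
  have "emeasure (time_average f x N) A = (\<Sum>j<N. indicator A ((f ^^ j) x)) / of_nat N"
    unfolding emeasure_time_average[OF A] 1 ..
  also have "(\<Sum>j<N. indicator A ((f ^^ j) x) :: ennreal) = of_nat (card {j \<in> {..<N}. (f ^^ j) x \<in> A})"
    by (simp add: indicator_def sum.If_cases Int_def)
  also have "of_nat (card {j \<in> {..<N}. (f ^^ j) x \<in> A}) / of_nat N = ennreal (real (card {j \<in> {..<N}. (f ^^ j) x \<in> A}) / real N)"
    using N by (simp add: ennreal_of_nat_eq_real_of_nat divide_ennreal)
  also have "\<dots> = emeasure (uniform_count_measure {..<N}) {j \<in> {..<N}. (f ^^ j) x \<in> A}"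
    by (subst emeasure_uniform_count_measure) auto
  also have "\<dots> = emeasure ?D A"
    by (subst emeasure_distr[OF meas A]) (auto intro!: arg_cong[of _ _ "emeasure _"] simp: space_uniform_count_measure)
  finally show "emeasure (time_average f x N) A = emeasure ?D A" .
qed

lemma time_average_prob:
  assumes x: "x \<in> {0..1}" and N: "0 < N"
  shows "sets (time_average f x N) = sets unit_borel" "prob_space (time_average f x N)"
    and "continuous_on {0..1} \<phi> \<Longrightarrow> integral\<^sup>L (time_average f x N) \<phi> = birkhoff_sum f \<phi> N x / N"
proof -
  have meas: "(\<lambda>j. (f ^^ j) x) \<in> measurable (uniform_count_measure {..<N}) unit_borel"
    by (rule measurableI) (use iter_mem[OF x] in \<open>auto simp: space_uniform_count_measure sets_uniform_count_measure space_restrict_space\<close>)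
  show "sets (time_average f x N) = sets unit_borel" unfolding time_average_distr[OF assms] by simp
  show "prob_space (time_average f x N)"
    unfolding time_average_distr[OF assms] using N
    by (intro prob_space.prob_space_distr prob_space_uniform_count_measure meas) auto
  show "integral\<^sup>L (time_average f x N) \<phi> = birkhoff_sum f \<phi> N x / N" if "continuous_on {0..1} \<phi>"
    unfolding time_average_distr[OF assms]
    by (subst integral_distr[OF meas measurable_unit(2)[OF refl that]])
      (simp add: integral_uniform_count_measure birkhoff_sum_def)
qed

text \<open>The shift to \<open>Suc n\<close> avoids \<open>r 0 = 0\<close>, where the time average is not a probability measure.\<close>

lemma limit_measure_integral:
  assumes x: "x \<in> {0..1}" and r: "strict_mono r" "weakly_converges (\<lambda>n. time_average f x (r n)) \<mu>"
    and \<phi>: "continuous_on {0..1} \<phi>"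
  shows "(\<lambda>n. birkhoff_sum f \<phi> (r (Suc n)) x / r (Suc n)) \<longlonglongrightarrow> integral\<^sup>L \<mu> \<phi>"
proof -
  have "(\<lambda>n. integral\<^sup>L (time_average f x (r n)) \<phi>) \<longlonglongrightarrow> integral\<^sup>L \<mu> \<phi>"
    using r(2) \<phi> unfolding weakly_converges_def by blast
  then have "(\<lambda>n. integral\<^sup>L (time_average f x (r (Suc n))) \<phi>) \<longlonglongrightarrow> integral\<^sup>L \<mu> \<phi>" by (rule LIMSEQ_Suc)
  moreover have "r (Suc n) > 0" for n using strict_mono_less[OF r(1), of 0 "Suc n"] by auto
  ultimately show ?thesis using time_average_prob(3)[OF x _ \<phi>] by simp
qed

text \<open>The sums of \<open>\<phi>\<close> composed with \<open>f\<close> and of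
  \<open>\<phi>\<close> itself differ by two boundary terms, which vanish after division by the
  time. As for the support, the distance to \<open>X\<close> is 0 along the orbit from time
  \<open>n0\<close> on, so its integral is 0.\<close>

lemma limit_measure_invariant:
  assumes x: "x \<in> {0..1}" and \<mu>: "\<mu> \<in> limit_measures f x"
    and X: "closed X" "X \<noteq> {}" "\<And>n. n \<ge> n0 \<Longrightarrow> (f ^^ n) x \<in> X"
  shows "\<mu> \<in> invariant_measures f (X \<inter> {0..1})"
proof -
  obtain r where r: "strict_mono r" "weakly_converges (\<lambda>n. time_average f x (r n)) \<mu>"
    and s: "sets \<mu> = sets unit_borel" and p: "prob_space \<mu>"
    using \<mu> unfolding limit_measures_def by blast
  interpret prob_space \<mu> by fact
  note lim = limit_measure_integral[OF x r]
  have rN: "real (r (Suc n)) \<ge> real (Suc n)" for n using seq_suble[OF r(1), of "Suc n"] by simp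
  have bound_lim: "h \<longlonglongrightarrow> 0" if "\<And>n. \<bar>h n\<bar> \<le> B / r (Suc n)" for h :: "nat \<Rightarrow> real" and B
  proof (rule Lim_null_comparison)
    show "\<forall>\<^sub>F n in sequentially. norm (h n) \<le> \<bar>B\<bar> * inverse (real (Suc n))"
    proof (intro always_eventually allI)
      fix n
      have "norm (h n) \<le> B / r (Suc n)" using that by simp
      also have "\<dots> \<le> \<bar>B\<bar> / real (Suc n)" using rN[of n] by (intro frac_le) auto
      finally show "norm (h n) \<le> \<bar>B\<bar> * inverse (real (Suc n))" by (simp add: divide_inverse)
    qed
    show "(\<lambda>n. \<bar>B\<bar> * inverse (real (Suc n))) \<longlonglongrightarrow> 0"
      using tendsto_mult_right_zero[OF LIMSEQ_inverse_real_of_nat] by blast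
  qed
  have inv: "integral\<^sup>L \<mu> (\<lambda>y. \<phi> (f y)) = integral\<^sup>L \<mu> \<phi>" if \<phi>: "continuous_on {0..1} \<phi>" for \<phi> :: "real \<Rightarrow> real"
  proof -
    have fc: "continuous_on {0..1} (\<lambda>y. \<phi> (f y))"
      by (rule continuous_on_compose2[OF \<phi> cont]) (use maps in auto)
    have "compact (\<phi> ` {0..1})" by (rule compact_continuous_image[OF \<phi> compact_Icc])
    then obtain B where B: "\<And>y. y \<in> {0..1} \<Longrightarrow> norm (\<phi> y) \<le> B"
      by (meson bounded_iff compact_imp_bounded imageI)
    have tel: "birkhoff_sum f (\<lambda>y. \<phi> (f y)) N x - birkhoff_sum f \<phi> N x = \<phi> ((f ^^ N) x) - \<phi> x" for N
      by (induction N) (simp_all add: birkhoff_sum_def)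
    have "(\<lambda>n. birkhoff_sum f (\<lambda>y. \<phi> (f y)) (r (Suc n)) x / r (Suc n) - birkhoff_sum f \<phi> (r (Suc n)) x / r (Suc n)) \<longlonglongrightarrow> 0"
    proof (rule bound_lim)
      fix n
      have "\<bar>\<phi> ((f ^^ r (Suc n)) x) - \<phi> x\<bar> \<le> 2 * B"
        using B[OF iter_mem[OF x, of "r (Suc n)"]] B[OF x] by (simp add: abs_if split: if_splits)
      then show "\<bar>birkhoff_sum f (\<lambda>y. \<phi> (f y)) (r (Suc n)) x / r (Suc n) - birkhoff_sum f \<phi> (r (Suc n)) x / r (Suc n)\<bar> \<le> (2 * B) / r (Suc n)"
        unfolding diff_divide_distrib[symmetric] tel by (simp add: divide_right_mono)
    qed
    moreover have "(\<lambda>n. birkhoff_sum f (\<lambda>y. \<phi> (f y)) (r (Suc n)) x / r (Suc n) - birkhoff_sum f \<phi> (r (Suc n)) x / r (Suc n))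
        \<longlonglongrightarrow> integral\<^sup>L \<mu> (\<lambda>y. \<phi> (f y)) - integral\<^sup>L \<mu> \<phi>"
      by (intro tendsto_diff lim fc \<phi>)
    ultimately show ?thesis using LIMSEQ_unique by fastforce
  qed
  have fm: "f \<in> measurable \<mu> unit_borel" by (rule measurable_unit(3)[OF s cont maps])
  have dist: "distr \<mu> unit_borel f = \<mu>"
  proof (rule measure_unit_eqI)
    show "prob_space (distr \<mu> unit_borel f)" by (rule prob_space_distr[OF fm])
    show "integral\<^sup>L (distr \<mu> unit_borel f) \<phi> = integral\<^sup>L \<mu> \<phi>" if "continuous_on {0..1} \<phi>" for \<phi> :: "real \<Rightarrow> real"
      by (subst integral_distr[OF fm measurable_unit(2)[OF refl that]]) (rule inv[OF that])
  qed (use s p in auto)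
  define \<psi> where "\<psi> y = infdist y X" for y
  have \<psi>c: "continuous_on {0..1} \<psi>" unfolding \<psi>_def[abs_def] by (intro continuous_intros)
  have "integral\<^sup>L \<mu> \<psi> = 0"
  proof -
    have "(\<lambda>n. birkhoff_sum f \<psi> (r (Suc n)) x / r (Suc n)) \<longlonglongrightarrow> 0"
    proof (rule bound_lim)
      fix n
      have zero: "\<psi> ((f ^^ t) x) = 0" if "t \<ge> n0" for t unfolding \<psi>_def using X(3)[OF that] by simp
      have "birkhoff_sum f \<psi> N x \<le> birkhoff_sum f \<psi> n0 x \<and> 0 \<le> birkhoff_sum f \<psi> N x" for N
      proof -
        have nn: "0 \<le> birkhoff_sum f \<psi> N x" for N
          unfolding birkhoff_sum_def \<psi>_def by (intro sum_nonneg) (simp add: infdist_nonneg)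
        have "birkhoff_sum f \<psi> N x \<le> birkhoff_sum f \<psi> n0 x"
        proof (cases "N \<le> n0")
          case True
          then show ?thesis unfolding birkhoff_sum_def \<psi>_def
            by (intro sum_mono2) (auto simp: infdist_nonneg)
        next
          case False
          have "birkhoff_sum f \<psi> N x = birkhoff_sum f \<psi> n0 x"
            unfolding birkhoff_sum_def
            by (rule sum.mono_neutral_right) (use False zero in auto)
          then show ?thesis by simp
        qed
        then show ?thesis using nn by blast
      qed
      then show "\<bar>birkhoff_sum f \<psi> (r (Suc n)) x / r (Suc n)\<bar> \<le> birkhoff_sum f \<psi> n0 x / r (Suc n)"
        by (simp add: divide_right_mono)
    qed
    then show ?thesis using lim[OF \<psi>c] LIMSEQ_unique by blast
  qed
  moreover have "AE y in \<mu>. 0 \<le> \<psi> y" by (simp add: \<psi>_def infdist_nonneg)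
  ultimately have "AE y in \<mu>. \<psi> y = 0"
    using integral_nonneg_eq_0_iff_AE[OF integrable_unit[OF s p \<psi>c]] by simp
  then have "AE y in \<mu>. y \<in> X \<inter> {0..1}"
  proof (rule AE_mp, intro AE_I2 impI)
    fix y assume y: "y \<in> space \<mu>" "\<psi> y = 0"
    then show "y \<in> X \<inter> {0..1}"
      using in_closed_iff_infdist_zero[OF X(1,2)] measurable_unit(1)[OF s] unfolding \<psi>_def by auto
  qed
  moreover have "X \<inter> {0..1} \<in> sets \<mu>"
    unfolding s sets_restrict_space using X(1) by (auto intro!: image_eqI[of _ _ X])
  ultimately have "emeasure \<mu> (X \<inter> {0..1}) = 1" by (intro emeasure_eq_1_AE)
  then show ?thesis unfolding invariant_measures_def using s p dist by blast
qed

end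

section \<open>Approximation of invariant measures\<close>

lemma birkhoff_sum_blocks:
  assumes s: "0 < s"
  shows "birkhoff_sum f \<phi> (s * T) y = s * birkhoff_sum (f ^^ s) (\<lambda>y. birkhoff_sum f \<phi> s y / s) T y"
proof (induction T)
  case 0
  show ?case by (simp add: birkhoff_sum_def)
next
  case (Suc T)
  have "birkhoff_sum f \<phi> (s * Suc T) y = birkhoff_sum f \<phi> (s * T + s) y" by (simp add: add.commute)
  also have "\<dots> = birkhoff_sum f \<phi> (s * T) y + birkhoff_sum f \<phi> s (((f ^^ s) ^^ T) y)"
    unfolding birkhoff_sum_add funpow_mult ..
  also have "\<dots> = s * birkhoff_sum (f ^^ s) (\<lambda>y. birkhoff_sum f \<phi> s y / s) (Suc T) y"
    unfolding Suc using s by (simp add: birkhoff_sum_def distrib_left)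
  finally show ?case .
qed

text \<open>Here \<open>P\<close> is the sum over the \<open>l\<close> steps that a point near
  \<open>x\<close> takes before shadowing starts; these change an average over \<open>D\<close>
  terms by at most \<open>2 * l / D\<close>.\<close>

lemma average_prefix:
  fixes P R D l :: real
  assumes "\<bar>P\<bar> \<le> l" "\<bar>R\<bar> \<le> D" "0 < D" "0 \<le> l" "2 * l \<le> e * D"
  shows "\<bar>(P + R) / (l + D) - R / D\<bar> \<le> e"
proof -
  have "(P + R) / (l + D) - R / D = (P * D - l * R) / ((l + D) * D)"
    using assms by (simp add: field_simps)
  also have "\<bar>\<dots>\<bar> \<le> (l * D + l * D) / ((l + D) * D)"
  proof -
    have "\<bar>P * D - l * R\<bar> \<le> \<bar>P\<bar> * D + l * \<bar>R\<bar>"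
      using abs_triangle_ineq4[of "P * D" "l * R"] assms by (simp add: abs_mult)
    also have "\<dots> \<le> l * D + l * D"
      using assms by (intro add_mono mult_right_mono mult_left_mono) auto
    finally have *: "\<bar>P * D - l * R\<bar> \<le> l * D + l * D" .
    have "0 < (l + D) * D" using assms by simp
    then show ?thesis using divide_right_mono[OF *, of "(l + D) * D"] unfolding abs_divide by simp
  qed
  also have "l * D + l * D = (2 * l) * D" by simp
  also have "(2 * l) * D / ((l + D) * D) = (2 * l) / (l + D)" using assms(3) by simp
  also have "\<dots> \<le> (2 * l) / D" using assms by (intro divide_left_mono) auto
  also have "\<dots> \<le> e" using assms by (simp add: field_simps)
  finally show ?thesis .
qed

lemma sum_list_abs_diff_le:
  fixes g h :: "'a \<Rightarrow> real"
  assumes "\<And>z. z \<in> set zs \<Longrightarrow> \<bar>g z - h z\<bar> \<le> B"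
  shows "\<bar>(\<Sum>z\<leftarrow>zs. g z) - (\<Sum>z\<leftarrow>zs. h z)\<bar> \<le> real (length zs) * B"
  using assms
proof (induction zs)
  case (Cons z zs)
  have "\<bar>g z - h z\<bar> \<le> B" by (rule Cons.prems) simp
  moreover have "\<bar>(\<Sum>z\<leftarrow>zs. g z) - (\<Sum>z\<leftarrow>zs. h z)\<bar> \<le> real (length zs) * B"
    by (rule Cons.IH) (use Cons.prems in simp)
  ultimately show ?case by (simp add: algebra_simps)
qed simp

text \<open>The collars exclude the endpoints and shrink to the empty set, so their measure tends to
  0 even if the endpoints carry mass. In the application the \<open>h i\<close> are the iterates
  that bring a sample into the interval.\<close>

lemma small_collars:
  fixes B :: nat
  assumes M: "sets M = sets unit_borel" "prob_space M" and \<epsilon>: "0 < \<epsilon>"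
    and h: "\<And>i. i \<le> B \<Longrightarrow> continuous_on {0..1} (h i :: real \<Rightarrow> real)"
  obtains n0 where "\<And>n. n \<ge> (n0::nat) \<Longrightarrow>
    measure M (\<Union>i\<le>B. {z \<in> {0..1}. h i z \<in> {\<alpha><..<\<alpha> + 1 / (real n + 1)} \<union> {\<beta> - 1 / (real n + 1)<..<\<beta>}}) < \<epsilon>"
proof -
  interpret prob_space M by fact
  have sp: "space M = {0..1}" by (rule measurable_unit(1)[OF M(1)])
  define U where "U n = {\<alpha><..<\<alpha> + 1 / (real n + 1)} \<union> {\<beta> - 1 / (real n + 1)<..<\<beta>}" for n :: nat
  define D where "D i n = {z \<in> {0..1}. h i z \<in> U n}" for i n
  have D_sets: "D i n \<in> sets M" if "i \<le> B" for i n
  proof -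
    have "h i -` U n \<inter> space M \<in> sets M"
      using measurable_unit(2)[OF M(1) h[OF that]] by (rule measurable_sets) (simp add: U_def)
    moreover have "h i -` U n \<inter> space M = D i n" unfolding D_def sp by blast
    ultimately show ?thesis by simp
  qed
  have dec: "decseq (D i)" for i
  proof (rule decseq_SucI)
    fix n
    have "1 / (real (Suc n) + 1) \<le> 1 / (real n + 1)" by (simp add: frac_le)
    then have "U (Suc n) \<subseteq> U n" unfolding U_def by auto
    then show "D i (Suc n) \<subseteq> D i n" unfolding D_def by blast
  qed
  have small: "\<exists>n. 1 / (real n + 1) \<le> e" if "0 < e" for e :: real
  proof -
    obtain n :: nat where "1 / e < real n" using reals_Archimedean2 by blast
    then have "1 / e < real n + 1" by simp
    then show ?thesis using that by (intro exI[of _ n]) (simp add: field_simps)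
  qed
  have empty: "(\<Inter>n. D i n) = {}" for i
  proof -
    have "\<exists>n. y \<notin> U n" for y
    proof -
      obtain n1 where n1: "\<alpha> < y \<Longrightarrow> 1 / (real n1 + 1) \<le> y - \<alpha>" using small[of "y - \<alpha>"] by auto
      obtain n2 where n2: "y < \<beta> \<Longrightarrow> 1 / (real n2 + 1) \<le> \<beta> - y" using small[of "\<beta> - y"] by auto
      define n where "n = max n1 n2"
      have "1 / (real n + 1) \<le> 1 / (real n1 + 1)" "1 / (real n + 1) \<le> 1 / (real n2 + 1)"
        unfolding n_def by (simp_all add: frac_le)
      then have "y \<notin> U n" using n1 n2 unfolding U_def by force
      then show ?thesis by blast
    qed
    then show ?thesis unfolding D_def by blast
  qed
  have "(\<lambda>n. measure M (D i n)) \<longlonglongrightarrow> 0" if "i \<le> B" for i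
    using finite_Lim_measure_decseq[OF _ dec[of i]] D_sets[OF that] empty[of i] by auto
  then have "(\<lambda>n. \<Sum>i\<le>B. measure M (D i n)) \<longlonglongrightarrow> (\<Sum>i\<le>B. 0)"
    by (intro tendsto_sum) auto
  then obtain n0 where n0: "\<And>n. n \<ge> n0 \<Longrightarrow> \<bar>\<Sum>i\<le>B. measure M (D i n)\<bar> < \<epsilon>"
    using \<epsilon> unfolding lim_sequentially dist_real_def by auto
  have "measure M (\<Union>i\<le>B. D i n) < \<epsilon>" if "n \<ge> n0" for n
  proof -
    have "measure M (\<Union>i\<in>{..B}. D i n) \<le> (\<Sum>i\<in>{..B}. measure M (D i n))"
      by (rule finite_measure_subadditive_finite) (auto intro: D_sets)
    then show ?thesis using n0[OF that] by linarith
  qed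
  then show thesis using that unfolding D_def U_def by blast
qed

context unit_map
begin

lemma eventually_in_orb:
  assumes per: "weakly_periodic f I k" and "(f ^^ n0) x \<in> I" "n0 \<le> n"
  shows "(f ^^ n) x \<in> (f ^^ (n - n0)) ` I" "(f ^^ n) x \<in> orb f I k"
proof -
  have "(f ^^ n) x = (f ^^ (n - n0)) ((f ^^ n0) x)"
    using assms(3) by (metis comp_apply funpow_add le_add_diff_inverse2)
  then show *: "(f ^^ n) x \<in> (f ^^ (n - n0)) ` I" using assms(2) by blast
  show "(f ^^ n) x \<in> orb f I k"
    unfolding weakly_periodic_orb[OF per, symmetric] using * by blast
qed

text \<open>The limit set contains the interval, so the orbit visits all its subintervals at late
  times. After a first visit further ones occur only at multiples of \<open>k\<close>, so the orbit
  of the return map is dense too.\<close>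

lemma periodic_transitive:
  assumes per: "periodic_interval f {a..b} k" and ab: "a < b"
    and om: "omega_limit f x = orb f {a..b} k"
  obtains n0 where "(f ^^ n0) x \<in> {a..b}" "transitive_map (f ^^ k) a b ((f ^^ n0) x)"
proof -
  have wp: "weakly_periodic f {a..b} k" by (rule periodic_imp_weakly_periodic[OF per])
  note D = weakly_periodicD[OF wp]
  have I_om: "{a..b} \<subseteq> omega_limit f x" unfolding om orb_def using D(4) by force
  have visit: "\<exists>n\<ge>N. (f ^^ n) x \<in> {c<..<d}" if cd: "a \<le> c" "c < d" "d \<le> b" for c d N
  proof -
    have "(c + d) / 2 \<in> omega_limit f x" using I_om cd by auto
    then obtain n where n: "n \<ge> N" "\<bar>(f ^^ n) x - (c + d) / 2\<bar> < (d - c) / 2"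
      using cd unfolding omega_limit_iff by (metis diff_gt_0_iff_gt half_gt_zero)
    have "(f ^^ n) x \<in> {c<..<d}" using n(2) by (auto simp: abs_if field_simps split: if_splits)
    then show ?thesis using n(1) by blast
  qed
  obtain n0 where n0: "(f ^^ n0) x \<in> {a<..<b}" using visit[of a b 0] ab by auto
  then have x0: "(f ^^ n0) x \<in> {a..b}" by simp
  have "transitive_map (f ^^ k) a b ((f ^^ n0) x)"
  proof (unfold_locales)
    show "continuous_on {a..b} (f ^^ k)" by (rule continuous_on_subset[OF iter_cont D(1)])
    show "(f ^^ k) \<in> {a..b} \<rightarrow> {a..b}" using D(5) by blast
    show "a < b" by (rule ab)
    show "(f ^^ n0) x \<in> {a..b}" by (rule x0)
    fix c d N assume cd: "a \<le> c" "c < d" "d \<le> b"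
    obtain n where n: "n \<ge> n0 + k * N" "(f ^^ n) x \<in> {c<..<d}" using visit[OF cd] by blast
    have le: "n0 \<le> n" using n(1) by simp
    have "(f ^^ n) x \<in> (f ^^ 0) ` {a..b}" using n(2) cd by simp
    then have "(f ^^ (n - n0)) ` {a..b} \<inter> (f ^^ 0) ` {a..b} \<noteq> {}"
      using eventually_in_orb(1)[OF wp x0 le] by blast
    then have "(n - n0) mod k = 0 mod k" by (rule weakly_periodic_disjoint[OF wp])
    then obtain j where j: "n - n0 = k * j" by auto
    have "(f ^^ n) x = (f ^^ (n - n0)) ((f ^^ n0) x)"
      using le by (metis comp_apply funpow_add le_add_diff_inverse2)
    then have "(f ^^ n) x = ((f ^^ k) ^^ j) ((f ^^ n0) x)" unfolding j funpow_mult .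
    moreover have "j \<ge> N"
    proof -
      have "k * N \<le> k * j" using n(1) j by linarith
      then show ?thesis using D(4) by simp
    qed
    ultimately show "\<exists>n\<ge>N. ((f ^^ k) ^^ n) ((f ^^ n0) x) \<in> {c<..<d}"
      using n(2) by (intro exI[of _ j]) simp
  qed
  then show thesis using that x0 by blast
qed

text \<open>If the \<open>l\<close>-th image of the neighbourhood were a single point, the meeting
  of two images would make the orbit of \<open>x\<close> eventually periodic and its limit set
  finite. So this connected image contains a segment on at least one side of
  \<open>(f ^^ l) x\<close>.\<close>

lemma near_image_interval:
  assumes x: "x \<in> {0..1}" and rec: "recurrent_near x" and inf: "infinite (omega_limit f x)"
    and \<delta>: "0 < \<delta>" and l: "(f ^^ l) x \<in> {\<alpha><..<\<beta>}"
  obtains c d where "\<alpha> \<le> c" "c < d" "d \<le> \<beta>" "{c..d} \<subseteq> (f ^^ l) ` near x \<delta>"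
proof -
  define A where "A = (f ^^ l) ` near x \<delta>"
  define p where "p = (f ^^ l) x"
  have pA: "p \<in> A" unfolding A_def p_def using near_center[OF x \<delta>] by blast
  have conn: "connected A" unfolding A_def by (rule iter_connected[OF near_subset near_connected])
  have "\<exists>p'\<in>A. p' \<noteq> p"
  proof (rule ccontr)
    assume "\<not> ?thesis"
    then have "\<forall>w\<in>A. w = p" by blast
    then have const: "(f ^^ l) u = p" if u: "u \<in> near x \<delta>" for u
      unfolding A_def using imageI[OF u, of "f ^^ l"] by (rule bspec)
    have "\<exists>m n. m < n \<and> (f ^^ m) ` near x \<delta> \<inter> (f ^^ n) ` near x \<delta> \<noteq> {}"
      using rec[unfolded recurrent_near_def, rule_format, OF \<delta>] .
    then obtain m n where mn: "m < n" "(f ^^ m) ` near x \<delta> \<inter> (f ^^ n) ` near x \<delta> \<noteq> {}"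
      by (elim exE conjE)
    then obtain w where w: "w \<in> (f ^^ m) ` near x \<delta>" "w \<in> (f ^^ n) ` near x \<delta>" by blast
    obtain u where u: "u \<in> near x \<delta>" "w = (f ^^ m) u" using w(1) by (rule imageE)
    obtain v where v: "v \<in> near x \<delta>" "w = (f ^^ n) v" using w(2) by (rule imageE)
    have uv: "u \<in> near x \<delta>" "v \<in> near x \<delta>" "(f ^^ m) u = (f ^^ n) v" using u v by auto
    have "(f ^^ l) ((f ^^ m) u) = (f ^^ l) ((f ^^ n) v)" using uv(3) by simp
    moreover have swap: "(f ^^ l) ((f ^^ i) w) = (f ^^ i) ((f ^^ l) w)" for i w
      by (metis add.commute comp_apply funpow_add)
    ultimately have "(f ^^ m) p = (f ^^ n) p" using const uv(1,2) by simp
    then have per: "(f ^^ (m + l)) x = (f ^^ (n + l)) x" unfolding p_def funpow_add comp_apply .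
    have fin: "(f ^^ t) x \<in> (\<lambda>t. (f ^^ t) x) ` {..<n + l}" for t
    proof (induction t rule: less_induct)
      case (less t)
      show ?case
      proof (cases "t < n + l")
        case False
        then have "(f ^^ t) x = (f ^^ (t - (n + l))) ((f ^^ (n + l)) x)"
          by (metis comp_apply funpow_add le_add_diff_inverse2 not_less)
        also have "\<dots> = (f ^^ (t - (n + l))) ((f ^^ (m + l)) x)" by (simp only: per)
        also have "\<dots> = (f ^^ (t - (n + l) + (m + l))) x" by (simp only: funpow_add comp_apply)
        finally show ?thesis using less[of "t - (n + l) + (m + l)"] False mn(1) by simp
      qed blast
    qed
    have "omega_limit f x \<subseteq> (\<lambda>t. (f ^^ t) x) ` {..<n + l}"
      by (rule omega_subset_closed[of _ 0]) (use fin in \<open>auto intro: finite_imp_closed\<close>)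
    then show False using inf finite_subset by blast
  qed
  then obtain p' where p': "p' \<in> A" "p' \<noteq> p" by blast
  have seg: "{c..d} \<subseteq> A" if "c \<in> A" "d \<in> A" for c d
    using connectedD_interval[OF conn that] by auto
  show thesis
  proof (cases "p < p'")
    case True
    show thesis
    proof (rule that[of p "min p' \<beta>"])
      show "{p..min p' \<beta>} \<subseteq> (f ^^ l) ` near x \<delta>"
        using seg[OF pA p'(1)] unfolding A_def by (rule order_trans[rotated]) auto
    qed (use l True in \<open>auto simp: p_def\<close>)
  next
    case False
    show thesis
    proof (rule that[of "max p' \<alpha>" p])
      show "{max p' \<alpha>..p} \<subseteq> (f ^^ l) ` near x \<delta>"
        using seg[OF p'(1) pA] unfolding A_def by (rule order_trans[rotated]) auto
    qed (use l False p'(2) in \<open>auto simp: p_def\<close>)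
  qed
qed

lemma integral_birkhoff_sum:
  assumes s: "sets \<mu> = sets unit_borel" and p: "prob_space \<mu>" and inv: "distr \<mu> unit_borel f = \<mu>"
    and \<phi>: "continuous_on {0..1} \<phi>"
  shows "continuous_on {0..1} (birkhoff_sum f \<phi> n)" "integral\<^sup>L \<mu> (birkhoff_sum f \<phi> n) = n * integral\<^sup>L \<mu> \<phi>"
proof -
  have c: "continuous_on {0..1} (\<lambda>y. \<phi> ((f ^^ t) y))" for t
    by (rule continuous_on_compose2[OF \<phi> iter_cont]) (use iter_mem in auto)
  have eq: "birkhoff_sum f \<phi> n = (\<lambda>y. \<Sum>t<n. \<phi> ((f ^^ t) y))" by (simp add: birkhoff_sum_def fun_eq_iff)
  show "continuous_on {0..1} (birkhoff_sum f \<phi> n)" unfolding eq by (intro continuous_on_sum c)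
  have fm: "f \<in> measurable \<mu> unit_borel" by (rule measurable_unit(3)[OF s cont maps])
  have step: "integral\<^sup>L \<mu> (\<lambda>y. \<psi> (f y)) = integral\<^sup>L \<mu> \<psi>" if "continuous_on {0..1} \<psi>" for \<psi> :: "real \<Rightarrow> real"
    using integral_distr[OF fm measurable_unit(2)[OF refl that]] unfolding inv by simp
  have "integral\<^sup>L \<mu> (\<lambda>y. \<phi> ((f ^^ t) y)) = integral\<^sup>L \<mu> \<phi>" for t
  proof (induction t)
    case (Suc t)
    have "integral\<^sup>L \<mu> (\<lambda>y. \<phi> ((f ^^ t) (f y))) = integral\<^sup>L \<mu> (\<lambda>y. \<phi> ((f ^^ t) y))" by (rule step[OF c])
    then show ?case using Suc by (simp add: funpow_swap1)
  qed simp
  then show "integral\<^sup>L \<mu> (birkhoff_sum f \<phi> n) = n * integral\<^sup>L \<mu> \<phi>"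
    unfolding eq by (subst Bochner_Integration.integral_sum) (auto intro: integrable_unit[OF s p c])
qed

text \<open>The error splits into \<open>\<epsilon>\<close> for the first \<open>l\<close> steps,
  \<open>\<epsilon>\<close> for shadowing, \<open>2 * \<epsilon>\<close> for moving samples away
  from the endpoints, \<open>\<epsilon>\<close> for the finite number of samples and
  \<open>2 * \<epsilon>\<close> for the discarded mass. Invariance of the measure allows each
  function to be replaced by its average over \<open>s * n\<close> steps.\<close>

lemma approximate_invariant_measure:
  fixes \<phi> :: "nat \<Rightarrow> real \<Rightarrow> real" and \<epsilon> \<delta> :: real
  assumes x: "x \<in> {0..1}" and rec: "recurrent_near x"
    and per: "periodic_interval f I k" and om: "omega_limit f x = orb f I k"
    and \<mu>: "\<mu> \<in> invariant_measures f (orb f I k)"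
    and \<phi>: "\<And>j. j < r \<Longrightarrow> continuous_on {0..1} (\<phi> j)" "\<And>j y. j < r \<Longrightarrow> y \<in> {0..1} \<Longrightarrow> \<bar>\<phi> j y\<bar> \<le> 1"
    and \<epsilon>: "0 < \<epsilon>" "\<epsilon> < 1" and \<delta>: "0 < \<delta>"
  shows "\<exists>y\<in>near x \<delta>. \<exists>N\<ge>N0. 0 < N \<and> (\<forall>j<r. \<bar>birkhoff_sum f (\<phi> j) N y / N - integral\<^sup>L \<mu> (\<phi> j)\<bar> \<le> 7 * \<epsilon>)"
proof -
  obtain a b where ab: "0 \<le> a" "a < b" "b \<le> 1" "I = {a..b}"
    using per unfolding periodic_interval_def by blast
  have wp: "weakly_periodic f I k" by (rule periodic_imp_weakly_periodic[OF per])
  note D = weakly_periodicD[OF wp]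
  have Iom: "I \<subseteq> omega_limit f x" unfolding om orb_def using D(4) by force
  have inf: "infinite (omega_limit f x)"
    using finite_subset[OF Iom] infinite_Icc[OF ab(2)] unfolding ab(4) by blast
  have s\<mu>: "sets \<mu> = sets unit_borel" and p\<mu>: "prob_space \<mu>" and \<mu>orb: "emeasure \<mu> (orb f I k) = 1"
    and inv: "distr \<mu> unit_borel f = \<mu>"
    using \<mu> unfolding invariant_measures_def by auto
  interpret P: prob_space \<mu> by (rule p\<mu>)
  have sp: "space \<mu> = {0..1}" by (rule measurable_unit(1)[OF s\<mu>])

  obtain n0 where n0: "(f ^^ n0) x \<in> {a..b}" "transitive_map (f ^^ k) a b ((f ^^ n0) x)"
    using periodic_transitive[of a b k x] per om ab(2) unfolding ab(4) by blast
  interpret tr: transitive_map "f ^^ k" a b "(f ^^ n0) x" by (rule n0(2))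
  obtain s' \<beta> q where s': "0 < s'" and \<beta>: "\<beta> \<le> b" and cov: "covering_map ((f ^^ k) ^^ s') a \<beta> q"
    and half: "\<forall>z\<in>{a..b}. z \<in> {a..\<beta>} \<or> (f ^^ k) z \<in> {a..\<beta>}"
    using tr.covering_power by blast
  define s where "s = k * s'"
  define u where "u = f ^^ s"
  have s: "0 < s" using s' D(4) unfolding s_def by simp
  have "covering_map u a \<beta> q" using cov unfolding u_def s_def funpow_mult .
  then interpret cm: covering_map u a \<beta> q .
  have Y01: "{a..\<beta>} \<subseteq> {0..1}" using ab \<beta> by auto

  have bs_cont: "continuous_on {0..1} (birkhoff_sum f (\<phi> j) n)" if "j < r" for j n
    by (rule integral_birkhoff_sum(1)[OF s\<mu> p\<mu> inv \<phi>(1)[OF that]])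
  have bs_bound: "\<bar>birkhoff_sum f (\<phi> j) n y\<bar> \<le> real n * 1" if "j < r" "y \<in> {0..1}" for j n y
    by (rule birkhoff_sum_bound) (rule \<phi>(2)[OF that(1) iter_mem[OF that(2)]])
  define \<Phi> where "\<Phi> j = (\<lambda>y. birkhoff_sum f (\<phi> j) s y / s)" for j
  have \<Phi>c: "continuous_on {a..\<beta>} (\<Phi> j)" if "j < r" for j
    unfolding \<Phi>_def using s
    by (intro continuous_on_divide continuous_on_const continuous_on_subset[OF bs_cont[OF that] Y01]) auto
  have \<Phi>b: "\<bar>\<Phi> j y\<bar> \<le> 1" if "j < r" "y \<in> {a..\<beta>}" for j y
  proof -
    have "y \<in> {0..1}" using that(2) Y01 by blast
    then show ?thesis using bs_bound[OF that(1), of y s] s unfolding \<Phi>_def by (simp add: field_simps)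
  qed
  have blocks: "birkhoff_sum f (\<phi> j) (s * T) y = s * birkhoff_sum u (\<Phi> j) T y" for j T y
    unfolding u_def \<Phi>_def by (rule birkhoff_sum_blocks[OF s])

  \<comment> \<open>At most \<open>k\<close> steps lead into \<open>I\<close>, and another
    \<open>k\<close> into the part of it on which \<open>u\<close> covers.\<close>
  have reach: "\<exists>i\<le>2 * k. (f ^^ i) z \<in> {a..\<beta>}" if z: "z \<in> orb f I k" for z
  proof -
    obtain i where i: "i < k" "z \<in> (f ^^ i) ` I" using z unfolding orb_def by blast
    have "(f ^^ (k - i)) z \<in> (f ^^ (k - i)) ` (f ^^ i) ` I" using i(2) by (rule imageI)
    then have z1: "(f ^^ (k - i)) z \<in> {a..b}"
      unfolding funpow_image_add[symmetric] using i(1) D(5) ab(4) by auto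
    show ?thesis
    proof (cases "(f ^^ (k - i)) z \<in> {a..\<beta>}")
      case True
      then show ?thesis by (intro exI[of _ "k - i"]) simp
    next
      case False
      then have "(f ^^ k) ((f ^^ (k - i)) z) \<in> {a..\<beta>}" using half z1 by blast
      then have "(f ^^ (k + (k - i))) z \<in> {a..\<beta>}" by (simp only: funpow_add comp_apply)
      then show ?thesis by (intro exI[of _ "k + (k - i)"]) simp
    qed
  qed

  obtain \<eta>a na where ca: "0 < \<eta>a" "\<forall>n\<ge>na. \<exists>w\<in>{a + \<eta>a..\<beta> - \<eta>a}. \<forall>j<r.
      \<bar>birkhoff_sum u (\<Phi> j) n w - birkhoff_sum u (\<Phi> j) n a\<bar> \<le> \<epsilon> * n"
    using cm.interior_companion[where \<Phi> = \<Phi> and r = r and c = a, OF \<Phi>c \<Phi>b \<epsilon>(1)] by blast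
  obtain \<eta>b nb where cb: "0 < \<eta>b" "\<forall>n\<ge>nb. \<exists>w\<in>{a + \<eta>b..\<beta> - \<eta>b}. \<forall>j<r.
      \<bar>birkhoff_sum u (\<Phi> j) n w - birkhoff_sum u (\<Phi> j) n \<beta>\<bar> \<le> \<epsilon> * n"
    using cm.interior_companion[where \<Phi> = \<Phi> and r = r and c = \<beta>, OF \<Phi>c \<Phi>b \<epsilon>(1)] by blast

  obtain nc where nc: "\<And>n. n \<ge> (nc::nat) \<Longrightarrow> measure \<mu> (\<Union>i\<le>2 * k. {z \<in> {0..1}.
      (f ^^ i) z \<in> {a<..<a + 1 / (real n + 1)} \<union> {\<beta> - 1 / (real n + 1)<..<\<beta>}}) < \<epsilon>"
    using small_collars[OF s\<mu> p\<mu> \<epsilon>(1), of "2 * k" "\<lambda>i. f ^^ i" a \<beta>] iter_cont by blast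
  \<comment> \<open>Halving makes \<open>g\<close> strictly smaller than the distances from
    \<open>q\<close> to the endpoints.\<close>
  define g where "g = min (min \<eta>a \<eta>b) (min (q - a) (\<beta> - q)) / 2"
  have g: "0 < g" "g \<le> \<eta>a" "g \<le> \<eta>b" "g < q - a" "g < \<beta> - q"
    using ca(1) cb(1) cm.q unfolding g_def by (auto simp: min_def)
  obtain ng :: nat where ng: "1 / g < real ng" using reals_Archimedean2 by blast
  define n1 where "n1 = max nc ng"
  define \<eta> where "\<eta> = 1 / (real n1 + 1)"
  have "1 / g < real n1 + 1" using ng unfolding n1_def by simp
  then have "\<eta> \<le> g" unfolding \<eta>_def using g(1) by (simp add: field_simps)
  then have \<eta>: "0 < \<eta>" "\<eta> \<le> \<eta>a" "\<eta> \<le> \<eta>b" "a + \<eta> < q" "q < \<beta> - \<eta>"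
    using g unfolding \<eta>_def by auto
  define bad where "bad = (\<Union>i\<le>2 * k. {z \<in> {0..1}. (f ^^ i) z \<in> {a<..<a + \<eta>} \<union> {\<beta> - \<eta><..<\<beta>}})"
  have bad: "measure \<mu> bad < \<epsilon>" using nc[of n1] unfolding bad_def \<eta>_def n1_def by simp
  have bad_sets: "bad \<in> sets \<mu>"
    unfolding bad_def
  proof (intro sets.finite_UN finite_atMost)
    fix i
    have "(f ^^ i) -` ({a<..<a + \<eta>} \<union> {\<beta> - \<eta><..<\<beta>}) \<inter> space \<mu> \<in> sets \<mu>"
      using measurable_unit(2)[OF s\<mu> iter_cont] by (rule measurable_sets) simp
    moreover have "(f ^^ i) -` ({a<..<a + \<eta>} \<union> {\<beta> - \<eta><..<\<beta>}) \<inter> space \<mu> =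
        {z \<in> {0..1}. (f ^^ i) z \<in> {a<..<a + \<eta>} \<union> {\<beta> - \<eta><..<\<beta>}}"
      unfolding sp by blast
    ultimately show "{z \<in> {0..1}. (f ^^ i) z \<in> {a<..<a + \<eta>} \<union> {\<beta> - \<eta><..<\<beta>}} \<in> sets \<mu>" by simp
  qed
  have orb_sets: "orb f I k \<in> sets \<mu>"
    using \<mu>orb by (metis emeasure_notin_sets zero_neq_one)
  define Z where "Z = orb f I k - bad"
  have Z_sets: "Z \<in> sets \<mu>" unfolding Z_def using orb_sets bad_sets by blast
  have Z_meas: "1 - \<epsilon> \<le> measure \<mu> Z"
  proof -
    have "measure \<mu> (orb f I k) = 1" using \<mu>orb by (simp add: measure_def)
    moreover have "measure \<mu> (orb f I k) \<le> measure \<mu> (Z \<union> bad)"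
      unfolding Z_def by (rule P.finite_measure_mono) (use orb_sets bad_sets in auto)
    moreover have "measure \<mu> (Z \<union> bad) \<le> measure \<mu> Z + measure \<mu> bad"
      by (rule measure_Un_le[OF Z_sets bad_sets])
    ultimately show ?thesis using bad by linarith
  qed
  have Z_pos: "0 < measure \<mu> Z" using Z_meas \<epsilon>(2) by linarith

  obtain i0 where i0: "((f ^^ k) ^^ i0) ((f ^^ n0) x) \<in> {a<..<\<beta>}"
    using tr.dense_orbit[of a \<beta> 0] \<beta> cm.q by auto
  define l where "l = k * i0 + n0"
  have l: "(f ^^ l) x \<in> {a<..<\<beta>}" using i0 unfolding funpow_mult l_def funpow_add comp_apply .
  obtain c d where cd: "a \<le> c" "c < d" "d \<le> \<beta>" "{c..d} \<subseteq> (f ^^ l) ` near x \<delta>"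
    using near_image_interval[OF x rec inf \<delta> l] by blast

  \<comment> \<open>The squared error \<open>4 * r * Q\<close> from \<open>greedy_samples\<close>
    has to be at most the square of \<open>\<epsilon> * Q\<close>. The time \<open>n2\<close> below
    depends on \<open>Q\<close>, so \<open>Q\<close> is fixed first.\<close>
  obtain Q :: nat where Q: "4 * real r / \<epsilon>\<^sup>2 + 1 < real Q" using reals_Archimedean2 by blast
  have "0 \<le> 4 * real r / \<epsilon>\<^sup>2" by simp
  then have "0 < real Q" and Q2: "4 * real r / \<epsilon>\<^sup>2 \<le> real Q"
    using Q by linarith+
  then have Q0: "0 < Q" by simp
  have Q1: "4 * real r \<le> \<epsilon>\<^sup>2 * real Q"
    using Q2 \<epsilon>(1) by (simp add: divide_le_eq mult.commute)
  obtain n2 where n2: "\<forall>n\<ge>n2. \<forall>zs. length zs = Q \<longrightarrow> set zs \<subseteq> {a + \<eta>..\<beta> - \<eta>} \<longrightarrow>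
    (\<exists>y\<in>{c..d}. \<exists>T\<ge>n. \<forall>j<r. \<bar>birkhoff_sum u (\<Phi> j) T y / T - (\<Sum>z\<leftarrow>zs. birkhoff_sum u (\<Phi> j) n z) / (real Q * real n)\<bar> \<le> \<epsilon>)"
    using cm.shadowing_average[where \<Phi> = \<Phi> and r = r, OF \<Phi>c \<Phi>b \<epsilon>(1) \<eta>(1,4,5) cd(1-3) Q0] by blast
  \<comment> \<open>The term \<open>2 * l\<close> pays for the initial steps, \<open>4 * k\<close>
    for shifting a sample by up to \<open>2 * k\<close> steps.\<close>
  obtain n3 :: nat where n3: "(2 * real l + 4 * real k) / \<epsilon> < real n3" using reals_Archimedean2 by blast
  define n where "n = na + nb + n2 + n3 + N0 + 1"
  have n: "na \<le> n" "nb \<le> n" "n2 \<le> n" "n3 \<le> n" "N0 \<le> n" "0 < n" unfolding n_def by auto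
  have "(2 * real l + 4 * real k) / \<epsilon> \<le> real n" using n3 n(4) by (meson less_imp_le less_le_trans of_nat_le_iff)
  then have lk: "2 * real l + 4 * real k \<le> \<epsilon> * real n" using \<epsilon>(1) by (simp add: field_simps)

  define v where "v j z = birkhoff_sum f (\<phi> j) (s * n) z / real (s * n)" for j z
  have sn: "0 < real (s * n)" using s n(6) by simp
  have v_cont: "continuous_on {0..1} (v j)" if "j < r" for j
    unfolding v_def[abs_def] using s n(6)
    by (intro continuous_on_divide continuous_on_const bs_cont[OF that]) auto
  have v_meas: "v j \<in> borel_measurable \<mu>" if "j < r" for j
    by (rule measurable_unit(2)[OF s\<mu> v_cont[OF that]])
  have v_bound: "\<bar>v j z\<bar> \<le> 1" if "j < r" "z \<in> space \<mu>" for j z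
    using bs_bound[OF that(1), of z "s * n"] that(2) sn unfolding sp v_def by (simp add: abs_mult divide_le_eq)
  have v_int: "integral\<^sup>L \<mu> (v j) = integral\<^sup>L \<mu> (\<phi> j)" if "j < r" for j
    unfolding v_def[abs_def] using integral_birkhoff_sum(2)[OF s\<mu> p\<mu> inv \<phi>(1)[OF that], of "s * n"] s n(6)
    by simp
  define m where "m j = integral\<^sup>L \<mu> (\<lambda>z. indicator Z z * v j z) / measure \<mu> Z" for j
  have m: "m j * measure \<mu> Z = integral\<^sup>L \<mu> (\<lambda>z. indicator Z z * v j z)" for j
    unfolding m_def using Z_pos by simp
  obtain zs where zs: "length zs = Q" "set zs \<subseteq> Z" "(\<Sum>j<r. (\<Sum>z\<leftarrow>zs. v j z - m j)\<^sup>2) \<le> 4 * real r * real Q"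
    using greedy_samples[where v = v and r = r and m = m and Q = Q, OF p\<mu> Z_sets Z_pos v_meas v_bound m] by blast

  have "\<exists>w\<in>{a + \<eta>..\<beta> - \<eta>}. \<forall>j<r. \<bar>birkhoff_sum u (\<Phi> j) n w - real n * v j z\<bar> \<le> 2 * \<epsilon> * n" if zZ: "z \<in> Z" for z
  proof -
    have z01: "z \<in> {0..1}" using sets.sets_into_space[OF Z_sets] zZ unfolding sp by blast
    obtain i where i: "i \<le> 2 * k" "(f ^^ i) z \<in> {a..\<beta>}" using reach zZ unfolding Z_def by blast
    define z' where "z' = (f ^^ i) z"
    have shift: "\<bar>birkhoff_sum u (\<Phi> j) n z' - real n * v j z\<bar> \<le> \<epsilon> * n" if j: "j < r" for j
    proof -
      have "\<bar>birkhoff_sum f (\<phi> j) (s * n) z - birkhoff_sum f (\<phi> j) (s * n) z'\<bar> \<le> 2 * real i"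
        unfolding z'_def by (rule birkhoff_sum_shift) (rule \<phi>(2)[OF j iter_mem[OF z01]])
      also have "\<dots> \<le> \<epsilon> * n" using i(1) lk by simp
      finally have 1: "\<bar>birkhoff_sum f (\<phi> j) (s * n) z - real s * birkhoff_sum u (\<Phi> j) n z'\<bar> \<le> \<epsilon> * n"
        unfolding blocks .
      have 2: "birkhoff_sum f (\<phi> j) (s * n) z = real s * (real n * v j z)"
        unfolding v_def using s n(6) by simp
      have 3: "real s * \<bar>birkhoff_sum u (\<Phi> j) n z' - real n * v j z\<bar> \<le> \<epsilon> * n"
        using 1 unfolding 2 right_diff_distrib[symmetric] abs_mult by (simp add: abs_minus_commute)
      have 4: "1 * \<bar>birkhoff_sum u (\<Phi> j) n z' - real n * v j z\<bar> \<le> real s * \<bar>birkhoff_sum u (\<Phi> j) n z' - real n * v j z\<bar>"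
        using s by (intro mult_right_mono) auto
      show ?thesis using order_trans[OF 4 3] by simp
    qed
    \<comment> \<open>The collars are open, so apart from the inner interval only the two endpoints
      remain; there the companions take over.\<close>
    have "z' \<notin> {a<..<a + \<eta>} \<union> {\<beta> - \<eta><..<\<beta>}"
      using zZ z01 i(1) unfolding Z_def bad_def z'_def by blast
    then have "z' \<in> {a + \<eta>..\<beta> - \<eta>} \<or> z' = a \<or> z' = \<beta>" using i(2) unfolding z'_def by auto
    then have "\<exists>w\<in>{a + \<eta>..\<beta> - \<eta>}. \<forall>j<r. \<bar>birkhoff_sum u (\<Phi> j) n w - birkhoff_sum u (\<Phi> j) n z'\<bar> \<le> \<epsilon> * n"
    proof (elim disjE)
      assume "z' \<in> {a + \<eta>..\<beta> - \<eta>}"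
      then show ?thesis using \<epsilon>(1) by (intro bexI[of _ z']) auto
    next
      assume z': "z' = a"
      obtain w where w: "w \<in> {a + \<eta>a..\<beta> - \<eta>a}" "\<forall>j<r. \<bar>birkhoff_sum u (\<Phi> j) n w - birkhoff_sum u (\<Phi> j) n a\<bar> \<le> \<epsilon> * n"
        using ca(2) n(1) by blast
      then show ?thesis unfolding z' using \<eta>(2) by (intro bexI[of _ w]) auto
    next
      assume z': "z' = \<beta>"
      obtain w where w: "w \<in> {a + \<eta>b..\<beta> - \<eta>b}" "\<forall>j<r. \<bar>birkhoff_sum u (\<Phi> j) n w - birkhoff_sum u (\<Phi> j) n \<beta>\<bar> \<le> \<epsilon> * n"
        using cb(2) n(2) by blast
      then show ?thesis unfolding z' using \<eta>(3) by (intro bexI[of _ w]) auto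
    qed
    then obtain w where w: "w \<in> {a + \<eta>..\<beta> - \<eta>}"
      "\<forall>j<r. \<bar>birkhoff_sum u (\<Phi> j) n w - birkhoff_sum u (\<Phi> j) n z'\<bar> \<le> \<epsilon> * n" by blast
    have "\<bar>birkhoff_sum u (\<Phi> j) n w - real n * v j z\<bar> \<le> 2 * \<epsilon> * n" if j: "j < r" for j
    proof -
      have "\<bar>birkhoff_sum u (\<Phi> j) n w - real n * v j z\<bar> \<le> \<epsilon> * n + \<epsilon> * n"
        using abs_triangle_ineq[of "birkhoff_sum u (\<Phi> j) n w - birkhoff_sum u (\<Phi> j) n z'" "birkhoff_sum u (\<Phi> j) n z' - real n * v j z"]
          w(2) j shift[OF j] by fastforce
      then show ?thesis by simp
    qed
    then show ?thesis using w(1) by blast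
  qed
  then have "\<forall>z\<in>Z. \<exists>w. w \<in> {a + \<eta>..\<beta> - \<eta>} \<and> (\<forall>j<r. \<bar>birkhoff_sum u (\<Phi> j) n w - real n * v j z\<bar> \<le> 2 * \<epsilon> * n)"
    by blast
  from bchoice[OF this] obtain \<sigma> where \<sigma>: "\<And>z. z \<in> Z \<Longrightarrow> \<sigma> z \<in> {a + \<eta>..\<beta> - \<eta>}"
    "\<And>z j. z \<in> Z \<Longrightarrow> j < r \<Longrightarrow> \<bar>birkhoff_sum u (\<Phi> j) n (\<sigma> z) - real n * v j z\<bar> \<le> 2 * \<epsilon> * n" by blast
  have "set (map \<sigma> zs) \<subseteq> {a + \<eta>..\<beta> - \<eta>}" "length (map \<sigma> zs) = Q" using \<sigma>(1) zs(1,2) by auto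
  then obtain y T where y: "y \<in> {c..d}" and T: "n \<le> T"
    and sh: "\<forall>j<r. \<bar>birkhoff_sum u (\<Phi> j) T y / T - (\<Sum>z\<leftarrow>map \<sigma> zs. birkhoff_sum u (\<Phi> j) n z) / (real Q * real n)\<bar> \<le> \<epsilon>"
    using n2 n(3) by blast
  obtain y0 where y0: "y0 \<in> near x \<delta>" "y = (f ^^ l) y0" using y cd(4) by blast
  have y001: "y0 \<in> {0..1}" using y0(1) near_subset by blast
  have y01: "y \<in> {0..1}" unfolding y0(2) by (rule iter_mem[OF y001])
  have T0: "0 < T" using T n(6) by simp
  have sT: "T \<le> s * T" using s by simp
  show ?thesis
  proof (intro bexI[OF _ y0(1)] exI[of _ "l + s * T"] conjI allI impI)
    show "N0 \<le> l + s * T" using n(5) T sT by linarith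
    show "0 < l + s * T" using T0 s by simp
    fix j assume j: "j < r"
    have E1: "\<bar>birkhoff_sum f (\<phi> j) (l + s * T) y0 / real (l + s * T) - birkhoff_sum u (\<Phi> j) T y / T\<bar> \<le> \<epsilon>"
    proof -
      have "\<bar>(birkhoff_sum f (\<phi> j) l y0 + birkhoff_sum f (\<phi> j) (s * T) y) / (real l + real (s * T)) -
          birkhoff_sum f (\<phi> j) (s * T) y / real (s * T)\<bar> \<le> \<epsilon>"
      proof (rule average_prefix)
        show "\<bar>birkhoff_sum f (\<phi> j) l y0\<bar> \<le> real l" using bs_bound[OF j y001, of l] by simp
        show "\<bar>birkhoff_sum f (\<phi> j) (s * T) y\<bar> \<le> real (s * T)" using bs_bound[OF j y01, of "s * T"] by simp
        show "0 < real (s * T)" using s T0 by simp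
        have "real n \<le> real (s * T)" using T sT by (metis le_trans of_nat_le_iff)
        then have "\<epsilon> * real n \<le> \<epsilon> * real (s * T)" using \<epsilon>(1) by (intro mult_left_mono) auto
        then show "2 * real l \<le> \<epsilon> * real (s * T)" using lk by linarith
      qed simp
      moreover have "birkhoff_sum f (\<phi> j) (s * T) y / real (s * T) = birkhoff_sum u (\<Phi> j) T y / T"
        unfolding blocks using s T0 by simp
      ultimately show ?thesis unfolding birkhoff_sum_add y0(2)[symmetric] by simp
    qed
    have E2: "\<bar>birkhoff_sum u (\<Phi> j) T y / T - (\<Sum>z\<leftarrow>zs. birkhoff_sum u (\<Phi> j) n (\<sigma> z)) / (real Q * real n)\<bar> \<le> \<epsilon>"
      using sh j by (simp add: o_def)
    have QN: "0 < real Q * real n" using Q0 n(6) by simp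
    have E3: "\<bar>(\<Sum>z\<leftarrow>zs. birkhoff_sum u (\<Phi> j) n (\<sigma> z)) / (real Q * real n) - (\<Sum>z\<leftarrow>zs. v j z) / real Q\<bar> \<le> 2 * \<epsilon>"
    proof -
      have "\<bar>(\<Sum>z\<leftarrow>zs. birkhoff_sum u (\<Phi> j) n (\<sigma> z)) - (\<Sum>z\<leftarrow>zs. real n * v j z)\<bar> \<le> real (length zs) * (2 * \<epsilon> * n)"
        by (rule sum_list_abs_diff_le) (use \<sigma>(2)[OF _ j] zs(2) in blast)
      then have "\<bar>(\<Sum>z\<leftarrow>zs. birkhoff_sum u (\<Phi> j) n (\<sigma> z)) - real n * (\<Sum>z\<leftarrow>zs. v j z)\<bar> / (real Q * real n) \<le>
          (real Q * (2 * \<epsilon> * n)) / (real Q * real n)"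
        unfolding zs(1) sum_list_const_mult using QN by (intro divide_right_mono) auto
      also have "\<dots> = 2 * \<epsilon>" using Q0 n(6) by simp
      also have "\<bar>(\<Sum>z\<leftarrow>zs. birkhoff_sum u (\<Phi> j) n (\<sigma> z)) - real n * (\<Sum>z\<leftarrow>zs. v j z)\<bar> / (real Q * real n) =
          \<bar>(\<Sum>z\<leftarrow>zs. birkhoff_sum u (\<Phi> j) n (\<sigma> z)) / (real Q * real n) - (\<Sum>z\<leftarrow>zs. v j z) / real Q\<bar>"
      proof -
        have "((\<Sum>z\<leftarrow>zs. birkhoff_sum u (\<Phi> j) n (\<sigma> z)) - real n * (\<Sum>z\<leftarrow>zs. v j z)) / (real Q * real n) =
          (\<Sum>z\<leftarrow>zs. birkhoff_sum u (\<Phi> j) n (\<sigma> z)) / (real Q * real n) - (\<Sum>z\<leftarrow>zs. v j z) / real Q"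
          using n(6) by (simp add: diff_divide_distrib)
        then show ?thesis using QN by (metis abs_divide abs_of_pos)
      qed
      finally show ?thesis .
    qed
    have E4: "\<bar>(\<Sum>z\<leftarrow>zs. v j z) / real Q - m j\<bar> \<le> \<epsilon>"
    proof -
      have "(\<Sum>z\<leftarrow>zs. v j z - m j)\<^sup>2 \<le> (\<Sum>j<r. (\<Sum>z\<leftarrow>zs. v j z - m j)\<^sup>2)"
        using member_le_sum[of j "{..<r}" "\<lambda>j. (\<Sum>z\<leftarrow>zs. v j z - m j)\<^sup>2"] j by simp
      also have "\<dots> \<le> 4 * real r * real Q" by (rule zs(3))
      also have "\<dots> \<le> (\<epsilon>\<^sup>2 * real Q) * real Q" using Q1 by (rule mult_right_mono) simp
      also have "\<dots> = (\<epsilon> * real Q)\<^sup>2" by (simp add: power2_eq_square)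
      finally have "\<bar>\<Sum>z\<leftarrow>zs. v j z - m j\<bar> \<le> \<bar>\<epsilon> * real Q\<bar>" unfolding abs_le_square_iff .
      then have "\<bar>\<Sum>z\<leftarrow>zs. v j z - m j\<bar> \<le> \<epsilon> * real Q" using \<epsilon>(1) by simp
      moreover have "(\<Sum>z\<leftarrow>zs. v j z - m j) = (\<Sum>z\<leftarrow>zs. v j z) - real Q * m j"
        by (simp add: sum_list_subtractf sum_list_triv zs(1))
      ultimately have "\<bar>(\<Sum>z\<leftarrow>zs. v j z) - real Q * m j\<bar> / real Q \<le> \<epsilon>"
        using Q0 by (simp add: divide_le_eq)
      moreover have "\<bar>(\<Sum>z\<leftarrow>zs. v j z) - real Q * m j\<bar> / real Q = \<bar>((\<Sum>z\<leftarrow>zs. v j z) - real Q * m j) / real Q\<bar>"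
        by simp
      moreover have "((\<Sum>z\<leftarrow>zs. v j z) - real Q * m j) / real Q = (\<Sum>z\<leftarrow>zs. v j z) / real Q - m j"
        using Q0 by (simp add: diff_divide_distrib)
      ultimately show ?thesis by simp
    qed
    have E5: "\<bar>integral\<^sup>L \<mu> (\<phi> j) - m j\<bar> \<le> 2 * \<epsilon>"
      using conditional_mean(3)[OF p\<mu> Z_sets Z_pos v_meas[OF j] v_bound[OF j] m] Z_meas
      unfolding v_int[OF j] by fastforce
    have chain: "\<bar>A - G\<bar> \<le> 7 * \<epsilon>"
      if "\<bar>A - B\<bar> \<le> \<epsilon>" "\<bar>B - C\<bar> \<le> \<epsilon>" "\<bar>C - D\<bar> \<le> 2 * \<epsilon>" "\<bar>D - E\<bar> \<le> \<epsilon>" "\<bar>G - E\<bar> \<le> 2 * \<epsilon>" for A B C D E G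
      using that unfolding abs_le_iff by linarith
    show "\<bar>birkhoff_sum f (\<phi> j) (l + s * T) y0 / real (l + s * T) - integral\<^sup>L \<mu> (\<phi> j)\<bar> \<le> 7 * \<epsilon>"
      by (rule chain[OF E1 E2 E3 E4 E5])
  qed
qed

end

section \<open>Generic limit measures\<close>

lemma finite_INT_openin:
  fixes n :: nat
  assumes "openin X S" "\<And>j. j < n \<Longrightarrow> openin X (S \<inter> A j)"
  shows "openin X {y \<in> S. \<forall>j<n. y \<in> A j}"
  using assms(2)
proof (induction n)
  case (Suc n)
  have "{y \<in> S. \<forall>j<Suc n. y \<in> A j} = {y \<in> S. \<forall>j<n. y \<in> A j} \<inter> (S \<inter> A n)"
    by (auto simp: less_Suc_eq)
  then show ?case using openin_Int[OF Suc.IH Suc.prems[of n]] Suc.prems by simp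
qed (use assms(1) in simp)

context unit_map
begin

text \<open>The first moments of a time average are compared with the entries of \<open>cs\<close>.
  Finite lists of rationals give countably many such sets, and the strict inequality makes them
  open.\<close>

definition averages_near :: "real list \<Rightarrow> real \<Rightarrow> nat \<Rightarrow> real set" where
  "averages_near cs e m = {y \<in> {0..1}. \<exists>N\<ge>m. 0 < N \<and>
     (\<forall>j<length cs. \<bar>birkhoff_sum f (\<lambda>t. t ^ j) N y / N - cs ! j\<bar> < e)}"

lemma averages_near_open: "openin (top_of_set {0..1}) (averages_near cs e m)"
proof -
  define A where "A N j = {y. \<bar>birkhoff_sum f (\<lambda>t. t ^ j) N y / N - cs ! j\<bar> < e}" for N j
  have A: "openin (top_of_set {0..1}) ({0..1} \<inter> A N j)" for N j
  proof -
    \<comment> \<open>Multiplication by \<open>inverse\<close> in place of division spares a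
      separate treatment of \<open>N = 0\<close>.\<close>
    have "continuous_on {0..1} (\<lambda>y. \<bar>birkhoff_sum f (\<lambda>t. t ^ j) N y * inverse (real N) - cs ! j\<bar>)"
      unfolding birkhoff_sum_def by (intro continuous_intros iter_cont)
    then have "openin (top_of_set {0..1})
        ({0..1} \<inter> (\<lambda>y. \<bar>birkhoff_sum f (\<lambda>t. t ^ j) N y * inverse (real N) - cs ! j\<bar>) -` {..<e})"
      by (rule continuous_openin_preimage_gen) simp
    then show ?thesis unfolding A_def vimage_def by (simp add: divide_inverse)
  qed
  have "averages_near cs e m = \<Union>((\<lambda>N. {y \<in> {0..1}. \<forall>j<length cs. y \<in> A N j}) ` {N. m \<le> N \<and> 0 < N})"
    unfolding averages_near_def A_def by auto
  also have "openin (top_of_set {0..1}) \<dots>"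
  proof (rule openin_Union)
    fix S assume "S \<in> (\<lambda>N. {y \<in> {0..1}. \<forall>j<length cs. y \<in> A N j}) ` {N. m \<le> N \<and> 0 < N}"
    then obtain N where "S = {y \<in> {0..1}. \<forall>j<length cs. y \<in> A N j}" by blast
    then show "openin (top_of_set {0..1}) S"
      using finite_INT_openin[OF openin_subtopology_self A] by simp
  qed
  finally show ?thesis .
qed

text \<open>Genericity is used for the second inclusion: points with nearly the right moments at
  late times exist arbitrarily close to \<open>x\<close>, so \<open>x\<close> itself has such times,
  and a diagonal choice among them gives weak convergence. The first inclusion only needs the orbit
  to end up in the closed set \<open>orb f I k\<close>.\<close>

lemma limit_measures_generic:
  assumes x: "x \<in> {0..1}" and rec: "recurrent_near x"
    and per: "periodic_interval f I k" and om: "omega_limit f x = orb f I k"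
    and gen: "\<And>cs e m. set cs \<subseteq> \<rat> \<Longrightarrow> e \<in> \<rat> \<Longrightarrow> x \<in> closure (averages_near cs e m) \<Longrightarrow> x \<in> averages_near cs e m"
  shows "limit_measures f x = invariant_measures f (orb f I k)"
proof
  have wp: "weakly_periodic f I k" by (rule periodic_imp_weakly_periodic[OF per])
  obtain a b where ab: "0 \<le> a" "a < b" "b \<le> 1" "I = {a..b}"
    using per unfolding periodic_interval_def by blast
  obtain n0 where n0: "(f ^^ n0) x \<in> I"
    using periodic_transitive[of a b k x] per om ab(2) unfolding ab(4) by blast
  have X01: "orb f I k \<subseteq> {0..1}" using omega_subset[OF x] om by simp
  show "limit_measures f x \<subseteq> invariant_measures f (orb f I k)"
  proof
    fix \<mu> assume "\<mu> \<in> limit_measures f x"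
    then have "\<mu> \<in> invariant_measures f (orb f I k \<inter> {0..1})"
    proof (rule limit_measure_invariant[OF x])
      show "closed (orb f I k)" by (rule compact_imp_closed[OF orb_compact[OF wp]])
      show "orb f I k \<noteq> {}" using omega_nonempty[OF x] om by simp
      show "(f ^^ n) x \<in> orb f I k" if "n \<ge> n0" for n by (rule eventually_in_orb(2)[OF wp n0 that])
    qed
    then show "\<mu> \<in> invariant_measures f (orb f I k)" using X01 by (simp add: Int_absorb2)
  qed
  show "invariant_measures f (orb f I k) \<subseteq> limit_measures f x"
  proof
    fix \<mu> assume \<mu>: "\<mu> \<in> invariant_measures f (orb f I k)"
    have s\<mu>: "sets \<mu> = sets unit_borel" and p\<mu>: "prob_space \<mu>"
      using \<mu> unfolding invariant_measures_def by auto
    define L where "L j = integral\<^sup>L \<mu> (\<lambda>t. t ^ j)" for j :: nat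
    \<comment> \<open>With \<open>e = 1 / (i + 1)\<close>, the error \<open>e\<close> from
      genericity and \<open>e / 2\<close> from rounding the moments to rationals stay together below
      \<open>2 * e\<close>.\<close>
    define close where "close i N \<longleftrightarrow> 0 < N \<and>
      (\<forall>j<i. \<bar>birkhoff_sum f (\<lambda>t. t ^ j) N x / N - L j\<bar> < 2 / (real i + 1))" for i N :: nat
    have close_ex: "\<exists>N\<ge>m. close i N" for i m
    proof -
      define e where "e = 1 / (real i + 1)"
      have e: "0 < e" "e \<le> 1" unfolding e_def by simp_all
      have "\<forall>j. \<exists>c. c \<in> \<rat> \<and> \<bar>c - L j\<bar> < e / 2"
      proof
        fix j
        obtain c where "c \<in> \<rat>" "L j < c" "c < L j + e / 2"
          using Rats_dense_in_real[of "L j" "L j + e / 2"] e(1) by auto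
        then show "\<exists>c. c \<in> \<rat> \<and> \<bar>c - L j\<bar> < e / 2" by (intro exI[of _ c]) auto
      qed
      from choice[OF this] obtain c where c: "\<And>j. c j \<in> \<rat>" "\<And>j. \<bar>c j - L j\<bar> < e / 2" by blast
      define cs where "cs = map c [0..<i]"
      have cs: "length cs = i" "\<And>j. j < i \<Longrightarrow> cs ! j = c j" "set cs \<subseteq> \<rat>" unfolding cs_def using c(1) by auto
      have "x \<in> closure (averages_near cs e m)"
        unfolding closure_approachable
      proof (intro allI impI)
        fix \<delta> :: real assume \<delta>: "0 < \<delta>"
        \<comment> \<open>The approximation error \<open>7 * (e / 16)\<close> and the rounding error
          \<open>e / 2\<close> together are less than \<open>e\<close>.\<close>
        have "\<exists>y\<in>near x \<delta>. \<exists>N\<ge>m. 0 < N \<and> (\<forall>j<i. \<bar>birkhoff_sum f (\<lambda>t. t ^ j) N y / N - integral\<^sup>L \<mu> (\<lambda>t. t ^ j)\<bar> \<le> 7 * (e / 16))"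
        proof (rule approximate_invariant_measure[where \<phi> = "\<lambda>j t. t ^ j", OF x rec per om \<mu>])
          show "continuous_on {0..1} (\<lambda>t::real. t ^ j)" for j by (intro continuous_intros)
          show "\<bar>y ^ j\<bar> \<le> 1" if "y \<in> {0..1}" for y :: real and j using that by (simp add: power_le_one)
        qed (use e \<delta> in auto)
        then obtain y N where y: "y \<in> near x \<delta>" "N \<ge> m" "0 < N"
          "\<And>j. j < i \<Longrightarrow> \<bar>birkhoff_sum f (\<lambda>t. t ^ j) N y / N - L j\<bar> \<le> 7 * (e / 16)"
          unfolding L_def by blast
        have "\<bar>birkhoff_sum f (\<lambda>t. t ^ j) N y / N - cs ! j\<bar> < e" if j: "j < i" for j
          using y(4)[OF j] c(2)[of j] e(1) unfolding cs(2)[OF j] abs_le_iff abs_less_iff by linarith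
        then have "y \<in> averages_near cs e m"
          unfolding averages_near_def cs(1) using y(1,2,3) near_subset by blast
        moreover have "dist y x < \<delta>" using y(1) unfolding near_def by (simp add: dist_commute)
        ultimately show "\<exists>y\<in>averages_near cs e m. dist y x < \<delta>" by blast
      qed
      moreover have "e \<in> \<rat>" unfolding e_def by simp
      ultimately have "x \<in> averages_near cs e m" using gen[OF cs(3)] by blast
      then obtain N where N: "N \<ge> m" "0 < N" "\<And>j. j < i \<Longrightarrow> \<bar>birkhoff_sum f (\<lambda>t. t ^ j) N x / N - cs ! j\<bar> < e"
        unfolding averages_near_def cs(1) by blast
      have "\<bar>birkhoff_sum f (\<lambda>t. t ^ j) N x / N - L j\<bar> < 2 / (real i + 1)" if j: "j < i" for j
      proof -
        have "2 / (real i + 1) = 2 * e" unfolding e_def by simp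
        then show ?thesis using N(3)[OF j] c(2)[of j] e(1) unfolding cs(2)[OF j] abs_less_iff by linarith
      qed
      then show ?thesis unfolding close_def using N(1,2) by blast
    qed
    have "\<exists>r. \<forall>i. close i (r i) \<and> r i < r (Suc i)"
    proof (intro dependent_nat_choice)
      show "\<exists>N. close 0 N" using close_ex by blast
      show "\<exists>N'. close (Suc i) N' \<and> N < N'" for N i
        using close_ex[of "Suc N" "Suc i"] by (meson Suc_le_lessD)
    qed
    then obtain r where r: "\<And>i. close i (r i)" "\<And>i. r i < r (Suc i)" by blast
    have sm: "strict_mono r" using r(2) by (simp add: strict_mono_Suc_iff)
    have rpos: "0 < r n" for n using r(1)[of n] unfolding close_def by blast
    have "weakly_converges (\<lambda>n. time_average f x (r n)) \<mu>"
    proof (rule weakly_converges_monomials[where ?n0.0 = 0, OF _ s\<mu> p\<mu>])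
      show "sets (time_average f x (r n)) = sets unit_borel \<and> prob_space (time_average f x (r n))" for n
        using time_average_prob(1,2)[OF x rpos] by blast
      fix j :: nat
      have c: "continuous_on {0..1} (\<lambda>t::real. t ^ j)" by (intro continuous_intros)
      have "(\<lambda>n. birkhoff_sum f (\<lambda>t. t ^ j) (r n) x / r n - L j) \<longlonglongrightarrow> 0"
      proof (rule Lim_null_comparison)
        show "\<forall>\<^sub>F n in sequentially. norm (birkhoff_sum f (\<lambda>t. t ^ j) (r n) x / r n - L j) \<le> 2 * inverse (real (Suc n))"
          unfolding eventually_sequentially
        \<comment> \<open>\<open>close n\<close> controls only the moments below \<open>n\<close>,
          so the \<open>j\<close>-th one is controlled from \<open>Suc j\<close> on.\<close>
        proof (intro exI[of _ "Suc j"] allI impI)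
          fix n assume "Suc j \<le> n"
          then have "\<bar>birkhoff_sum f (\<lambda>t. t ^ j) (r n) x / r n - L j\<bar> < 2 / (real n + 1)"
            using r(1)[of n] unfolding close_def by (simp add: Suc_le_eq)
          then show "norm (birkhoff_sum f (\<lambda>t. t ^ j) (r n) x / r n - L j) \<le> 2 * inverse (real (Suc n))"
            by (simp add: divide_inverse add.commute)
        qed
        show "(\<lambda>n. 2 * inverse (real (Suc n))) \<longlonglongrightarrow> 0"
          using tendsto_mult_right_zero[OF LIMSEQ_inverse_real_of_nat] by blast
      qed
      then have "(\<lambda>n. birkhoff_sum f (\<lambda>t. t ^ j) (r n) x / r n) \<longlonglongrightarrow> L j" by (rule LIM_zero_cancel)
      then show "(\<lambda>n. integral\<^sup>L (time_average f x (r n)) (\<lambda>t. t ^ j)) \<longlonglongrightarrow> integral\<^sup>L \<mu> (\<lambda>t. t ^ j)"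
        unfolding time_average_prob(3)[OF x rpos c] L_def .
    qed
    then show "\<mu> \<in> limit_measures f x"
      unfolding limit_measures_def using s\<mu> p\<mu> sm by blast
  qed
qed

end

theorem theorem6p2:
  fixes f :: "real \<Rightarrow> real"
  assumes "continuous_on {0..1} f"
    and "f \<in> {0..1} \<rightarrow> {0..1}"
    and "\<not> (\<exists>I. wandering_interval f I)"
  shows "\<exists>G. residual_in (top_of_set {0..1}) G \<and>
    (\<forall>x\<in>G.
       is_cycle f (omega_limit f x) \<or>
       solenoid f (omega_limit f x) \<or>
       (\<exists>I k. periodic_interval f I k \<and> omega_limit f x = orb f I k \<and>
          limit_measures f x = invariant_measures f (orb f I k)))"
proof -
  interpret unit_map f by unfold_locales (rule assms)+
  define \<H> where "\<H> = (\<lambda>(p, q, m). hits p q m) ` (\<rat> \<times> \<rat> \<times> UNIV)"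
  define \<A> where "\<A> = (\<lambda>(cs, e, m). averages_near cs e m) ` (lists \<rat> \<times> \<rat> \<times> UNIV)"
  define G where "G = {x \<in> {0..1}. \<forall>A\<in>\<H> \<union> \<A>. x \<in> closure A \<longrightarrow> x \<in> A}"
  have "countable (\<H> \<union> \<A>)"
    unfolding \<H>_def \<A>_def
    by (intro countable_Un countable_image countable_SIGMA countable_lists countable_rat countableI_type)
  moreover have "openin (top_of_set {0..1}) A" if "A \<in> \<H> \<union> \<A>" for A
    using that hits_open averages_near_open unfolding \<H>_def \<A>_def by auto
  ultimately have "residual_in (top_of_set {0..1}) G"
    unfolding G_def by (rule residual_regular)
  moreover have "is_cycle f (omega_limit f x) \<or> solenoid f (omega_limit f x) \<or>
       (\<exists>I k. periodic_interval f I k \<and> omega_limit f x = orb f I k \<and>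
          limit_measures f x = invariant_measures f (orb f I k))" if "x \<in> G" for x
  proof -
    have x: "x \<in> {0..1}" using that unfolding G_def by blast
    have gen_hits: "x \<in> hits p q m" if h: "p \<in> \<rat>" "q \<in> \<rat>" "x \<in> closure (hits p q m)" for p q m
    proof -
      have "hits p q m \<in> \<H>" unfolding \<H>_def using h(1,2) by (intro image_eqI[of _ _ "(p, q, m)"]) auto
      then show ?thesis using \<open>x \<in> G\<close> h(3) unfolding G_def by blast
    qed
    have gen_avg: "x \<in> averages_near cs e m" if h: "set cs \<subseteq> \<rat>" "e \<in> \<rat>" "x \<in> closure (averages_near cs e m)" for cs e m
    proof -
      have "averages_near cs e m \<in> \<A>" unfolding \<A>_def using h(1,2)
        by (intro image_eqI[of _ _ "(cs, e, m)"]) auto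
      then show ?thesis using \<open>x \<in> G\<close> h(3) unfolding G_def by blast
    qed
    show ?thesis
    proof (cases "recurrent_near x")
      case False
      then show ?thesis using not_recurrent_near_cycle[OF x False assms(3)] by blast
    next
      case rec: True
      show ?thesis
      proof (cases "finite (omega_limit f x)")
        case True
        then show ?thesis using finite_omega_cycle[OF x] by blast
      next
        case inf: False
        show ?thesis
        proof (cases "interior (omega_limit f x) = {}")
          case True
          have "solenoid f (omega_limit f x)" by (rule omega_solenoid[OF x rec gen_hits inf True])
          then show ?thesis by blast
        next
          case False
          then obtain I k where I: "periodic_interval f I k" "omega_limit f x = orb f I k"
            using interior_omega_orb[OF x] by blast
          have "limit_measures f x = invariant_measures f (orb f I k)"
            by (rule limit_measures_generic[OF x rec I gen_avg])
          then show ?thesis using I by blast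
        qed
      qed
    qed
  qed
  ultimately show ?thesis by blast
qed

end
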